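(* There is an algorithm that decides Tree Partitioning, and hence Balanced Tree Partitioning, in time $2^{O(\sqrt{n})}$, where $n = |V(T)|$ is the number of vertices of the input tree.
   Context: Tree Partitioning: given a tree $T$ and integers $k, b, s_1, \ldots, s_b \in \mathbb{N}$, decide whether there exists $E' \subseteq E(T)$ with $|E'| \le k$ such that the connected components of $T-E'$ can be assigned to $b$ groups so that, for each $i \in \{1,\ldots,b\}$, the components assigned to group $i$ contain exactly $s_i$ vertices in total. Balanced Tree Partitioning is the special case $s_1 = \cdots = s_b = |V(T)|/b$.
   Formalization: For Tree Partitioning, if group sizes s_i = 0 are allowed, b is not bounded in n and all sizes must be read, so the time bound is 2^{O(√n)} plus a constant for each s_i equal to 0; with positive s_i, and for Balanced Tree Partitioning, it is exactly 2^{O(√n)}. *)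

theory Defs
  imports Complex_Main "HOL-Library.Landau_Symbols"
begin

section \<open>Trees and the partitioning problems\<close>

definition simple_graph :: "'a set \<Rightarrow> 'a set set \<Rightarrow> bool" where
  "simple_graph V E \<longleftrightarrow>
     finite V \<and> (\<forall>e\<in>E. \<exists>u\<in>V. \<exists>v\<in>V. u \<noteq> v \<and> e = {u, v})"

definition reachability :: "'a set \<Rightarrow> 'a set set \<Rightarrow> 'a rel" where
  "reachability V E = {(x, y). {x, y} \<in> E}\<^sup>* \<inter> V \<times> V"

definition components :: "'a set \<Rightarrow> 'a set set \<Rightarrow> 'a set set" where
  "components V E = V // reachability V E"

definition is_cycle :: "'a set set \<Rightarrow> 'a list \<Rightarrow> bool" where
  "is_cycle E p \<longleftrightarrow> 3 \<le> length p \<and> distinct p \<and>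
     (\<forall>i<length p. {p ! i, p ! (Suc i mod length p)} \<in> E)"

definition is_tree :: "'a set \<Rightarrow> 'a set set \<Rightarrow> bool" where
  "is_tree V E \<longleftrightarrow> simple_graph V E \<and> V \<noteq> {} \<and>
     (\<forall>u\<in>V. \<forall>v\<in>V. (u, v) \<in> reachability V E) \<and> (\<nexists>p. is_cycle E p)"

text \<open>The group sizes \<open>s\<^sub>1, \<dots>, s\<^sub>b\<close> form the list \<open>ss\<close>, so that \<open>b = length ss\<close>
  and the groups are indexed from 0.\<close>

definition tree_partitioning :: "'a set \<Rightarrow> 'a set set \<Rightarrow> nat \<Rightarrow> nat list \<Rightarrow> bool" where
  "tree_partitioning V E k ss \<longleftrightarrow>
     (\<exists>E'\<subseteq>E. card E' \<le> k \<and>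
       (\<exists>g. (\<forall>C\<in>components V (E - E'). g C < length ss) \<and>
            (\<forall>i<length ss. (\<Sum>C | C \<in> components V (E - E') \<and> g C = i. card C) = ss ! i)))"

text \<open>If \<open>b\<close> does not divide the number of vertices (in particular if \<open>b = 0\<close>), then
  \<open>card V / b\<close> is not an admissible group size and the instance is a no-instance.\<close>

definition balanced_tree_partitioning :: "'a set \<Rightarrow> 'a set set \<Rightarrow> nat \<Rightarrow> nat \<Rightarrow> bool" where
  "balanced_tree_partitioning V E k b \<longleftrightarrow>
     b dvd card V \<and> tree_partitioning V E k (replicate b (card V div b))"


section \<open>Random access machines\<close>

text \<open>Structured programs for a random access machine with finitely many used registers and
  an indirectly addressed memory, all cells holding natural numbers. Every operation counts
  as one step. Since there are only addition and truncated subtraction, one step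
  increases the bit length of the largest stored number by at most one (up to the constants
  in the program), so unit cost is polynomially related to logarithmic cost.
  In particular the class of time bounds \<open>2\<close> to the power \<open>O(sqrt n)\<close> does not depend on
  this choice of machine.\<close>

type_synonym state = "(nat \<Rightarrow> nat) \<times> (nat \<Rightarrow> nat)"  \<comment> \<open>registers and memory\<close>

datatype aexp = Num nat | Reg nat | Mem aexp | Plus aexp aexp | Minus aexp aexp

datatype bexp = Less aexp aexp | Neg bexp | Conj bexp bexp

datatype com =
    Skip
  | Assign nat aexp
  | Store aexp aexp
  | Seq com com
  | Cond bexp com com
  | While bexp com

fun aval :: "aexp \<Rightarrow> state \<Rightarrow> nat" where
  "aval (Num m) s = m"
| "aval (Reg r) s = fst s r"
| "aval (Mem a) s = snd s (aval a s)"
| "aval (Plus a b) s = aval a s + aval b s"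
| "aval (Minus a b) s = aval a s - aval b s"

fun bval :: "bexp \<Rightarrow> state \<Rightarrow> bool" where
  "bval (Less a b) s \<longleftrightarrow> aval a s < aval b s"
| "bval (Neg p) s \<longleftrightarrow> \<not> bval p s"
| "bval (Conj p q) s \<longleftrightarrow> bval p s \<and> bval q s"

fun atime :: "aexp \<Rightarrow> nat" where
  "atime (Num m) = 1"
| "atime (Reg r) = 1"
| "atime (Mem a) = atime a + 1"
| "atime (Plus a b) = atime a + atime b + 1"
| "atime (Minus a b) = atime a + atime b + 1"

fun btime :: "bexp \<Rightarrow> nat" where
  "btime (Less a b) = atime a + atime b + 1"
| "btime (Neg p) = btime p + 1"
| "btime (Conj p q) = btime p + btime q + 1"

text \<open>\<open>exec c s t s'\<close>: started in \<open>s\<close>, the program \<open>c\<close> halts in \<open>s'\<close> after \<open>t\<close> steps.\<close>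

inductive exec :: "com \<Rightarrow> state \<Rightarrow> nat \<Rightarrow> state \<Rightarrow> bool" where
  Skip: "exec Skip s 1 s"
| Assign: "exec (Assign r a) s (atime a + 1) ((fst s)(r := aval a s), snd s)"
| Store: "exec (Store a b) s (atime a + atime b + 1) (fst s, (snd s)(aval a s := aval b s))"
| Seq: "exec c s t s' \<Longrightarrow> exec d s' t' s'' \<Longrightarrow> exec (Seq c d) s (t + t') s''"
| CondT: "bval p s \<Longrightarrow> exec c s t s' \<Longrightarrow> exec (Cond p c d) s (btime p + 1 + t) s'"
| CondF: "\<not> bval p s \<Longrightarrow> exec d s t s' \<Longrightarrow> exec (Cond p c d) s (btime p + 1 + t) s'"
| WhileF: "\<not> bval p s \<Longrightarrow> exec (While p c) s (btime p + 1) s"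
| WhileT: "bval p s \<Longrightarrow> exec c s t s' \<Longrightarrow> exec (While p c) s' t' s'' \<Longrightarrow>
           exec (While p c) s (btime p + 1 + t + t') s''"

inductive_cases exec_SkipE: "exec Skip s t s'"
inductive_cases exec_AssignE: "exec (Assign r a) s t s'"
inductive_cases exec_StoreE: "exec (Store a b) s t s'"
inductive_cases exec_SeqE: "exec (Seq c d) s t s'"
inductive_cases exec_CondE: "exec (Cond p c d) s t s'"
inductive_cases exec_WhileE: "exec (While p c) s t s'"

lemma exec_deterministic:
  "exec c s t s' \<Longrightarrow> exec c s u s'' \<Longrightarrow> u = t \<and> s'' = s'"
proof (induction arbitrary: u s'' rule: exec.induct)
  case (Skip s)
  then show ?case by (auto elim: exec_SkipE)
next
  case (Assign r a s)
  then show ?case by (auto elim: exec_AssignE)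
next
  case (Store a b s)
  then show ?case by (auto elim: exec_StoreE)
next
  case (Seq c s t s1 d t' s2)
  from Seq.prems obtain t1 t2 s3 where "u = t1 + t2" "exec c s t1 s3" "exec d s3 t2 s''"
    by (rule exec_SeqE)
  then show ?case using Seq.IH by metis
next
  case (CondT p s c t s1 d)
  from CondT.prems CondT.hyps obtain t1 where "u = btime p + 1 + t1" "exec c s t1 s''"
    by (auto elim: exec_CondE)
  then show ?case using CondT.IH by metis
next
  case (CondF p s d t s1 c)
  from CondF.prems CondF.hyps obtain t1 where "u = btime p + 1 + t1" "exec d s t1 s''"
    by (auto elim: exec_CondE)
  then show ?case using CondF.IH by metis
next
  case (WhileF p s c)
  from WhileF.prems WhileF.hyps show ?case
    by (auto elim: exec_WhileE)
next
  case (WhileT p s c t s1 t' s2)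
  from WhileT.prems WhileT.hyps obtain t1 t2 s3
    where "u = btime p + 1 + t1 + t2" "exec c s t1 s3" "exec (While p c) s3 t2 s''"
    by (auto elim: exec_WhileE)
  then show ?case using WhileT.IH by metis
qed

definition initial_state :: "nat list \<Rightarrow> state" where
  "initial_state xs = (\<lambda>_. 0, \<lambda>i. if i < length xs then xs ! i else 0)"

text \<open>The program \<open>P\<close> decides the problem \<open>Q\<close> on the instances \<open>I\<close>, encoded by \<open>enc\<close>, in at
  most \<open>T x\<close> steps on instance \<open>x\<close>. The verdict is left in register 0.\<close>

definition decides_in_time ::
    "com \<Rightarrow> ('i \<Rightarrow> nat list) \<Rightarrow> 'i set \<Rightarrow> ('i \<Rightarrow> bool) \<Rightarrow> ('i \<Rightarrow> real) \<Rightarrow> bool" where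
  "decides_in_time P enc I Q T \<longleftrightarrow>
     (\<forall>x\<in>I. \<exists>t s. exec P (initial_state (enc x)) t s \<and> real t \<le> T x \<and>
        fst s 0 = (if Q x then 1 else 0))"


section \<open>Instances\<close>

text \<open>The input tree has vertices \<open>0, \<dots>, n - 1\<close> and is given by a list of its edges, each
  listed once, in any order and with its two ends in any order.\<close>

definition edges_of :: "(nat \<times> nat) list \<Rightarrow> nat set set" where
  "edges_of es = (\<lambda>(u, v). {u, v}) ` set es"

definition represents_tree :: "nat \<Rightarrow> (nat \<times> nat) list \<Rightarrow> bool" where
  "represents_tree n es \<longleftrightarrow>
     is_tree {..<n} (edges_of es) \<and> distinct (map (\<lambda>(u, v). {u, v}) es)"

definition flatten_edges :: "(nat \<times> nat) list \<Rightarrow> nat list" where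
  "flatten_edges es = concat (map (\<lambda>(u, v). [u, v]) es)"

type_synonym tp_instance = "nat \<times> (nat \<times> nat) list \<times> nat \<times> nat list"

definition tp_instances :: "tp_instance set" where
  "tp_instances = {(n, es, k, ss). represents_tree n es}"

definition tp_encode :: "tp_instance \<Rightarrow> nat list" where
  "tp_encode = (\<lambda>(n, es, k, ss). [n, k, length ss] @ flatten_edges es @ ss)"

definition tp_yes :: "tp_instance \<Rightarrow> bool" where
  "tp_yes = (\<lambda>(n, es, k, ss). tree_partitioning {..<n} (edges_of es) k ss)"

type_synonym btp_instance = "nat \<times> (nat \<times> nat) list \<times> nat \<times> nat"

definition btp_instances :: "btp_instance set" where
  "btp_instances = {(n, es, k, b). represents_tree n es}"

definition btp_encode :: "btp_instance \<Rightarrow> nat list" where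
  "btp_encode = (\<lambda>(n, es, k, b). [n, k, b] @ flatten_edges es)"

definition btp_yes :: "btp_instance \<Rightarrow> bool" where
  "btp_yes = (\<lambda>(n, es, k, b). balanced_tree_partitioning {..<n} (edges_of es) k b)"

text \<open>The number of groups of size 0 is not bounded in terms of \<open>n\<close>, and all of them have to be
  read before a yes-instance can be accepted. They are charged a constant amount each; for
  positive group sizes the bound is just \<open>2 powr f n\<close>.\<close>

definition tp_time :: "(nat \<Rightarrow> real) \<Rightarrow> nat \<Rightarrow> tp_instance \<Rightarrow> real" where
  "tp_time f c = (\<lambda>(n, es, k, ss). 2 powr f n + real (c * count_list ss 0))"

definition btp_time :: "(nat \<Rightarrow> real) \<Rightarrow> btp_instance \<Rightarrow> real" where
  "btp_time f = (\<lambda>(n, es, k, b). 2 powr f n)"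

end

theory Submission
  imports Defs "HOL-Library.Multiset"
begin

text \<open>Whether a set of cut edges is admissible depends only on the multiset of the sizes of the resulting components,
  which is a partition of \<open>n\<close>, and there are only \<open>2\<close> to the power \<open>O(sqrt n)\<close> partitions. Adding the vertices one
  by one along the edges orders the tree such that the last vertex is always a leaf; merging leaves into their
  neighbours in the reverse order, one computes for every vertex all pairs of the size of its open component and the
  multiset of the sizes of the components that have been cut off below it. A multiset can be distributed to the groups iff its
  elements can be lined up such that no partial sum of the group sizes falls inside an element; the multisets with
  this property are generated by appending one element at a time. Multisets are coded by numbers written in base
  \<open>n + 1\<close>, so that union of multisets is addition of codes, and a code serves as an address in a membership table, which makes
  all set operations constant-time.\<close>

section \<open>The number of partitions\<close>

text \<open>The tables are far larger than the running time permits: codes range up to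
  \<open>(n+1)^(n+2)\<close>, which is not \<open>2\<close> to the power O(sqrt n). They are
  affordable because memory starts out as zero and reserving a block is a single addition; only
  written cells cost time, and the linked lists visit only those. Combining all pairs of two tables
  squares the number of partitions, which merely changes the constant in the exponent. The same is
  true of every polynomial, so it suffices to bound the iterations of each loop by a common
  \<open>M\<close>. A pair of open size and multiset is no richer than a partition, because the
  sizes add up to the number of merged vertices. The machine can neither multiply nor divide, hence
  the stored powers of \<open>n + 1\<close> and the map from codes to open sizes. The numbers
  \<open>k\<close> and \<open>ss\<close> are not bounded in terms of \<open>n\<close>: therefore
  \<open>k\<close> is capped at \<open>n\<close>, and the reading of \<open>ss\<close> stops once
  the sum exceeds \<open>n\<close>. That reading loop is the only one not bounded by
  \<open>M\<close>, as group sizes 0 do not increase the sum.\<close>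

definition partitions_upto :: "nat \<Rightarrow> nat \<Rightarrow> nat multiset set" where
  "partitions_upto n m = {\<mu>. set_mset \<mu> \<subseteq> {1..m} \<and> sum_mset \<mu> \<le> n}"

lemma partitions_upto_0: "partitions_upto n 0 = {{#}}"
  by (auto simp: partitions_upto_def)

lemma partitions_upto_Suc:
  "partitions_upto n (Suc m) = partitions_upto n m \<union>
     (if Suc m \<le> n then add_mset (Suc m) ` partitions_upto (n - Suc m) (Suc m) else {})"
  (is "?L = ?A \<union> ?B")
proof
  show "?L \<subseteq> ?A \<union> ?B"
  proof
    fix \<mu> assume mu: "\<mu> \<in> ?L"
    show "\<mu> \<in> ?A \<union> ?B"
    proof (cases "Suc m \<in># \<mu>")
      case False
      with mu show ?thesis
        by (fastforce simp: partitions_upto_def subset_iff le_Suc_eq)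
    next
      case True
      then obtain \<nu> where nu: "\<mu> = add_mset (Suc m) \<nu>"
        by (meson mset_add)
      with mu have "Suc m \<le> n" "\<nu> \<in> partitions_upto (n - Suc m) (Suc m)"
        by (auto simp: partitions_upto_def)
      with nu show ?thesis by auto
    qed
  qed
  show "?A \<union> ?B \<subseteq> ?L"
    by (fastforce simp: partitions_upto_def split: if_splits)
qed

lemma partitions_upto_gf:
  fixes x :: real
  assumes x: "0 < x" "x < 1"
  shows "finite (partitions_upto n m) \<and>
    (\<Sum>\<mu>\<in>partitions_upto n m. x ^ sum_mset \<mu>) \<le> (\<Prod>i=1..m. 1 / (1 - x ^ i))"
proof (induction m arbitrary: n)
  case 0
  show ?case by (simp add: partitions_upto_0)
next
  case (Suc m)
  let ?A = "\<lambda>m. \<Prod>i=1..m. 1 / (1 - x ^ i)"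
  have xm: "x ^ Suc m < 1" "0 < x ^ Suc m"
    using x by (auto simp: power_less_one_iff simp del: power_Suc)
  have A: "?A (Suc m) = ?A m / (1 - x ^ Suc m)"
    by (simp add: prod.cl_ivl_Suc del: power_Suc)
  have A0: "?A m \<ge> 0"
    using x by (intro prod_nonneg) (auto simp: power_le_one)
  \<comment> \<open>The product is a fixed point of the recurrence that splits off one copy of
    \<open>Suc m\<close>; this closes the inner induction.\<close>
  have AS: "?A m + x ^ Suc m * ?A (Suc m) = ?A (Suc m)"
    unfolding A using xm by (simp add: field_simps del: power_Suc)
  show ?case
  proof (induction n rule: less_induct)
    case (less n)
    show ?case
    proof (cases "Suc m \<le> n")
      case False
      have "?A m \<le> ?A (Suc m)"
        using AS A0 xm A by (smt (verit) divide_nonneg_pos mult_nonneg_nonneg)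
      with False Suc[of n] show ?thesis by (auto simp: partitions_upto_Suc[of n m] simp del: prod.cl_ivl_Suc)
    next
      case True
      let ?P = "partitions_upto (n - Suc m) (Suc m)"
      have IH: "finite ?P" "(\<Sum>\<mu>\<in>?P. x ^ sum_mset \<mu>) \<le> ?A (Suc m)"
        using less[of "n - Suc m"] True by auto
      have eq: "partitions_upto n (Suc m) = partitions_upto n m \<union> add_mset (Suc m) ` ?P"
        using True by (simp add: partitions_upto_Suc[of n m])
      have "(\<Sum>\<mu>\<in>partitions_upto n (Suc m). x ^ sum_mset \<mu>)
          \<le> (\<Sum>\<mu>\<in>partitions_upto n m. x ^ sum_mset \<mu>) + (\<Sum>\<mu>\<in>add_mset (Suc m) ` ?P. x ^ sum_mset \<mu>)"
        unfolding eq using x Suc[of n] IH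
        by (subst sum.union_inter[symmetric]) (auto intro!: sum_nonneg)
      also have "(\<Sum>\<mu>\<in>add_mset (Suc m) ` ?P. x ^ sum_mset \<mu>) = x ^ Suc m * (\<Sum>\<mu>\<in>?P. x ^ sum_mset \<mu>)"
        by (subst sum.reindex) (auto simp: inj_on_def sum_distrib_left power_add mult.assoc)
      also have "\<dots> \<le> x ^ Suc m * ?A (Suc m)"
        using IH xm by (intro mult_left_mono) auto
      finally have "(\<Sum>\<mu>\<in>partitions_upto n (Suc m). x ^ sum_mset \<mu>) \<le> ?A (Suc m)"
        using Suc[of n] AS by linarith
      with eq IH Suc[of n] show ?thesis by auto
    qed
  qed
qed

text \<open>Each factor of the Euler product has the form \<open>1 + z\<close> with
  \<open>z = 1 / (exp u - 1)\<close>. Comparing \<open>1 + z\<close> with the square of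
  \<open>1 + sqrt z\<close> is crude for large \<open>z\<close>, but it turns the logarithm into a
  function of \<open>u\<close> with an elementary antiderivative.\<close>

lemma ln_one_plus_le_sqrt:
  fixes z :: real assumes "0 \<le> z" shows "ln (1 + z) \<le> 2 * sqrt z"
proof -
  have "1 + z \<le> (1 + sqrt z)\<^sup>2"
    using assms by (simp add: power2_sum)
  then have "ln (1 + z) \<le> ln ((1 + sqrt z)\<^sup>2)"
    using assms by (subst ln_le_cancel_iff) (auto intro: add_pos_nonneg)
  also have "\<dots> = 2 * ln (1 + sqrt z)"
    using assms by (simp add: ln_realpow add_pos_nonneg)
  also have "\<dots> \<le> 2 * sqrt z"
    using assms by (simp add: ln_add_one_self_le_self)
  finally show ?thesis .
qed

text \<open>\<open>2 * arctan (sqrt (exp u - 1))\<close> is an antiderivative of the decreasing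
  function \<open>1 / sqrt (exp u - 1)\<close>, so its increment over an interval is at least the
  width times the value at the right end.\<close>

lemma arctan_sqrt_exp_step:
  fixes u v :: real assumes "0 \<le> u" "u < v"
  shows "(v - u) / sqrt (exp v - 1) \<le> 2 * (arctan (sqrt (exp v - 1)) - arctan (sqrt (exp u - 1)))"
proof -
  let ?H = "\<lambda>u. arctan (sqrt (exp u - 1))"
  have d: "(?H has_real_derivative 1 / (2 * sqrt (exp w - 1))) (at w)" if "u < w" for w
  proof -
    have w: "0 < exp w - 1" using that assms by simp
    then have "0 < exp w - 1" "1 + (sqrt (exp w - 1))\<^sup>2 = exp w" by auto
    then show ?thesis
      by (auto intro!: derivative_eq_intros simp: field_simps)
  qed
  \<comment> \<open>At \<open>u = 0\<close> the derivative is infinite; the mean value theorem asks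
    only for continuity at the ends.\<close>
  have "continuous_on {u..v} ?H" by (intro continuous_intros)
  from mvt[OF assms(2) this, of "\<lambda>w h. (1 / (2 * sqrt (exp w - 1))) * h"]
  obtain w where w: "u < w" "w < v" "?H v - ?H u = 1 / (2 * sqrt (exp w - 1)) * (v - u)"
    using d[unfolded has_field_derivative_def] by metis
  have "1 / sqrt (exp v - 1) \<le> 1 / sqrt (exp w - 1)"
    using w assms by (intro divide_left_mono) auto
  then have "(v - u) * (1 / sqrt (exp v - 1)) \<le> (v - u) * (1 / sqrt (exp w - 1))"
    using assms by (intro mult_left_mono) auto
  then have "(v - u) / sqrt (exp v - 1) \<le> (v - u) / sqrt (exp w - 1)" by simp
  also have "\<dots> = 2 * (?H v - ?H u)"
    unfolding w(3) by (simp only: times_divide_eq_left times_divide_eq_right mult_1 mult_divide_mult_cancel_left_if) simp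
  finally show ?thesis .
qed

text \<open>The logarithms of the factors are bounded by a Riemann sum of step \<open>t\<close>,
  whose arctan increments telescope. What remains is \<open>4 / t\<close> times a single arctan,
  which is below \<open>pi / 2\<close> however many factors there are.\<close>

lemma prod_inverse_one_minus_exp_le:
  fixes t :: real assumes t: "0 < t"
  shows "(\<Prod>i=1..m. 1 / (1 - exp (- t) ^ i)) \<le> exp (2 * pi / t)"
proof -
  have fac: "1 / (1 - exp (- t) ^ i) \<le> exp (4 / t * (arctan (sqrt (exp (real i * t) - 1))
       - arctan (sqrt (exp (real (i - 1) * t) - 1))))" if "i \<in> {1..m}" for i
  proof -
    define u where "u = real i * t"
    have u: "u > 0" using that t by (simp add: u_def)
    have e: "exp u > 1" using u by simp
    have st: "real (i - 1) * t = u - t" "0 \<le> u - t"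
      using that t by (auto simp: u_def of_nat_diff algebra_simps)
    have "exp (- t) ^ i = inverse (exp u)"
      by (simp add: u_def exp_of_nat_mult[symmetric] exp_minus[symmetric])
    then have "1 / (1 - exp (- t) ^ i) = 1 + 1 / (exp u - 1)"
      using e by (simp add: divide_simps) (auto simp: algebra_simps)
    also have "\<dots> = exp (ln (1 + 1 / (exp u - 1)))"
      using e by (subst exp_ln) (auto intro: add_pos_pos)
    also have "ln (1 + 1 / (exp u - 1)) \<le> 2 * (1 / sqrt (exp u - 1))"
      using ln_one_plus_le_sqrt[of "1 / (exp u - 1)"] e by (simp add: real_sqrt_divide)
    also have "1 / sqrt (exp u - 1) \<le> 2 / t * (arctan (sqrt (exp u - 1)) - arctan (sqrt (exp (u - t) - 1)))"
      using arctan_sqrt_exp_step[of "u - t" u] st t by (simp add: field_simps)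
    finally show ?thesis unfolding st u_def[symmetric] by (simp add: algebra_simps)
  qed
  have "(\<Prod>i=1..m. 1 / (1 - exp (- t) ^ i)) \<le> (\<Prod>i=1..m. exp (4 / t * (arctan (sqrt (exp (real i * t) - 1))
       - arctan (sqrt (exp (real (i - 1) * t) - 1)))))"
    using fac t by (intro prod_mono) (auto simp: power_le_one)
  also have "\<dots> = exp (4 / t * arctan (sqrt (exp (real m * t) - 1)))"
  proof (induction m)
    case (Suc m)
    then show ?case
      by (simp add: exp_add[symmetric] algebra_simps)
  qed simp
  also have "\<dots> \<le> exp (4 / t * (pi / 2))"
    unfolding exp_le_cancel_iff using t arctan_ubound[of "sqrt (exp (real m * t) - 1)"]
    by (intro mult_left_mono) auto
  finally show ?thesis by simp
qed

lemma card_partitions_upto: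
  assumes "0 < n"
  shows "finite (partitions_upto n m)" and "real (card (partitions_upto n m)) \<le> exp (9 * sqrt (real n))"
proof -
  \<comment> \<open>Replacing \<open>?x ^ sum_mset \<mu>\<close> by \<open>?x ^ n\<close> costs a
    factor \<open>exp (t * n)\<close>, and the Euler product costs \<open>exp (2 * pi / t)\<close>.
    This \<open>t\<close> makes both exponents multiples of \<open>sqrt n\<close>.\<close>
  define t where "t = 1 / sqrt (real n)"
  have t: "0 < t" using assms by (simp add: t_def)
  let ?x = "exp (- t)"
  have gf: "finite (partitions_upto n m)"
    "(\<Sum>\<mu>\<in>partitions_upto n m. ?x ^ sum_mset \<mu>) \<le> (\<Prod>i=1..m. 1 / (1 - ?x ^ i))"
    using partitions_upto_gf[of ?x n m] t by auto
  show "finite (partitions_upto n m)" by fact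
  have "real (card (partitions_upto n m)) * ?x ^ n = (\<Sum>\<mu>\<in>partitions_upto n m. ?x ^ n)"
    by simp
  also have "\<dots> \<le> (\<Sum>\<mu>\<in>partitions_upto n m. ?x ^ sum_mset \<mu>)"
    using t by (intro sum_mono power_decreasing) (auto simp: partitions_upto_def)
  also have "\<dots> \<le> exp (2 * pi / t)"
    using gf(2) prod_inverse_one_minus_exp_le[OF t, of m] by linarith
  finally have "real (card (partitions_upto n m)) * ?x ^ n \<le> exp (2 * pi / t)" .
  moreover have "?x ^ n = exp (- sqrt (real n))"
    using assms by (simp add: exp_of_nat_mult[symmetric] t_def real_div_sqrt)
  ultimately have "real (card (partitions_upto n m)) \<le> exp (2 * pi / t) * exp (sqrt (real n))"
    by (simp add: exp_minus field_simps)
  also have "\<dots> = exp ((2 * pi + 1) * sqrt (real n))"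
    by (simp add: exp_add[symmetric] t_def algebra_simps)
  \<comment> \<open>\<open>2 * pi + 1\<close> is at most 9 because pi is less than 4.\<close>
  also have "\<dots> \<le> exp (9 * sqrt (real n))"
    using pi_half_less_two by (simp add: mult_right_mono)
  finally show "real (card (partitions_upto n m)) \<le> exp (9 * sqrt (real n))" .
qed

section \<open>Components and the dynamic program\<close>

lemma components_subset: "C \<in> components V F \<Longrightarrow> C \<subseteq> V"
  by (auto simp: components_def reachability_def quotient_def)

lemma finite_components: "finite V \<Longrightarrow> finite (components V F)"
  unfolding components_def quotient_def by simp

lemma component_nonempty: "C \<in> components V F \<Longrightarrow> C \<noteq> {}"
  by (fastforce simp: components_def reachability_def quotient_def)

text \<open>Attaching a leaf \<open>c\<close> at \<open>p\<close>: mapping \<open>c\<close> to \<open>p\<close> turns every walk into one that avoids \<open>c\<close>.\<close>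

lemma components_join:
  assumes "p \<in> V" "c \<notin> V" "\<And>e. e \<in> F \<Longrightarrow> c \<notin> e"
  shows "components (insert c V) (insert {p, c} F) = (\<lambda>C. if p \<in> C then insert c C else C) ` components V F"
proof -
  let ?R = "{(x, y). {x, y} \<in> insert {p, c} F}\<^sup>*" and ?Q = "{(x, y). {x, y} \<in> F}\<^sup>*"
  define \<pi> where "\<pi> = (\<lambda>y. if y = c then p else y)"
  have 1: "(\<pi> x, \<pi> y) \<in> ?Q" if "(x, y) \<in> ?R" for x y
    using that
  proof (induction rule: rtrancl_induct)
    case (step y z)
    from step.hyps(2) consider "{y, z} = {p, c}" | "{y, z} \<in> F" by auto
    then show ?case
    proof cases
      case 1
      then have "\<pi> y = \<pi> z" by (auto simp: \<pi>_def doubleton_eq_iff)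
      with step.IH show ?thesis by simp
    next
      case 2
      then have "\<pi> y = y" "\<pi> z = z" using assms(3)[OF 2] by (auto simp: \<pi>_def)
      with step.IH 2 show ?thesis by (auto intro: rtrancl_into_rtrancl)
    qed
  qed simp
  have 2: "(x, y) \<in> ?R" if "(\<pi> x, \<pi> y) \<in> ?Q" for x y
  proof -
    have "(p, c) \<in> {(x, y). {x, y} \<in> insert {p, c} F}" "(c, p) \<in> {(x, y). {x, y} \<in> insert {p, c} F}"
      by (simp_all add: doubleton_eq_iff)
    then have "(p, c) \<in> ?R" "(c, p) \<in> ?R" by (simp_all only: r_into_rtrancl)
    then have "(x, \<pi> x) \<in> ?R" "(\<pi> y, y) \<in> ?R" by (auto simp: \<pi>_def)
    moreover have "?Q \<subseteq> ?R" by (rule rtrancl_mono) auto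
    ultimately show ?thesis using that by (meson rtrancl_trans subsetD)
  qed
  have im: "reachability (insert c V) (insert {p, c} F) `` {x} =
      (\<lambda>C. if p \<in> C then insert c C else C) (reachability V F `` {\<pi> x})" if "x \<in> insert c V" for x
  proof -
    have "\<pi> x \<in> V" using that assms by (auto simp: \<pi>_def)
    moreover have "(x, y) \<in> ?R \<longleftrightarrow> (\<pi> x, \<pi> y) \<in> ?Q" for y using 1 2 by blast
    ultimately show ?thesis
      using that assms by (auto simp: reachability_def \<pi>_def split: if_splits)
  qed
  have sur: "\<pi> ` insert c V = V" using assms by (auto simp: \<pi>_def)
  have "components (insert c V) (insert {p, c} F)
      = (\<lambda>x. reachability (insert c V) (insert {p, c} F) `` {x}) ` insert c V"
    by (auto simp: components_def quotient_def)
  also have "\<dots> = (\<lambda>C. if p \<in> C then insert c C else C) ` (\<lambda>x. reachability V F `` {x}) ` \<pi> ` insert c V"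
    unfolding image_image using im by (intro image_cong) auto
  also have "\<dots> = (\<lambda>C. if p \<in> C then insert c C else C) ` components V F"
    unfolding sur by (auto simp: components_def quotient_def)
  finally show ?thesis .
qed

lemma components_isolated:
  assumes "c \<notin> V" "\<And>e. e \<in> F \<Longrightarrow> c \<notin> e"
  shows "components (insert c V) F = insert {c} (components V F)"
proof -
  let ?R = "{(x, y). {x, y} \<in> F}\<^sup>*"
  have 1: "y = c" if "(c, y) \<in> ?R" for y
    using that by (cases rule: converse_rtranclE) (use assms(2) in auto)
  have 2: "x = c" if "(x, c) \<in> ?R" for x
    using that by (cases rule: rtranclE) (use assms(2) in auto)
  have a: "reachability (insert c V) F `` {c} = {c}"
    using 1 by (auto simp: reachability_def)
  have b: "reachability (insert c V) F `` {x} = reachability V F `` {x}" if "x \<in> V" for x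
    using 2 that assms(1) by (auto simp: reachability_def)
  show ?thesis
    using a b by (auto simp: components_def quotient_def)
qed

section \<open>Weighted sums over components\<close>

definition component_sum :: "(nat \<Rightarrow> 'm) \<Rightarrow> ('v \<Rightarrow> nat) \<Rightarrow> 'v set \<Rightarrow> 'v set set \<Rightarrow> 'm :: comm_monoid_add" where
  "component_sum w a V F = (\<Sum>C\<in>components V F. w (sum a C))"

lemma component_sum_cong:
  "(\<And>v. v \<in> V \<Longrightarrow> a v = b v) \<Longrightarrow> component_sum w a V F = component_sum w b V F"
  unfolding component_sum_def
  by (rule sum.cong[OF refl], rule arg_cong[of _ _ w], rule sum.cong[OF refl]) (use components_subset in blast)

text \<open>Contracting the leaf \<open>c\<close> into \<open>p\<close> preserves the component
  totals if \<open>p\<close> takes over the load of \<open>c\<close>. This is why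
  \<open>component_sum\<close> carries an arbitrary load \<open>a\<close> on the vertices:
  inductions over the tree change it.\<close>

lemma component_sum_join:
  assumes "finite V" "p \<in> V" "c \<notin> V" "\<And>e. e \<in> F \<Longrightarrow> c \<notin> e"
  shows "component_sum w a (insert c V) (insert {p, c} F) = component_sum w (a(p := a p + a c)) V F"
proof -
  let ?h = "\<lambda>C. if p \<in> C then insert c C else C"
  have join: "components (insert c V) (insert {p, c} F) = ?h ` components V F"
    using assms by (intro components_join) auto
  have "inj_on ?h (components V F)"
  proof (rule inj_on_inverseI)
    fix C assume "C \<in> components V F"
    then show "?h C - {c} = C" using components_subset[of C V F] assms(3) by auto
  qed
  from sum.reindex[OF this, of "\<lambda>C. w (sum a C)"]
  have "component_sum w a (insert c V) (insert {p, c} F) = (\<Sum>C\<in>components V F. w (sum a (?h C)))"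
    by (simp only: component_sum_def join o_def)
  also have "\<dots> = component_sum w (a(p := a p + a c)) V F"
    unfolding component_sum_def
  proof (rule sum.cong[OF refl], rule arg_cong[of _ _ w])
    fix C assume C: "C \<in> components V F"
    then have sub: "C \<subseteq> V" by (rule components_subset)
    then have fin: "finite C" using assms(1) by (rule finite_subset)
    have rest: "sum (a(p := a p + a c)) (C - {p}) = sum a (C - {p})" by (rule sum.cong) auto
    show "sum a (?h C) = sum (a(p := a p + a c)) C"
    proof (cases "p \<in> C")
      case True
      have "sum a (insert c C) = a c + sum a C" using fin sub assms(3) by (intro sum.insert) auto
      moreover have "sum a C = a p + sum a (C - {p})" by (rule sum.remove[OF fin True])
      moreover have "sum (a(p := a p + a c)) C = a p + a c + sum a (C - {p})"
        using sum.remove[OF fin True, of "a(p := a p + a c)"] rest by simp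
      ultimately show ?thesis using True by simp
    next
      case False
      then have "sum (a(p := a p + a c)) C = sum a C" by (intro sum.cong) auto
      with False show ?thesis by simp
    qed
  qed
  finally show ?thesis .
qed

lemma component_sum_isolated:
  assumes "finite V" "c \<notin> V" "\<And>e. e \<in> F \<Longrightarrow> c \<notin> e"
  shows "component_sum w a (insert c V) F = w (a c) + component_sum w a V F"
proof -
  have "{c} \<notin> components V F" using components_subset assms(2) by blast
  moreover have "components (insert c V) F = insert {c} (components V F)"
    using assms by (intro components_isolated) auto
  ultimately show ?thesis
    by (simp add: component_sum_def finite_components assms(1))
qed

section \<open>Growth sequences and the forests inside them\<close>

definition verts :: "(nat \<times> nat) list \<Rightarrow> nat set" where
  "verts gs = insert 0 (snd ` set gs)"

inductive growth :: "(nat \<times> nat) list \<Rightarrow> bool" where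
  Nil: "growth []"
| snoc: "growth gs \<Longrightarrow> p \<in> verts gs \<Longrightarrow> c \<notin> verts gs \<Longrightarrow> growth (gs @ [(p, c)])"

lemma finite_verts [simp]: "finite (verts gs)"
  by (simp add: verts_def)

lemma verts_snoc: "verts (gs @ [(p, c)]) = insert c (verts gs)"
  by (auto simp: verts_def)

lemma verts_Nil [simp]: "verts [] = {0}"
  by (simp add: verts_def)

lemma edges_of_snoc: "edges_of (gs @ [(p, c)]) = insert {p, c} (edges_of gs)"
  by (auto simp: edges_of_def)

lemma edges_of_Nil [simp]: "edges_of [] = {}"
  by (simp add: edges_of_def)

lemma growth_edge_subset: "growth gs \<Longrightarrow> e \<in> edges_of gs \<Longrightarrow> e \<subseteq> verts gs"
  by (induction rule: growth.induct) (auto simp: verts_snoc edges_of_snoc)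

lemma growth_prefix: "growth (gs @ hs) \<Longrightarrow> growth gs"
proof (induction hs rule: rev_induct)
  case (snoc h hs)
  from snoc.prems have "growth (gs @ hs)"
    by (cases rule: growth.cases) (auto simp flip: append_assoc)
  with snoc.IH show ?case .
qed simp

lemma growth_snocD:
  assumes "growth (gs @ [(p, c)])" shows "growth gs" "p \<in> verts gs" "c \<notin> verts gs"
  using assms by (cases rule: growth.cases; auto)+

lemma growth_card_verts: "growth gs \<Longrightarrow> card (verts gs) = Suc (length gs)"
  by (induction rule: growth.induct) (auto simp: verts_snoc)

lemma growth_card_edges: "growth gs \<Longrightarrow> card (edges_of gs) = length gs"
proof (induction rule: growth.induct)
  case (snoc gs p c)
  then have "{p, c} \<notin> edges_of gs" using growth_edge_subset by blast
  with snoc show ?case by (simp add: edges_of_snoc edges_of_def)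
qed simp

lemma components_singleton: "components {v} {} = {{v}}"
  by (auto simp: components_def quotient_def reachability_def)

lemma growth_snoc_edge_subset_cases:
  assumes "growth (gs @ [(p, c)])" "F \<subseteq> edges_of (gs @ [(p, c)])"
  obtains "F \<subseteq> edges_of gs" "\<And>e. e \<in> F \<Longrightarrow> c \<notin> e"
  | F' where "F = insert {p, c} F'" "F' \<subseteq> edges_of gs" "{p, c} \<notin> F'" "\<And>e. e \<in> F' \<Longrightarrow> c \<notin> e"
proof -
  have c: "c \<notin> e" if "e \<in> edges_of gs" for e
    using that growth_edge_subset growth_snocD[OF assms(1)] by blast
  show thesis
  proof (cases "{p, c} \<in> F")
    case True
    have "F - {{p, c}} \<subseteq> edges_of gs" using assms(2) by (auto simp: edges_of_snoc)
    with True c show thesis by (intro that(2)[of "F - {{p, c}}"]) auto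
  next
    case False
    with assms(2) have "F \<subseteq> edges_of gs" by (auto simp: edges_of_snoc)
    with c show thesis by (intro that(1)) auto
  qed
qed

lemma growth_card_components:
  assumes "growth gs" "F \<subseteq> edges_of gs"
  shows "card (components (verts gs) F) + card F = Suc (length gs)"
proof -
  \<comment> \<open>With constant weight the sum counts components, so the rules for leaves apply.
    The load 0 is unchanged by a contraction.\<close>
  have eq: "card (components V F) = component_sum (\<lambda>_. 1 :: nat) (\<lambda>_. 0) V F" for V :: "nat set" and F
    by (simp add: component_sum_def)
  show ?thesis using assms
  proof (induction arbitrary: F rule: growth.induct)
    case Nil
    then show ?case by (simp add: components_singleton)
  next
    case (snoc gs p c)
    have fin: "finite F" using snoc.prems finite_subset by (fastforce simp: edges_of_def)
    from growth.snoc[OF snoc.hyps] snoc.prems show ?case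
    proof (cases rule: growth_snoc_edge_subset_cases)
      case 1
      then have "component_sum (\<lambda>_. 1 :: nat) (\<lambda>_. 0) (insert c (verts gs)) F
          = 1 + component_sum (\<lambda>_. 1) (\<lambda>_. 0) (verts gs) F"
        using snoc.hyps by (intro component_sum_isolated) auto
      with snoc.IH[OF 1(1)] show ?thesis by (simp add: eq verts_snoc)
    next
      case (2 F')
      then have "component_sum (\<lambda>_. 1 :: nat) (\<lambda>_. 0) (insert c (verts gs)) F
          = component_sum (\<lambda>_. 1) ((\<lambda>_. 0)(p := 0 + 0)) (verts gs) F'"
        unfolding 2(1) using snoc.hyps by (intro component_sum_join) auto
      with snoc.IH[OF 2(2)] 2 fin show ?thesis by (simp add: eq verts_snoc fun_upd_idem)
    qed
  qed
qed

text \<open>A state \<open>(a, r)\<close> of a vertex describes a choice of cut edges among those below it that have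
  already been processed: its own component has \<open>a\<close> vertices and the components cut off below
  it have total weight \<open>r\<close>.\<close>

definition merge :: "(nat \<Rightarrow> 'm) \<Rightarrow> (nat \<times> 'm) set \<Rightarrow> (nat \<times> 'm) set \<Rightarrow> (nat \<times> 'm :: comm_monoid_add) set" where
  "merge w A B = (\<Union>(a, r)\<in>A. \<Union>(b, s)\<in>B. {(a + b, r + s), (a, r + s + w b)})"

lemma mergeI:
  assumes "(a, r) \<in> A" "(b, s) \<in> B"
  shows "(a + b, r + s) \<in> merge w A B" "(a, r + s + w b) \<in> merge w A B"
  unfolding merge_def by (rule UN_I[OF assms(1)], simp, rule bexI[OF _ assms(2)], simp)+

text \<open>The monoid of the second component is left open: correctness holds for every additive
  weight, and the program works with numerical codes in place of multisets.\<close>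

definition dp :: "(nat \<Rightarrow> 'm) \<Rightarrow> (nat \<times> nat) list \<Rightarrow> (nat \<Rightarrow> (nat \<times> 'm) set) \<Rightarrow> nat \<Rightarrow> (nat \<times> 'm :: comm_monoid_add) set" where
  "dp w gs T = foldr (\<lambda>(p, c) T. T(p := merge w (T p) (T c))) gs T"

lemma dp_Nil [simp]: "dp w [] T = T"
  by (simp add: dp_def)

lemma dp_snoc: "dp w (gs @ [(p, c)]) T = dp w gs (T(p := merge w (T p) (T c)))"
  by (simp add: dp_def)

text \<open>\<open>dp_snoc\<close> removes a leaf of the tree and has the shape of the correctness
  induction. This equation adds one merge after all those of \<open>gs\<close> and is the step that
  the program performs.\<close>

lemma dp_Cons: "dp w ((p, c) # gs) T = (dp w gs T)(p := merge w (dp w gs T p) (dp w gs T c))"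
  by (simp add: dp_def)

text \<open>Arbitrary initial tables \<open>T\<close> are needed because merging the last leaf
  changes the table of its neighbour. On the right-hand side each vertex \<open>v\<close> picks a
  state \<open>f v\<close> from its table and \<open>F\<close> consists of the kept edges; the sizes
  in the picked states are the loads that the components of \<open>F\<close> add up.\<close>

lemma dp_correct_general:
  assumes "growth gs"
  shows "(\<lambda>(a, r). r + w a) ` dp w gs T 0 =
    {(\<Sum>v\<in>verts gs. snd (f v)) + component_sum w (\<lambda>v. fst (f v)) (verts gs) F | f F.
      (\<forall>v\<in>verts gs. f v \<in> T v) \<and> F \<subseteq> edges_of gs}" (is "_ = ?S gs T")
  using assms
proof (induction arbitrary: T rule: growth.induct)
  case Nil
  have "(\<exists>f. x = snd (f 0) + w (fst (f 0)) \<and> f 0 \<in> T 0) \<longleftrightarrow> (\<exists>y\<in>T 0. x = snd y + w (fst y))"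
    for x :: 'a and T :: "nat \<Rightarrow> (nat \<times> 'a) set"
    by (auto intro: exI[of _ "\<lambda>_. y" for y])
  then show ?case
    by (auto simp: component_sum_def components_singleton image_iff case_prod_beta)
next
  case (snoc gs p c)
  let ?V = "verts gs" and ?T = "T(p := merge w (T p) (T c))"
  have gr: "growth (gs @ [(p, c)])" using snoc by (intro growth.snoc)
  have notin: "c \<notin> e" if "e \<in> edges_of gs" for e
    using that growth_edge_subset snoc.hyps by blast
  have pc: "p \<noteq> c" using snoc by auto
  have "?S gs ?T = ?S (gs @ [(p, c)]) T"
  proof (intro equalityI subsetI)
    fix x assume "x \<in> ?S gs ?T"
    then obtain f F where f: "\<forall>v\<in>?V. f v \<in> ?T v" and F: "F \<subseteq> edges_of gs"
      and x: "x = (\<Sum>v\<in>?V. snd (f v)) + component_sum w (\<lambda>v. fst (f v)) ?V F" by blast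
    have "f p \<in> merge w (T p) (T c)" using f snoc.hyps by (auto split: if_splits)
    then obtain a r b s where ar: "(a, r) \<in> T p" "(b, s) \<in> T c"
      and fp: "f p = (a + b, r + s) \<or> f p = (a, r + s + w b)"
      by (auto simp: merge_def)
    let ?f = "f(p := (a, r), c := (b, s))"
    have f': "\<forall>v\<in>insert c ?V. ?f v \<in> T v" using f ar by auto
    have rest: "(\<Sum>v\<in>?V - {p}. snd (?f v)) = (\<Sum>v\<in>?V - {p}. snd (f v))"
      using snoc.hyps by (intro sum.cong) auto
    have s1: "(\<Sum>v\<in>insert c ?V. snd (?f v)) = s + r + (\<Sum>v\<in>?V - {p}. snd (f v))"
      using snoc.hyps pc rest by (simp add: sum.remove[of ?V p] add.assoc)
    have s2: "(\<Sum>v\<in>?V. snd (f v)) = snd (f p) + (\<Sum>v\<in>?V - {p}. snd (f v))"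
      using snoc.hyps by (simp add: sum.remove[of ?V p])
    \<comment> \<open>The first alternative keeps the edge, so it joins \<open>F\<close>; the second
      cuts it, and \<open>c\<close> becomes a component of its own.\<close>
    from fp show "x \<in> ?S (gs @ [(p, c)]) T"
    proof
      assume fp: "f p = (a + b, r + s)"
      have "component_sum w (\<lambda>v. fst (?f v)) (insert c ?V) (insert {p, c} F)
          = component_sum w ((\<lambda>v. fst (?f v))(p := fst (?f p) + fst (?f c))) ?V F"
        using snoc.hyps F notin by (intro component_sum_join) auto
      also have "\<dots> = component_sum w (\<lambda>v. fst (f v)) ?V F"
        using snoc.hyps pc fp by (intro component_sum_cong) auto
      finally have e: "component_sum w (\<lambda>v. fst (?f v)) (insert c ?V) (insert {p, c} F) = component_sum w (\<lambda>v. fst (f v)) ?V F" .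
      have "x = (\<Sum>v\<in>insert c ?V. snd (?f v)) + component_sum w (\<lambda>v. fst (?f v)) (insert c ?V) (insert {p, c} F)"
        unfolding s1 x s2 e by (simp add: fp ac_simps)
      then show ?thesis using f' F unfolding verts_snoc edges_of_snoc
        by (intro CollectI exI[of _ ?f] exI[of _ "insert {p, c} F"]) auto
    next
      assume fp: "f p = (a, r + s + w b)"
      have "component_sum w (\<lambda>v. fst (?f v)) (insert c ?V) F
          = w (fst (?f c)) + component_sum w (\<lambda>v. fst (?f v)) ?V F"
        using snoc.hyps F notin by (intro component_sum_isolated) auto
      also have "component_sum w (\<lambda>v. fst (?f v)) ?V F = component_sum w (\<lambda>v. fst (f v)) ?V F"
        using snoc.hyps pc fp by (intro component_sum_cong) auto
      finally have e: "component_sum w (\<lambda>v. fst (?f v)) (insert c ?V) F = w (fst (?f c)) + component_sum w (\<lambda>v. fst (f v)) ?V F" .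
      have "x = (\<Sum>v\<in>insert c ?V. snd (?f v)) + component_sum w (\<lambda>v. fst (?f v)) (insert c ?V) F"
        unfolding s1 x s2 e by (simp add: fp ac_simps)
      then show ?thesis using f' F unfolding verts_snoc edges_of_snoc
        by (intro CollectI exI[of _ ?f] exI[of _ F]) auto
    qed
  next
    fix x assume "x \<in> ?S (gs @ [(p, c)]) T"
    then obtain f F where f: "\<forall>v\<in>insert c ?V. f v \<in> T v" and F: "F \<subseteq> edges_of (gs @ [(p, c)])"
      and x: "x = (\<Sum>v\<in>insert c ?V. snd (f v)) + component_sum w (\<lambda>v. fst (f v)) (insert c ?V) F"
      unfolding verts_snoc by blast
    have mem: "f p \<in> T p" "f c \<in> T c" using f snoc.hyps by auto
    have s1: "(\<Sum>v\<in>insert c ?V. snd (f v)) = snd (f c) + snd (f p) + (\<Sum>v\<in>?V - {p}. snd (f v))"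
      using snoc.hyps by (simp add: sum.remove[of ?V p] add.assoc)
    have s2: "(\<Sum>v\<in>?V. snd ((f(p := y)) v)) = snd y + (\<Sum>v\<in>?V - {p}. snd (f v))" for y
    proof -
      have "(\<Sum>v\<in>?V - {p}. snd ((f(p := y)) v)) = (\<Sum>v\<in>?V - {p}. snd (f v))"
        by (intro sum.cong) auto
      then show ?thesis using snoc.hyps by (simp add: sum.remove[of ?V p])
    qed
    from gr F show "x \<in> ?S gs ?T"
    proof (cases rule: growth_snoc_edge_subset_cases)
      case 1
      let ?y = "(fst (f p), snd (f p) + snd (f c) + w (fst (f c)))"
      have y: "?y \<in> merge w (T p) (T c)"
        unfolding merge_def using mem by (intro UN_I[of "f p"]) (auto simp: case_prod_beta intro!: bexI[of _ "f c"])
      have "component_sum w (\<lambda>v. fst (f v)) (insert c ?V) F = w (fst (f c)) + component_sum w (\<lambda>v. fst (f v)) ?V F"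
        using snoc.hyps 1 by (intro component_sum_isolated) auto
      also have "component_sum w (\<lambda>v. fst (f v)) ?V F = component_sum w (\<lambda>v. fst ((f(p := ?y)) v)) ?V F"
        by (intro component_sum_cong) auto
      finally have "x = (\<Sum>v\<in>?V. snd ((f(p := ?y)) v)) + component_sum w (\<lambda>v. fst ((f(p := ?y)) v)) ?V F"
        unfolding x s1 s2 by (simp add: ac_simps)
      moreover have "\<forall>v\<in>?V. (f(p := ?y)) v \<in> ?T v" using f y by auto
      ultimately show ?thesis using 1(1) by blast
    next
      case (2 F')
      let ?y = "(fst (f p) + fst (f c), snd (f p) + snd (f c))"
      have y: "?y \<in> merge w (T p) (T c)"
        unfolding merge_def using mem by (intro UN_I[of "f p"]) (auto simp: case_prod_beta intro!: bexI[of _ "f c"])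
      have "component_sum w (\<lambda>v. fst (f v)) (insert c ?V) F
          = component_sum w ((\<lambda>v. fst (f v))(p := fst (f p) + fst (f c))) ?V F'"
        unfolding 2(1) using snoc.hyps 2 by (intro component_sum_join) auto
      also have "\<dots> = component_sum w (\<lambda>v. fst ((f(p := ?y)) v)) ?V F'"
        by (intro component_sum_cong) auto
      finally have "x = (\<Sum>v\<in>?V. snd ((f(p := ?y)) v)) + component_sum w (\<lambda>v. fst ((f(p := ?y)) v)) ?V F'"
        unfolding x s1 s2 by (simp add: ac_simps)
      moreover have "\<forall>v\<in>?V. (f(p := ?y)) v \<in> ?T v" using f y by auto
      ultimately show ?thesis using 2(2) by blast
    qed
  qed
  then show ?case unfolding dp_snoc snoc.IH .
qed

text \<open>Initially every vertex is an open component of size 1 with nothing cut off. Adding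
  \<open>w a\<close> at the end closes the component of vertex 0.\<close>

theorem dp_correct:
  assumes "growth gs"
  shows "(\<lambda>(a, r). r + w a) ` dp w gs (\<lambda>_. {(1, 0)}) 0 =
    (\<lambda>F. \<Sum>C\<in>components (verts gs) F. w (card C)) ` {F. F \<subseteq> edges_of gs}"
proof -
  have "(\<Sum>v\<in>verts gs. snd (f v)) + component_sum w (\<lambda>v. fst (f v)) (verts gs) F
      = (\<Sum>C\<in>components (verts gs) F. w (card C))"
    if "\<forall>v\<in>verts gs. f v \<in> {(1, 0)}" for f F
  proof -
    have "component_sum w (\<lambda>v. fst (f v)) (verts gs) F = component_sum w (\<lambda>v. 1) (verts gs) F"
      using that by (intro component_sum_cong) auto
    moreover have "(\<Sum>v\<in>verts gs. snd (f v)) = 0" using that by (intro sum.neutral) auto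
    ultimately show ?thesis by (simp add: component_sum_def)
  qed
  note * = this
  show ?thesis unfolding dp_correct_general[OF assms]
  proof (intro equalityI subsetI)
    fix x assume "x \<in> (\<lambda>F. \<Sum>C\<in>components (verts gs) F. w (card C)) ` {F. F \<subseteq> edges_of gs}"
    then show "x \<in> {(\<Sum>v\<in>verts gs. snd (f v)) + component_sum w (\<lambda>v. fst (f v)) (verts gs) F | f F.
      (\<forall>v\<in>verts gs. f v \<in> {(1, 0)}) \<and> F \<subseteq> edges_of gs}"
      using *[of "\<lambda>_. (1, 0)"] by (intro CollectI exI[of _ "\<lambda>_. (1, 0)"]) auto
  qed (use * in auto)
qed

section \<open>States as partitions of the number of merged vertices\<close>

definition code :: "(nat \<Rightarrow> nat) \<Rightarrow> nat multiset \<Rightarrow> nat" where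
  "code w \<mu> = (\<Sum>x\<in>#\<mu>. w x)"

text \<open>Fixing the total \<open>s\<close> makes the open size a function of the multiset, so
  that there are no more states than partitions.\<close>

definition states :: "(nat \<Rightarrow> nat) \<Rightarrow> nat \<Rightarrow> (nat \<times> nat) set" where
  "states w s = {(a, code w \<mu>) | a \<mu>. 0 < a \<and> 0 \<notin># \<mu> \<and> a + sum_mset \<mu> = s}"

lemma statesI: "0 < a \<Longrightarrow> 0 \<notin># \<mu> \<Longrightarrow> a + sum_mset \<mu> = s \<Longrightarrow> r = code w \<mu> \<Longrightarrow> (a, r) \<in> states w s"
  by (auto simp: states_def)

lemma merge_states:
  assumes "A \<subseteq> states w s" "B \<subseteq> states w t"
  shows "merge w A B \<subseteq> states w (s + t)"
proof
  fix x assume "x \<in> merge w A B"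
  then obtain a r b q where "(a, r) \<in> A" "(b, q) \<in> B"
      and x: "x = (a + b, r + q) \<or> x = (a, r + q + w b)"
    unfolding merge_def by blast
  with assms have "(a, r) \<in> states w s" "(b, q) \<in> states w t" by auto
  then obtain \<mu> \<nu> where "r = code w \<mu>" "0 < a" "0 \<notin># \<mu>" "a + sum_mset \<mu> = s"
      "q = code w \<nu>" "0 < b" "0 \<notin># \<nu>" "b + sum_mset \<nu> = t"
    by (auto simp: states_def)
  then have "(a + b, r + q) \<in> states w (s + t)" "(a, r + q + w b) \<in> states w (s + t)"
    using statesI[of "a + b" "\<mu> + \<nu>" "s + t" "r + q" w] statesI[of a "add_mset b (\<mu> + \<nu>)" "s + t" "r + q + w b" w]
    by (auto simp: code_def)
  with x show "x \<in> states w (s + t)" by auto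
qed

text \<open>\<open>sz v\<close> counts the vertices merged into \<open>v\<close>. Over the vertices
  that remain, the counts add up to the whole tree. Vertices already merged away keep their old
  tables, which is why the bound is also stated for every single \<open>v\<close>.\<close>

lemma dp_states:
  assumes "growth (gs @ hs)"
  shows "\<exists>sz. (\<forall>v. dp w hs (\<lambda>_. {(1, 0)}) v \<subseteq> states w (sz v) \<and> sz v \<le> Suc (length (gs @ hs))) \<and>
    (\<Sum>v\<in>verts gs. sz v) = Suc (length (gs @ hs))"
  using assms
proof (induction hs arbitrary: gs)
  case Nil
  then show ?case
    by (intro exI[of _ "\<lambda>_. 1"]) (auto simp: growth_card_verts states_def code_def intro!: exI[of _ "{#}"])
next
  case (Cons h hs)
  obtain p c where h: "h = (p, c)" by (cases h)
  from Cons.IH[of "gs @ [h]"] Cons.prems obtain sz where sz: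
     "\<And>v. dp w hs (\<lambda>_. {(1, 0)}) v \<subseteq> states w (sz v)" "\<And>v. sz v \<le> Suc (length (gs @ h # hs))"
     "(\<Sum>v\<in>verts (gs @ [h]). sz v) = Suc (length (gs @ h # hs))" by auto
  from Cons.prems growth_prefix[of "gs @ [(p, c)]" hs] have "growth (gs @ [(p, c)])" by (simp add: h)
  note pc = growth_snocD[OF this]
  let ?sz = "sz(p := sz p + sz c)"
  have rest: "sum ?sz (verts gs - {p}) = sum sz (verts gs - {p})" by (rule sum.cong) auto
  have "sum ?sz (verts gs) = sz p + sz c + sum sz (verts gs - {p})"
    using pc rest by (simp add: sum.remove[of "verts gs" p])
  also have "\<dots> = sum sz (insert c (verts gs))"
    using pc by (simp add: sum.remove[of "verts gs" p])
  finally have s: "sum ?sz (verts gs) = Suc (length (gs @ h # hs))"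
    using sz(3) by (simp add: h verts_snoc)
  have "?sz p \<le> sum ?sz (verts gs)" using pc by (intro member_le_sum) auto
  then have "?sz v \<le> Suc (length (gs @ h # hs))" for v
    using s sz(2)[of v] by auto
  moreover have "dp w (h # hs) (\<lambda>_. {(1, 0)}) v \<subseteq> states w (?sz v)" for v
    using sz(1) merge_states[OF sz(1) sz(1)] by (auto simp: h dp_Cons)
  ultimately show ?case using s by blast
qed

section \<open>Growth sequences of a tree\<close>

lemma simple_graph_edgeD: "simple_graph V E \<Longrightarrow> {u, v} \<in> E \<Longrightarrow> u \<in> V \<and> v \<in> V \<and> u \<noteq> v"
  unfolding simple_graph_def by (metis doubleton_eq_iff)

lemma crossing_edge:
  assumes "(x, y) \<in> {(x, y). {x, y} \<in> E}\<^sup>*" "x \<in> X" "y \<notin> X"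
  shows "\<exists>u v. {u, v} \<in> E \<and> u \<in> X \<and> v \<notin> X"
  using assms by (induction rule: rtrancl_induct) auto

text \<open>A walk that returns to an earlier vertex is cut back to that vertex.\<close>

lemma distinct_path:
  assumes "(u, v) \<in> {(x, y). {x, y} \<in> E}\<^sup>*"
  shows "\<exists>xs. xs \<noteq> [] \<and> distinct xs \<and> hd xs = u \<and> last xs = v \<and> successively (\<lambda>x y. {x, y} \<in> E) xs"
  using assms
proof (induction rule: rtrancl_induct)
  case base
  show ?case by (intro exI[of _ "[u]"]) simp
next
  case (step y z)
  then obtain xs where xs: "xs \<noteq> []" "distinct xs" "hd xs = u" "last xs = y" "successively (\<lambda>x y. {x, y} \<in> E) xs"
    by blast
  show ?case
  proof (cases "z \<in> set xs")
    case False
    with xs step.hyps show ?thesis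
      by (intro exI[of _ "xs @ [z]"]) (simp add: successively_append_iff)
  next
    case True
    then obtain ys zs where eq: "xs = (ys @ [z]) @ zs" by (metis append.assoc append_Cons append_Nil split_list)
    from xs(5) have "successively (\<lambda>x y. {x, y} \<in> E) (ys @ [z])"
      unfolding eq successively_append_iff by blast
    with xs show ?thesis
      by (intro exI[of _ "ys @ [z]"]) (auto simp: eq hd_append)
  qed
qed

text \<open>The extra edge closes a path in \<open>F\<close> to a cycle. The path has at least three
  vertices, since a path of two would be the extra edge itself, which is not in
  \<open>F\<close>.\<close>

lemma cycle_if_extra_edge:
  assumes "(u, v) \<in> {(x, y). {x, y} \<in> F}\<^sup>*" "F \<subseteq> E" "{u, v} \<in> E - F" "u \<noteq> v"
  shows "\<exists>p. is_cycle E p"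
proof -
  from distinct_path[OF assms(1)] obtain xs where xs: "xs \<noteq> []" "distinct xs" "hd xs = u" "last xs = v"
    and suc: "successively (\<lambda>x y. {x, y} \<in> F) xs" by blast
  have edge: "{xs ! i, xs ! Suc i} \<in> F" if "Suc i < length xs" for i
    using suc that by (simp add: successively_conv_nth)
  have h: "xs ! 0 = u" "xs ! (length xs - 1) = v" using xs by (simp_all add: hd_conv_nth last_conv_nth)
  have len: "3 \<le> length xs"
  proof (rule ccontr)
    assume "\<not> 3 \<le> length xs"
    then consider "length xs = 0" | "length xs = 1" | "length xs = 2" by linarith
    then show False
    proof cases
      case 3
      with edge[of 0] h assms show False by (simp add: numeral_2_eq_2)
    qed (use xs h assms in auto)
  qed
  have "{xs ! i, xs ! (Suc i mod length xs)} \<in> E" if i: "i < length xs" for i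
  proof (cases "Suc i < length xs")
    case True
    with edge[of i] assms show ?thesis by auto
  next
    case False
    with i have "Suc i = length xs" by linarith
    then have "i = length xs - 1" "Suc i mod length xs = 0" by auto
    with h assms(3) show ?thesis by (simp add: insert_commute)
  qed
  with len xs show ?thesis unfolding is_cycle_def by blast
qed

lemma growth_reach: "growth gs \<Longrightarrow> v \<in> verts gs \<Longrightarrow> (0, v) \<in> {(x, y). {x, y} \<in> edges_of gs}\<^sup>*"
proof (induction arbitrary: v rule: growth.induct)
  case (snoc gs p c)
  have mono: "{(x, y). {x, y} \<in> edges_of gs}\<^sup>* \<subseteq> {(x, y). {x, y} \<in> edges_of (gs @ [(p, c)])}\<^sup>*"
    by (rule rtrancl_mono) (auto simp: edges_of_snoc)
  have "(0, p) \<in> {(x, y). {x, y} \<in> edges_of (gs @ [(p, c)])}\<^sup>*"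
    using snoc mono by blast
  then have "(0, c) \<in> {(x, y). {x, y} \<in> edges_of (gs @ [(p, c)])}\<^sup>*"
    by (rule rtrancl_into_rtrancl) (simp add: edges_of_snoc)
  with snoc mono show ?case by (auto simp: verts_snoc)
qed simp

lemma growth_verts_subset:
  "growth gs \<Longrightarrow> simple_graph V (E :: nat set set) \<Longrightarrow> 0 \<in> V \<Longrightarrow> edges_of gs \<subseteq> E \<Longrightarrow> verts gs \<subseteq> V"
proof (induction rule: growth.induct)
  case (snoc gs p c)
  then show ?case using simple_graph_edgeD[of V E p c] by (auto simp: verts_snoc edges_of_snoc)
qed simp

lemma tree_growth_extend:
  assumes "is_tree {..<n} E" "growth gs" "edges_of gs \<subseteq> E" "length gs < n - 1"
  shows "\<exists>p c. {p, c} \<in> E \<and> p \<in> verts gs \<and> c \<notin> verts gs"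
proof -
  have n: "0 \<in> {..<n}" using assms(4) by simp
  have sg: "simple_graph {..<n} E" and conn: "\<And>u v. u < n \<Longrightarrow> v < n \<Longrightarrow> (u, v) \<in> {(x, y). {x, y} \<in> E}\<^sup>*"
    using assms(1) by (auto simp: is_tree_def reachability_def)
  have sub: "verts gs \<subseteq> {..<n}" using growth_verts_subset[OF assms(2) sg n assms(3)] .
  moreover have "verts gs \<noteq> {..<n}"
  proof
    assume "verts gs = {..<n}"
    with growth_card_verts[OF assms(2)] have "n = Suc (length gs)" by simp
    with assms(4) show False by simp
  qed
  ultimately obtain y where "y < n" "y \<notin> verts gs" by blast
  moreover have "(0, y) \<in> {(x, y). {x, y} \<in> E}\<^sup>*" using conn \<open>y < n\<close> n by simp
  moreover have "0 \<in> verts gs" by (simp add: verts_def)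
  ultimately show ?thesis using crossing_edge[of 0 y E "verts gs"] by blast
qed

text \<open>With \<open>n - 1\<close> edges the sequence reaches \<open>n\<close> vertices and hence
  spans the tree; it then connects the ends of any other edge, which would close a cycle.\<close>

lemma tree_growth_complete:
  assumes "is_tree {..<n} E" "growth gs" "edges_of gs \<subseteq> E" "length gs = n - 1"
  shows "verts gs = {..<n}" "edges_of gs = E"
proof -
  have sg: "simple_graph {..<n} E" and n: "0 \<in> {..<n}"
    using assms(1) by (auto simp: is_tree_def)
  have sub: "verts gs \<subseteq> {..<n}" using growth_verts_subset[OF assms(2) sg n assms(3)] .
  have "card (verts gs) = card {..<n}" using growth_card_verts[OF assms(2)] assms(4) n by simp
  with sub show V: "verts gs = {..<n}" by (intro card_subset_eq) simp_all
  have sym: "sym {(x, y). {x, y} \<in> edges_of gs}" by (auto simp: sym_def insert_commute)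
  show "edges_of gs = E"
  proof (rule ccontr)
    assume "edges_of gs \<noteq> E"
    then obtain e where e: "e \<in> E" "e \<notin> edges_of gs" using assms(3) by auto
    with sg obtain u v where uv: "u < n" "v < n" "u \<noteq> v" "e = {u, v}"
      by (auto simp: simple_graph_def)
    have "(u, 0) \<in> {(x, y). {x, y} \<in> edges_of gs}\<^sup>*"
      using growth_reach[OF assms(2), of u] uv V sym_rtrancl[OF sym] by (auto dest: symD)
    moreover have "(0, v) \<in> {(x, y). {x, y} \<in> edges_of gs}\<^sup>*"
      using growth_reach[OF assms(2), of v] uv V by auto
    ultimately have "(u, v) \<in> {(x, y). {x, y} \<in> edges_of gs}\<^sup>*" by (rule rtrancl_trans)
    from cycle_if_extra_edge[OF this assms(3)] e uv assms(1) show False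
      by (auto simp: is_tree_def)
  qed
qed

lemma tree_exists_growth:
  assumes "is_tree {..<n} E" "i \<le> n - 1"
  shows "\<exists>gs. growth gs \<and> edges_of gs \<subseteq> E \<and> length gs = i"
  using assms(2)
proof (induction i)
  case 0
  show ?case by (intro exI[of _ "[]"]) (simp add: growth.Nil)
next
  case (Suc i)
  then obtain gs where gs: "growth gs" "edges_of gs \<subseteq> E" "length gs = i" by auto
  with tree_growth_extend[OF assms(1), of gs] Suc.prems obtain p c
    where "{p, c} \<in> E" "p \<in> verts gs" "c \<notin> verts gs" by auto
  with gs show ?case
    by (intro exI[of _ "gs @ [(p, c)]"]) (auto simp: edges_of_snoc intro: growth.snoc)
qed

lemma tree_card_edges:
  assumes "is_tree {..<n} E" shows "card E = n - 1"
  using tree_exists_growth[OF assms order_refl] tree_growth_complete[OF assms] growth_card_edges by metis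

lemma represents_tree_length: "represents_tree n es \<Longrightarrow> length es = n - 1"
proof -
  assume "represents_tree n es"
  then have "is_tree {..<n} (edges_of es)" "distinct (map (\<lambda>(u, v). {u, v}) es)"
    by (auto simp: represents_tree_def)
  then show ?thesis
    using tree_card_edges distinct_card[of "map (\<lambda>(u, v). {u, v}) es"] by (fastforce simp: edges_of_def)
qed

section \<open>Grouping as packing\<close>

text \<open>\<open>packable Bd m \<mu>\<close>: the pieces \<open>\<mu>\<close> can be laid side by side on the interval from 0 to \<open>m\<close> such that
  no point of \<open>Bd\<close> is in the interior of a piece.\<close>

inductive packable :: "nat set \<Rightarrow> nat \<Rightarrow> nat multiset \<Rightarrow> bool" for Bd where
  empty: "packable Bd 0 {#}"
| add: "packable Bd m \<mu> \<Longrightarrow> 0 < x \<Longrightarrow> {m<..<m + x} \<inter> Bd = {} \<Longrightarrow> packable Bd (m + x) (add_mset x \<mu>)"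

lemma packable_sum_mset: "packable Bd m \<mu> \<Longrightarrow> sum_mset \<mu> = m"
  by (induction rule: packable.induct) auto

lemma packable_pos: "packable Bd m \<mu> \<Longrightarrow> 0 \<notin># \<mu>"
  by (induction rule: packable.induct) auto

text \<open>The total itself is left out: the layout ends there, so it cannot be inside a piece.
  Groups of size 0 merely repeat a boundary and vanish in the set.\<close>

definition boundaries :: "nat list \<Rightarrow> nat set" where
  "boundaries ss = (\<lambda>i. sum_list (take i ss)) ` {..<length ss}"

lemma sum_list_take_mono: "i \<le> j \<Longrightarrow> sum_list (take i ss) \<le> (sum_list (take j ss) :: nat)"
  by (metis le_add1 le_Suc_ex sum_list_append take_add)

lemma sum_list_take_Suc: "i < length ss \<Longrightarrow> sum_list (take (Suc i) ss) = sum_list (take i ss) + (ss ! i :: nat)"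
  by (simp add: take_Suc_conv_app_nth)

lemma packable_extend:
  assumes "finite D" and "\<And>C. C \<in> D \<Longrightarrow> 0 < (f C :: nat)" and "packable Bd m \<mu>"
    and "{m<..<m + sum f D} \<inter> Bd = {}"
  shows "packable Bd (m + sum f D) (\<mu> + image_mset f (mset_set D))"
  using assms
proof (induction D rule: finite_induct)
  case (insert C D)
  have "packable Bd (m + sum f D) (\<mu> + image_mset f (mset_set D))"
    using insert by (intro insert.IH) (auto simp: disjoint_iff)
  then have "packable Bd (m + sum f D + f C) (add_mset (f C) (\<mu> + image_mset f (mset_set D)))"
    using insert by (intro packable.add) (auto simp: disjoint_iff)
  then show ?case using insert by (simp add: ac_simps)
qed simp

lemma boundary_gap:
  assumes "i < length ss" shows "{sum_list (take i ss)<..<sum_list (take (Suc i) ss)} \<inter> boundaries ss = {}"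
proof -
  have "sum_list (take j ss) \<le> sum_list (take i ss) \<or> sum_list (take (Suc i) ss) \<le> sum_list (take j ss)" for j
    by (cases "j \<le> i") (use sum_list_take_mono[of j i ss] sum_list_take_mono[of "Suc i" j ss] in auto)
  note * = this
  show ?thesis
  proof (rule ccontr)
    assume "\<not> ?thesis"
    then obtain j where "sum_list (take i ss) < sum_list (take j ss)" "sum_list (take j ss) < sum_list (take (Suc i) ss)"
      by (auto simp: boundaries_def)
    with *[of j] show False by linarith
  qed
qed

text \<open>The groups are laid out one after another; no boundary lies strictly inside the stretch
  of a single group.\<close>

lemma packable_if_grouped:
  assumes D: "finite D" "\<And>C. C \<in> D \<Longrightarrow> 0 < (f C :: nat)" "\<And>C. C \<in> D \<Longrightarrow> g C < length ss"
    and load: "\<And>i. i < length ss \<Longrightarrow> (\<Sum>C | C \<in> D \<and> g C = i. f C) = ss ! i"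
  shows "packable (boundaries ss) (sum_list ss) (image_mset f (mset_set D))"
proof -
  have "packable (boundaries ss) (sum_list (take i ss)) (image_mset f (mset_set {C \<in> D. g C < i}))"
    if "i \<le> length ss" for i
    using that
  proof (induction i)
    case 0
    show ?case by (simp add: packable.empty)
  next
    case (Suc i)
    let ?D = "{C \<in> D. g C = i}"
    have eq: "sum_list (take (Suc i) ss) = sum_list (take i ss) + sum f ?D"
      using Suc.prems load[of i] by (simp add: sum_list_take_Suc)
    have "packable (boundaries ss) (sum_list (take i ss) + sum f ?D)
        (image_mset f (mset_set {C \<in> D. g C < i}) + image_mset f (mset_set ?D))"
      using Suc D boundary_gap[of i ss] by (intro packable_extend) (auto simp: eq)
    moreover have "{C \<in> D. g C < Suc i} = {C \<in> D. g C < i} \<union> ?D" by auto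
    ultimately show ?case
      using D(1) by (simp add: eq mset_set_Union disjoint_iff)
  qed
  from this[of "length ss"] have "packable (boundaries ss) (sum_list ss) (image_mset f (mset_set {C \<in> D. g C < length ss}))"
    by simp
  moreover have "{C \<in> D. g C < length ss} = D" using D by auto
  ultimately show ?thesis by simp
qed

text \<open>The induction needs partial layouts, on the interval from 0 to \<open>m\<close>: group
  \<open>i\<close> has then received the length of the overlap of its stretch with that interval,
  which is the difference of the two minima.\<close>

lemma grouped_if_packable_aux:
  assumes "packable (boundaries ss) m \<mu>" "m \<le> sum_list ss" "finite D" "image_mset f (mset_set D) = \<mu>"
  shows "\<exists>g. (\<forall>C\<in>D. g C < length ss) \<and> (\<forall>i<length ss. (\<Sum>C | C \<in> D \<and> g C = i. f C)
     = min m (sum_list (take (Suc i) ss)) - min m (sum_list (take i ss)))"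
  using assms
proof (induction arbitrary: D rule: packable.induct)
  case empty
  then have "D = {}" by (simp add: mset_set_empty_iff)
  then show ?case by simp
next
  case (add m \<mu> x)
  let ?S = "\<lambda>i. sum_list (take i ss)"
  from add.prems(3) have "x \<in># image_mset f (mset_set D)" by simp
  then obtain C where C: "C \<in> D" "f C = x" using add.prems(2) by auto
  let ?D = "D - {C}"
  have "mset_set D = add_mset C (mset_set ?D)"
    using C add.prems(2) by (simp add: mset_set.remove)
  then have "image_mset f (mset_set ?D) = \<mu>" using add.prems(3) C by simp
  then obtain g where g: "\<forall>C\<in>?D. g C < length ss" "\<And>i. i < length ss \<Longrightarrow>
      (\<Sum>C | C \<in> ?D \<and> g C = i. f C) = min m (?S (Suc i)) - min m (?S i)"
    using add.IH[of ?D] add.prems by auto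
  \<comment> \<open>Taking the greatest index skips groups of size 0 at position \<open>m\<close>,
    so the new piece starts strictly before the end of group \<open>i\<close>.\<close>
  obtain i where i: "i \<le> length ss" "?S i \<le> m" "\<And>j. j \<le> length ss \<Longrightarrow> ?S j \<le> m \<Longrightarrow> j \<le> i"
  proof -
    have "\<exists>i. (i \<le> length ss \<and> ?S i \<le> m) \<and> (\<forall>j. j \<le> length ss \<and> ?S j \<le> m \<longrightarrow> j \<le> i)"
      by (rule Nat.ex_has_greatest_nat[of _ 0 "length ss"]) auto
    then show thesis using that by blast
  qed
  have "i \<noteq> length ss"
  proof
    assume "i = length ss"
    with i(2) add.prems(1) add.hyps(2) show False by simp
  qed
  with i have il: "i < length ss" "?S i \<le> m" by auto
  have mi: "m < ?S (Suc i)"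
    using i(3)[of "Suc i"] il(1) by (meson Suc_leI Suc_n_not_le_n not_le)
  have hi: "m + x \<le> ?S (Suc i)"
  proof (cases "Suc i < length ss")
    case True
    then have "?S (Suc i) \<in> boundaries ss" by (auto simp: boundaries_def)
    then show ?thesis using add.hyps(3) mi by (force simp: disjoint_iff)
  next
    \<comment> \<open>The end of the last group is not in \<open>boundaries ss\<close>; the bound of
      \<open>m + x\<close> by the total takes its place.\<close>
    case False
    then show ?thesis using add.prems(1) il by simp
  qed
  let ?g = "g(C := i)"
  have "(\<Sum>C | C \<in> D \<and> ?g C = j. f C) = min (m + x) (?S (Suc j)) - min (m + x) (?S j)" if j: "j < length ss" for j
  proof (cases "j = i")
    case True
    have "{C' \<in> D. ?g C' = j} = insert C {C' \<in> ?D. g C' = j}" using True C by auto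
    then have "(\<Sum>C | C \<in> D \<and> ?g C = j. f C) = x + (\<Sum>C | C \<in> ?D \<and> g C = j. f C)"
      using add.prems(2) C by (simp add: sum.insert_if)
    then show ?thesis using g(2)[OF j] True hi il mi by simp
  next
    case False
    have "{C' \<in> D. ?g C' = j} = {C' \<in> ?D. g C' = j}" using False C by auto
    then have eq: "(\<Sum>C | C \<in> D \<and> ?g C = j. f C) = min m (?S (Suc j)) - min m (?S j)" using g(2)[OF j] by simp
    show ?thesis
    proof (cases "j < i")
      case True
      then have "?S (Suc j) \<le> m" "?S j \<le> m"
        using sum_list_take_mono[of "Suc j" i ss] sum_list_take_mono[of j i ss] il by auto
      then show ?thesis unfolding eq by simp
    next
      case False
      then have "m + x \<le> ?S (Suc j)" "m + x \<le> ?S j"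
        using \<open>j \<noteq> i\<close> sum_list_take_mono[of "Suc i" j ss] sum_list_take_mono[of "Suc i" "Suc j" ss] hi by auto
      then show ?thesis unfolding eq by simp
    qed
  qed
  moreover have "\<forall>C\<in>D. ?g C < length ss" using g(1) il by auto
  ultimately show ?case by blast
qed

lemma grouped_iff_packable:
  assumes "finite D" "\<And>C. C \<in> D \<Longrightarrow> 0 < (f C :: nat)"
  shows "(\<exists>g. (\<forall>C\<in>D. g C < length ss) \<and> (\<forall>i<length ss. (\<Sum>C | C \<in> D \<and> g C = i. f C) = ss ! i))
    \<longleftrightarrow> packable (boundaries ss) (sum_list ss) (image_mset f (mset_set D))" (is "?L \<longleftrightarrow> ?R")
proof
  assume ?L
  then show ?R using packable_if_grouped[of D f _ ss] assms by blast
next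
  assume ?R
  from grouped_if_packable_aux[OF this order_refl assms(1) refl]
  obtain g where g: "\<forall>C\<in>D. g C < length ss" "\<forall>i<length ss. (\<Sum>C | C \<in> D \<and> g C = i. f C)
     = min (sum_list ss) (sum_list (take (Suc i) ss)) - min (sum_list ss) (sum_list (take i ss))" by blast
  have "sum_list (take i ss) \<le> sum_list ss" for i
    using sum_list_take_mono[of i "max i (length ss)" ss] by simp
  then have "min (sum_list ss) (sum_list (take i ss)) = sum_list (take i ss)" for i
    by (simp add: min_absorb2)
  with g have "\<forall>i<length ss. (\<Sum>C | C \<in> D \<and> g C = i. f C) = sum_list (take (Suc i) ss) - sum_list (take i ss)"
    by metis
  with g(1) show ?L by (intro exI[of _ g]) (simp add: sum_list_take_Suc)
qed

section \<open>Codes of multisets\<close>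

lemma digits_unique:
  fixes W :: nat
  assumes "\<And>x. x \<le> N \<Longrightarrow> d x < W" "\<And>x. x \<le> N \<Longrightarrow> e x < W"
    "(\<Sum>x\<le>N. d x * W ^ x) = (\<Sum>x\<le>N. e x * W ^ x)" "x \<le> N"
  shows "d x = e x"
  using assms
proof (induction N arbitrary: d e x)
  case (Suc N)
  have split: "(\<Sum>x\<le>Suc N. f x * W ^ x) = f 0 + W * (\<Sum>x\<le>N. f (Suc x) * W ^ x)" for f
    by (subst sum.atMost_Suc_shift) (simp add: sum_distrib_left ac_simps)
  have eq: "d 0 + W * (\<Sum>x\<le>N. d (Suc x) * W ^ x) = e 0 + W * (\<Sum>x\<le>N. e (Suc x) * W ^ x)"
    using Suc.prems(3) unfolding split .
  have W: "d 0 < W" "e 0 < W" using Suc.prems by auto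
  have 0: "d 0 = e 0"
    using arg_cong[OF eq, of "\<lambda>y. y mod W"] W by simp
  with eq W have "(\<Sum>x\<le>N. d (Suc x) * W ^ x) = (\<Sum>x\<le>N. e (Suc x) * W ^ x)" by simp
  then have "d (Suc y) = e (Suc y)" if "y \<le> N" for y
    using Suc.IH[of "\<lambda>x. d (Suc x)" "\<lambda>x. e (Suc x)" y] Suc.prems that by auto
  with 0 Suc.prems(4) show ?case by (cases x) auto
qed simp

lemma digits_less:
  fixes W :: nat
  assumes "\<And>x. x \<le> N \<Longrightarrow> d x < W"
  shows "(\<Sum>x\<le>N. d x * W ^ x) < W ^ Suc N"
  using assms
proof (induction N)
  case (Suc N)
  then have "(\<Sum>x\<le>N. d x * W ^ x) < W ^ Suc N" by auto
  moreover have "d (Suc N) * W ^ Suc N + W ^ Suc N \<le> W * W ^ Suc N"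
    using Suc.prems[of "Suc N"] by (metis Suc_leI add.commute mult_Suc mult_le_mono1 order_refl)
  ultimately show ?case by simp
qed simp

text \<open>A piece of size \<open>x\<close> is a unit in digit \<open>x\<close> of base
  \<open>n + 1\<close> plus a unit in digit \<open>n + 1\<close>. The top digit thus counts the
  pieces, which turns the limit on cut edges into a comparison of codes. Digit 0 is free because
  pieces are positive; it receives the open size.\<close>

definition wt :: "nat \<Rightarrow> nat \<Rightarrow> nat" where
  "wt n x = Suc n ^ x + Suc n ^ Suc n"

lemma code_simps [simp]:
  "code w {#} = 0" "code w (add_mset x \<mu>) = w x + code w \<mu>" "code w (\<mu> + \<nu>) = code w \<mu> + code w \<nu>"
  by (simp_all add: code_def)

lemma sum_mset_powers:
  "set_mset \<mu> \<subseteq> {..n} \<Longrightarrow> (\<Sum>x\<in>#\<mu>. (W::nat) ^ x) = (\<Sum>x\<le>n. count \<mu> x * W ^ x)"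
proof (induction \<mu>)
  case (add y \<mu>)
  have "(\<Sum>x\<le>n. count (add_mset y \<mu>) x * W ^ x) = (\<Sum>x\<le>n. count \<mu> x * W ^ x + (if x = y then W ^ x else 0))"
    by (intro sum.cong) auto
  also have "\<dots> = (\<Sum>x\<le>n. count \<mu> x * W ^ x) + W ^ y"
    using add.prems by (simp add: sum.distrib)
  finally show ?case using add by simp
qed simp

lemma code_wt: "code (wt n) \<mu> = (\<Sum>x\<in>#\<mu>. Suc n ^ x) + size \<mu> * Suc n ^ Suc n"
  by (induction \<mu>) (auto simp: wt_def)

lemma size_le_sum_mset: "0 \<notin># \<mu> \<Longrightarrow> size \<mu> \<le> sum_mset (\<mu> :: nat multiset)"
  by (induction \<mu>) auto

lemma member_le_sum_mset: "x \<in># \<mu> \<Longrightarrow> x \<le> sum_mset (\<mu> :: nat multiset)"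
  by (metis le_add1 mset_add sum_mset.add_mset)

definition state_digit :: "nat \<Rightarrow> nat \<Rightarrow> nat multiset \<Rightarrow> nat \<Rightarrow> nat" where
  "state_digit n a \<mu> x = (if x = 0 then a else if x \<le> n then count \<mu> x else size \<mu>)"

lemma state_code_digits:
  assumes "0 \<notin># \<mu>" "sum_mset \<mu> \<le> n"
  shows "a + code (wt n) \<mu> = (\<Sum>x\<le>Suc n. state_digit n a \<mu> x * Suc n ^ x)"
proof -
  have "set_mset \<mu> \<subseteq> {..n}" using assms member_le_sum_mset by fastforce
  then have "(\<Sum>x\<in>#\<mu>. Suc n ^ x) = (\<Sum>x\<le>n. count \<mu> x * Suc n ^ x)" by (rule sum_mset_powers)
  moreover have "a + (\<Sum>x\<le>n. count \<mu> x * Suc n ^ x) = (\<Sum>x\<le>n. state_digit n a \<mu> x * Suc n ^ x)"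
  proof -
    have z: "count \<mu> 0 = 0" using assms(1) by (simp add: not_in_iff)
    have "(\<Sum>x\<le>n. state_digit n a \<mu> x * Suc n ^ x) = (\<Sum>x\<le>n. count \<mu> x * Suc n ^ x + (if x = 0 then a else 0))"
      using z by (intro sum.cong) (auto simp: state_digit_def)
    then show ?thesis by (simp add: sum.distrib)
  qed
  ultimately show ?thesis by (simp add: code_wt state_digit_def)
qed

text \<open>No carries occur: positive pieces of total at most \<open>n\<close> number at most
  \<open>n\<close>, which bounds all multiplicities and the top digit.\<close>

lemma state_digit_less:
  assumes "0 \<notin># \<mu>" "sum_mset \<mu> \<le> n" "a \<le> n" shows "state_digit n a \<mu> x < Suc n"
  using assms size_le_sum_mset[OF assms(1)] count_le_size[of \<mu> x] by (auto simp: state_digit_def)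

lemma state_code_inj:
  assumes "0 \<notin># \<mu>" "sum_mset \<mu> \<le> n" "a \<le> n" "0 \<notin># \<nu>" "sum_mset \<nu> \<le> n" "b \<le> n"
    and eq: "a + code (wt n) \<mu> = b + code (wt n) \<nu>"
  shows "a = b" "\<mu> = \<nu>"
proof -
  have d: "state_digit n a \<mu> x = state_digit n b \<nu> x" if "x \<le> Suc n" for x
    using that by (rule digits_unique[of "Suc n" _ "Suc n", rotated 3])
      (use assms state_digit_less in \<open>auto simp: state_code_digits simp del: sum.atMost_Suc\<close>)
  show "a = b" using d[of 0] by (simp add: state_digit_def)
  show "\<mu> = \<nu>"
  proof (rule multiset_eqI)
    fix x
    consider "x = 0" | "0 < x" "x \<le> n" | "n < x" by linarith
    then show "count \<mu> x = count \<nu> x"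
    proof cases
      case 1
      then show ?thesis using assms by (simp add: not_in_iff)
    next
      case 2
      then show ?thesis using d[of x] by (simp add: state_digit_def)
    next
      case 3
      then have "x \<notin># \<mu>" "x \<notin># \<nu>" using assms member_le_sum_mset[of x] by fastforce+
      then show ?thesis by (simp add: not_in_iff)
    qed
  qed
qed

lemma code_inj:
  assumes "0 \<notin># \<mu>" "sum_mset \<mu> \<le> n" "0 \<notin># \<nu>" "sum_mset \<nu> \<le> n" "code (wt n) \<mu> = code (wt n) \<nu>"
  shows "\<mu> = \<nu>"
  using state_code_inj(2)[of \<mu> n 0 \<nu> 0] assms by simp

lemma state_code_less:
  assumes "0 \<notin># \<mu>" "sum_mset \<mu> \<le> n" "a \<le> n"
  shows "a + code (wt n) \<mu> < Suc n ^ (n + 2)"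
  using digits_less[of "Suc n" "state_digit n a \<mu>" "Suc n"] state_digit_less[OF assms]
  by (simp add: state_code_digits[OF assms(1,2)] del: sum.atMost_Suc)

lemma code_dvd: "0 \<notin># \<mu> \<Longrightarrow> Suc n dvd code (wt n) \<mu>"
proof (induction \<mu>)
  case (add x \<mu>)
  then have "Suc n dvd wt n x" unfolding wt_def by (intro dvd_add dvd_power) auto
  with add show ?case by simp
qed simp

lemma state_code_mod:
  assumes "0 \<notin># \<mu>" "a \<le> n" shows "(a + code (wt n) \<mu>) mod Suc n = a"
  using code_dvd[OF assms(1), of n] assms(2) by (metis add.commute dvd_imp_mod_0 le_imp_less_Suc mod_add_right_eq mod_less add_0_right)

text \<open>All lower digits together stay below one unit of the top digit, which is the number of
  pieces.\<close>

lemma code_less_iff_size: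
  assumes "0 \<notin># \<mu>" "sum_mset \<mu> \<le> n"
  shows "code (wt n) \<mu> < k * Suc n ^ Suc n \<longleftrightarrow> size \<mu> < k"
proof -
  have sub: "set_mset \<mu> \<subseteq> {..n}" using assms member_le_sum_mset by fastforce
  have "count \<mu> x < Suc n" for x
    using assms size_le_sum_mset[OF assms(1)] count_le_size[of \<mu> x] by simp
  then have low: "(\<Sum>x\<in>#\<mu>. Suc n ^ x) < Suc n ^ Suc n"
    unfolding sum_mset_powers[OF sub] by (intro digits_less)
  show ?thesis
  proof
    assume "size \<mu> < k"
    then have "Suc (size \<mu>) * Suc n ^ Suc n \<le> k * Suc n ^ Suc n" by (intro mult_le_mono1) auto
    with low show "code (wt n) \<mu> < k * Suc n ^ Suc n" unfolding code_wt by simp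
  next
    assume "code (wt n) \<mu> < k * Suc n ^ Suc n"
    then have "size \<mu> * Suc n ^ Suc n < k * Suc n ^ Suc n" unfolding code_wt by linarith
    then show "size \<mu> < k" by simp
  qed
qed

lemma card_state_codes:
  assumes "s \<le> n" "0 < n"
  shows "finite ((\<lambda>(a, r). a + r) ` states w s)"
    "card ((\<lambda>(a, r). a + r) ` states w s) \<le> card (partitions_upto n n)"
proof -
  have sub: "(\<lambda>(a, r). a + r) ` states w s \<subseteq> (\<lambda>\<mu>. (s - sum_mset \<mu>) + code w \<mu>) ` partitions_upto n n"
  proof
    fix c assume "c \<in> (\<lambda>(a, r). a + r) ` states w s"
    then obtain a \<mu> where c: "c = a + code w \<mu>" "0 < a" "0 \<notin># \<mu>" "a + sum_mset \<mu> = s"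
      by (auto simp: states_def)
    have "set_mset \<mu> \<subseteq> {1..n}"
    proof
      fix x assume "x \<in># \<mu>"
      with c assms member_le_sum_mset[of x \<mu>] show "x \<in> {1..n}" by (cases x) auto
    qed
    with c assms have "\<mu> \<in> partitions_upto n n" by (auto simp: partitions_upto_def)
    moreover have "c = (s - sum_mset \<mu>) + code w \<mu>" using c by auto
    ultimately show "c \<in> (\<lambda>\<mu>. (s - sum_mset \<mu>) + code w \<mu>) ` partitions_upto n n" by blast
  qed
  have fin: "finite (partitions_upto n n)" using assms(2) by (rule card_partitions_upto(1))
  with sub show "finite ((\<lambda>(a, r). a + r) ` states w s)"
    by (meson finite_imageI finite_subset)
  have "card ((\<lambda>(a, r). a + r) ` states w s) \<le> card ((\<lambda>\<mu>. (s - sum_mset \<mu>) + code w \<mu>) ` partitions_upto n n)"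
    using sub fin by (intro card_mono) auto
  also have "\<dots> \<le> card (partitions_upto n n)" using fin by (rule card_image_le)
  finally show "card ((\<lambda>(a, r). a + r) ` states w s) \<le> card (partitions_upto n n)" .
qed

section \<open>Program logic\<close>

text \<open>\<open>cost M c\<close> bounds the running time of \<open>c\<close> if every loop in it makes at most \<open>M\<close> iterations each time it
  is entered. For fixed \<open>c\<close> it is a polynomial in \<open>M\<close>, so that proofs only have to count iterations.\<close>

fun cost :: "nat \<Rightarrow> com \<Rightarrow> nat" where
  "cost M Skip = 1"
| "cost M (Assign r a) = atime a + 1"
| "cost M (Store a b) = atime a + atime b + 1"
| "cost M (Seq c d) = cost M c + cost M d"
| "cost M (Cond p c d) = btime p + 1 + (cost M c + cost M d)"
| "cost M (While p c) = Suc M * (btime p + 1 + cost M c)"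

lemma polynomial_bound_add:
  fixes a b :: nat
  assumes "a \<le> K * Suc M ^ i" "b \<le> L * Suc M ^ j"
  shows "a + b \<le> (K + L) * Suc M ^ (i + j)"
proof -
  have "K * Suc M ^ i \<le> K * Suc M ^ (i + j)" "L * Suc M ^ j \<le> L * Suc M ^ (i + j)"
    by (intro mult_le_mono2 power_increasing; simp)+
  with assms have "a + b \<le> K * Suc M ^ (i + j) + L * Suc M ^ (i + j)" by linarith
  then show ?thesis by (simp only: add_mult_distrib)
qed

lemma cost_polynomial: "\<exists>K d. \<forall>M. cost M c \<le> K * Suc M ^ d"
proof (induction c)
  case Skip
  show ?case by (intro exI[of _ 1] exI[of _ 0]) simp
next
  case (Assign r a)
  show ?case by (intro exI[of _ "atime a + 1"] exI[of _ 0]) simp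
next
  case (Store a b)
  show ?case by (intro exI[of _ "atime a + atime b + 1"] exI[of _ 0]) simp
next
  case (Seq c d)
  then obtain K i L j where "\<And>M. cost M c \<le> K * Suc M ^ i" "\<And>M. cost M d \<le> L * Suc M ^ j" by blast
  then have "cost M c + cost M d \<le> (K + L) * Suc M ^ (i + j)" for M
    by (intro polynomial_bound_add)
  then show ?case unfolding cost.simps by blast
next
  case (Cond p c d)
  then obtain K i L j where "\<And>M. cost M c \<le> K * Suc M ^ i" "\<And>M. cost M d \<le> L * Suc M ^ j" by blast
  then have "cost M c + cost M d \<le> (K + L) * Suc M ^ (i + j)" for M
    by (intro polynomial_bound_add)
  then have "cost M (Cond p c d) \<le> (btime p + 1 + (K + L)) * Suc M ^ (0 + (i + j))" for M
    unfolding cost.simps by (rule polynomial_bound_add[rotated]) simp_all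
  then show ?case by blast
next
  case (While p c)
  then obtain K i where c: "\<And>M. cost M c \<le> K * Suc M ^ i" by blast
  have "cost M (While p c) \<le> (btime p + 1 + K) * Suc M ^ Suc i" for M
  proof -
    have "btime p + 1 + cost M c \<le> (btime p + 1 + K) * Suc M ^ (0 + i)"
      using c by (rule polynomial_bound_add[rotated]) simp_all
    then have "Suc M * (btime p + 1 + cost M c) \<le> Suc M * ((btime p + 1 + K) * Suc M ^ (0 + i))"
      by (rule mult_le_mono2)
    then show ?thesis unfolding cost.simps power_Suc by (simp only: add_0 mult.left_commute)
  qed
  then show ?case by blast
qed

section \<open>Weakest preconditions with a time bound\<close>

definition runs :: "nat \<Rightarrow> com \<Rightarrow> state \<Rightarrow> (state \<Rightarrow> bool) \<Rightarrow> bool" where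
  "runs M c s Q \<longleftrightarrow> (\<exists>t s'. exec c s t s' \<and> t \<le> cost M c \<and> Q s')"

text \<open>The clause for loops is \<open>runs\<close> itself: programs carry no invariants, and
  \<open>wp_while\<close> supplies one at each use. Removing the clause from the simplifier keeps
  loops folded until then.\<close>

fun wp :: "nat \<Rightarrow> com \<Rightarrow> (state \<Rightarrow> bool) \<Rightarrow> state \<Rightarrow> bool" where
  "wp M Skip Q s = Q s"
| "wp M (Assign r a) Q s = Q ((fst s)(r := aval a s), snd s)"
| "wp M (Store a b) Q s = Q (fst s, (snd s)(aval a s := aval b s))"
| "wp M (Seq c d) Q s = wp M c (wp M d Q) s"
| "wp M (Cond p c d) Q s = (if bval p s then wp M c Q s else wp M d Q s)"
| "wp M (While p c) Q s = runs M (While p c) s Q"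

lemma wp_imp_runs: "wp M c Q s \<Longrightarrow> runs M c s Q"
proof (induction c arbitrary: Q s)
  case Skip
  then show ?case unfolding runs_def wp.simps by (intro exI[of _ 1] exI[of _ s] conjI exec.Skip) simp_all
next
  case (Assign r a)
  then show ?case unfolding runs_def wp.simps by (blast intro: exec.Assign order_eq_refl cost.simps(2)[symmetric])
next
  case (Store a b)
  then show ?case unfolding runs_def wp.simps by (blast intro: exec.Store order_eq_refl cost.simps(3)[symmetric])
next
  case (Seq c d)
  from Seq.prems have "runs M c s (wp M d Q)" by (auto intro: Seq.IH)
  then obtain t s' where 1: "exec c s t s'" "t \<le> cost M c" "wp M d Q s'" by (auto simp: runs_def)
  from Seq.IH(2)[OF 1(3)] obtain t' s'' where 2: "exec d s' t' s''" "t' \<le> cost M d" "Q s''"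
    by (auto simp: runs_def)
  from exec.Seq[OF 1(1) 2(1)] 1(2) 2(2,3) show ?case
    unfolding runs_def by (intro exI[of _ "t + t'"] exI[of _ s'']) auto
next
  case (Cond p c d)
  show ?case
  proof (cases "bval p s")
    case True
    with Cond.prems Cond.IH(1)[of Q s] have "runs M c s Q" by simp
    then obtain t s' where "exec c s t s'" "t \<le> cost M c" "Q s'" unfolding runs_def by blast
    with exec.CondT[OF True] show ?thesis
      unfolding runs_def by (intro exI[of _ "btime p + 1 + t"] exI[of _ s']) auto
  next
    case False
    with Cond.prems Cond.IH(2)[of Q s] have "runs M d s Q" by simp
    then obtain t s' where "exec d s t s'" "t \<le> cost M d" "Q s'" unfolding runs_def by blast
    with exec.CondF[OF False] show ?thesis
      unfolding runs_def by (intro exI[of _ "btime p + 1 + t"] exI[of _ s']) auto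
  qed
next
  case (While p c)
  then show ?case by simp
qed

declare wp.simps(6) [simp del]

lemma wp_Seq: "wp M (Seq c d) Q = wp M c (wp M d Q)"
  by (rule ext) simp

lemma wp_mono: "wp M c Q s \<Longrightarrow> (\<And>s. Q s \<Longrightarrow> Q' s) \<Longrightarrow> wp M c Q' s"
proof (induction c arbitrary: Q Q' s)
  case (Seq c d)
  then show ?case by (simp only: wp.simps)
next
  case (While p c)
  then show ?case unfolding wp.simps runs_def by blast
qed (auto split: if_splits)

text \<open>The invariant is indexed by the number of completed iterations and the loop makes
  exactly \<open>N\<close> of them, so the index yields termination and the time bound at
  once.\<close>

lemma wp_while:
  assumes "I 0 R m" "N \<le> M"
    and step: "\<And>i R m. i < N \<Longrightarrow> I i R m \<Longrightarrow> bval p (R, m) \<and> wp M c (\<lambda>(R, m). I (Suc i) R m) (R, m)"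
    and stop: "\<And>R m. I N R m \<Longrightarrow> \<not> bval p (R, m)"
    and Q: "\<And>R m. I N R m \<Longrightarrow> Q (R, m)"
  shows "wp M (While p c) Q (R, m)"
proof -
  \<comment> \<open>The generalisation counts the \<open>k\<close> iterations that remain; the
    additional one in \<open>Suc k\<close> pays for the final test.\<close>
  have "\<exists>t s'. exec (While p c) (R, m) t s' \<and> t \<le> Suc k * (btime p + 1 + cost M c) \<and> Q s'"
    if "I i R m" "i + k = N" for i k R m
    using that
  proof (induction k arbitrary: i R m)
    case 0
    then have "exec (While p c) (R, m) (btime p + 1) (R, m)" by (intro exec.WhileF) (auto dest: stop)
    with 0 Q show ?case by (intro exI[of _ "btime p + 1"] exI[of _ "(R, m)"]) auto
  next
    case (Suc k)
    then have b: "bval p (R, m)" and "wp M c (\<lambda>(R, m). I (Suc i) R m) (R, m)"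
      using step[of i R m] by auto
    from wp_imp_runs[OF this(2)] obtain t R' m' where
      1: "exec c (R, m) t (R', m')" "t \<le> cost M c" "I (Suc i) R' m'" by (auto simp: runs_def)
    from Suc.IH[OF 1(3)] Suc.prems obtain t' s' where
      2: "exec (While p c) (R', m') t' s'" "t' \<le> Suc k * (btime p + 1 + cost M c)" "Q s'" by auto
    from exec.WhileT[OF b 1(1) 2(1)] 1(2) 2(2,3) show ?case
      by (intro exI[of _ "btime p + 1 + t + t'"] exI[of _ s']) auto
  qed
  from this[of 0 R m N] assms(1) obtain t s' where
    "exec (While p c) (R, m) t s'" "t \<le> Suc N * (btime p + 1 + cost M c)" "Q s'" by auto
  moreover have "Suc N * (btime p + 1 + cost M c) \<le> cost M (While p c)"
    unfolding cost.simps using assms(2) by (intro mult_le_mono1) simp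
  ultimately show ?thesis unfolding wp.simps runs_def by (meson order_trans)
qed

text \<open>A set of positive numbers is stored as a linked list that is threaded through its own membership
  table: cell 0 holds the first element, the cell of a member holds the successor of the next element
  (0 ends the list), the cells of nonmembers hold 0.\<close>

definition linked :: "(nat \<Rightarrow> nat) \<Rightarrow> nat list \<Rightarrow> bool" where
  "linked g xs \<longleftrightarrow> distinct xs \<and> 0 \<notin> set xs \<and> g 0 = (xs @ [0]) ! 0 \<and>
     (\<forall>i<length xs. g (xs ! i) = Suc ((xs @ [0]) ! Suc i)) \<and> (\<forall>x. x \<noteq> 0 \<longrightarrow> x \<notin> set xs \<longrightarrow> g x = 0)"

definition table :: "(nat \<Rightarrow> nat) \<Rightarrow> nat set \<Rightarrow> bool" where
  "table g S \<longleftrightarrow> (\<exists>xs. linked g xs \<and> set xs = S)"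

text \<open>Links are stored increased by 1, which keeps the cell of the last member nonzero; one
  cell is thus both link and membership flag.\<close>

definition insert_fun :: "(nat \<Rightarrow> nat) \<Rightarrow> nat \<Rightarrow> nat \<Rightarrow> nat" where
  "insert_fun g x = (if g x = 0 then g(x := Suc (g 0), 0 := x) else g)"

lemma table_empty: "table (\<lambda>_. 0) {}"
  by (auto simp: table_def linked_def)

lemma table_member: "table g S \<Longrightarrow> x \<noteq> 0 \<Longrightarrow> g x = 0 \<longleftrightarrow> x \<notin> S"
  unfolding table_def linked_def by (metis in_set_conv_nth nat.distinct(1))

lemma table_insert:
  assumes "table g S" "x \<noteq> 0" shows "table (insert_fun g x) (insert x S)"
proof (cases "x \<in> S")
  case True
  then show ?thesis using assms table_member[OF assms] by (simp add: insert_fun_def insert_absorb)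
next
  case False
  from assms(1) obtain xs where xs: "linked g xs" "set xs = S" by (auto simp: table_def)
  have "linked (g(x := Suc (g 0), 0 := x)) (x # xs)"
    using xs False assms(2) nth_mem[of _ xs] unfolding linked_def
    by (simp add: All_less_Suc2) metis
  with xs False table_member[OF assms] show ?thesis
    by (auto simp: insert_fun_def table_def intro!: exI[of _ "x # xs"])
qed

lemma table_singleton: "table ((\<lambda>_. 0)(0 := Suc 0, Suc 0 := Suc 0)) {Suc 0}"
  by (auto simp: table_def linked_def intro!: exI[of _ "[Suc 0]"])

text \<open>The memory access in \<open>aval\<close> has a variable as its head, which rules it out as a rewrite target;
  \<open>rd\<close> makes it one.\<close>

definition rd :: "(nat \<Rightarrow> nat) \<Rightarrow> nat \<Rightarrow> nat" where
  "rd m a = m a"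

lemma aval_Mem_rd: "aval (Mem a) s = rd (snd s) (aval a s)"
  by (simp add: rd_def)

lemmas aval_rd = aval.simps(1,2) aval_Mem_rd aval.simps(4,5)

declare aval.simps(3) [simp del]

section \<open>Insertion into a table and traversal of a table\<close>

definition insert_prog :: "nat \<Rightarrow> nat \<Rightarrow> com" where
  "insert_prog b c = Cond (Less (Mem (Plus (Reg b) (Reg c))) (Num 1))
     (Seq (Store (Plus (Reg b) (Reg c)) (Plus (Mem (Reg b)) (Num 1))) (Store (Reg b) (Reg c))) Skip"

definition insert_mem :: "(nat \<Rightarrow> nat) \<Rightarrow> nat \<Rightarrow> nat \<Rightarrow> nat \<Rightarrow> nat" where
  "insert_mem m b c = (if m (b + c) = 0 then m(b + c := Suc (m b), b := c) else m)"

lemma wp_insert [simp]: "wp M (insert_prog b c) Q (R, m) = Q (R, insert_mem m (R b) (R c))"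
  by (simp add: insert_prog_def insert_mem_def aval_Mem_rd rd_def)

text \<open>The link is read after the body, so the traversed table must survive the body unchanged;
  new elements go to other blocks.\<close>

definition for_table :: "nat \<Rightarrow> nat \<Rightarrow> com \<Rightarrow> com" where
  "for_table u c body = Seq (Assign c (Mem (Reg u)))
     (While (Less (Num 0) (Reg c)) (Seq body (Assign c (Minus (Mem (Plus (Reg u) (Reg c))) (Num 1)))))"

locale blocks =
  fixes B Z :: nat
  assumes Z_gt_1: "1 < Z"
begin

definition bs :: "nat \<Rightarrow> nat" where
  "bs t = B + t * Z"

text \<open>Reading 0 beyond the end makes a block a total function to which \<open>table\<close>
  applies, independent of what its neighbours hold.\<close>

definition blk :: "(nat \<Rightarrow> nat) \<Rightarrow> nat \<Rightarrow> nat \<Rightarrow> nat" where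
  "blk m t i = (if i < Z then m (bs t + i) else 0)"

lemma bs_Suc [simp]: "bs t + Z = bs (Suc t)"
  by (simp add: bs_def)

lemma address_inj: "i < Z \<Longrightarrow> j < Z \<Longrightarrow> bs t + i = bs u + j \<longleftrightarrow> t = u \<and> i = j"
proof
  assume a: "i < Z" "j < Z" "bs t + i = bs u + j"
  then have e: "t * Z + i = u * Z + j" by (simp add: bs_def)
  from arg_cong[OF e, of "\<lambda>x. x div Z"] arg_cong[OF e, of "\<lambda>x. x mod Z"] a show "t = u \<and> i = j" by simp
qed simp

text \<open>The variants with \<open>Suc\<close> match the addresses as the simplifier normalises
  them.\<close>

lemma rd_blk [simp]:
  "i < Z \<Longrightarrow> rd m (bs t + i) = blk m t i"
  "rd m (bs t) = blk m t 0"
  "Suc i < Z \<Longrightarrow> rd m (Suc (bs t + i)) = blk m t (Suc i)"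
  "rd m (Suc (bs t)) = blk m t (Suc 0)"
  using Z_gt_1 by (simp_all add: rd_def blk_def)

lemma blk_upd [simp]:
  "i < Z \<Longrightarrow> blk (m(bs t + i := v)) = (blk m)(t := (blk m t)(i := v))"
proof (intro ext)
  fix u j assume "i < Z"
  then show "blk (m(bs t + i := v)) u j = ((blk m)(t := (blk m t)(i := v))) u j"
    using address_inj[of j i u t] by (auto simp: blk_def)
qed

lemma blk_upd' [simp]:
  "blk (m(bs t := v)) = (blk m)(t := (blk m t)(0 := v))"
  "Suc i < Z \<Longrightarrow> blk (m(Suc (bs t + i) := v)) = (blk m)(t := (blk m t)(Suc i := v))"
  "blk (m(Suc (bs t) := v)) = (blk m)(t := (blk m t)(Suc 0 := v))"
  using blk_upd[of 0 m t v] blk_upd[of "Suc i" m t v] blk_upd[of "Suc 0" m t v] Z_gt_1 by simp_all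

lemma blk_insert [simp]:
  "c < Z \<Longrightarrow> blk (insert_mem m (bs t) c) = (blk m)(t := insert_fun (blk m t) c)"
proof -
  assume c: "c < Z"
  have "m (bs t + c) = blk m t c" "m (bs t) = blk m t 0" using c by (auto simp: blk_def)
  then show ?thesis using c by (auto simp: insert_mem_def insert_fun_def)
qed

text \<open>The invariant \<open>J\<close> depends on the set of processed elements and not on their
  order, so callers never see the list. \<open>keep\<close> says that the traversed table stays
  intact, \<open>indep\<close> that \<open>J\<close> ignores the loop register.\<close>

lemma wp_for_table:
  assumes tab: "table g S" and S: "\<And>x. x \<in> S \<Longrightarrow> x < Z" and M: "card S \<le> M"
    and init: "J {} R m"
    and step: "\<And>x D R m. x \<in> S \<Longrightarrow> x \<noteq> 0 \<Longrightarrow> x < Z \<Longrightarrow> D \<subseteq> S \<Longrightarrow> J D R m \<Longrightarrow> R c = x \<Longrightarrow>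
        wp M body (\<lambda>(R, m). J (insert x D) R m \<and> R c = x) (R, m)"
    and keep: "\<And>D R m. J D R m \<Longrightarrow> R u = bs t \<and> blk m t = g"
    and indep: "\<And>D R m y. J D R m \<Longrightarrow> J D (R(c := y)) m"
    and Q: "\<And>R m. J S R m \<Longrightarrow> Q (R, m)"
  shows "wp M (for_table u c body) Q (R, m)"
proof -
  have start: "R u = bs t" "m (bs t) = g 0"
    using keep[OF init] Z_gt_1 by (auto simp: blk_def)
  from tab obtain xs where xs: "linked g xs" "set xs = S" by (auto simp: table_def)
  then have len: "length xs = card S" using distinct_card[of xs] by (auto simp: linked_def)
  let ?I = "\<lambda>i R m. J (set (take i xs)) R m \<and> R c = (xs @ [0]) ! i"
  have "wp M (While (Less (Num 0) (Reg c)) (Seq body (Assign c (Minus (Mem (Plus (Reg u) (Reg c))) (Num 1))))) Q (R(c := g 0), m)"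
  proof (rule wp_while[where I = ?I and N = "length xs"])
    show "?I 0 (R(c := g 0)) m" using indep[OF init] xs by (simp add: linked_def)
    show "length xs \<le> M" using len M by simp
  next
    fix i R m assume i: "i < length xs" and I: "?I i R m"
    let ?x = "xs ! i"
    have "?x \<in> S" using xs(2) i by auto
    moreover have "?x \<noteq> 0" using xs i unfolding linked_def by (metis nth_mem)
    ultimately have x: "?x \<in> S" "?x \<noteq> 0" "?x < Z" "R c = ?x"
      using i I S by (auto simp: nth_append simp del: nth_mem)
    have sub: "set (take i xs) \<subseteq> S" using set_take_subset[of i xs] xs by simp
    have ins: "insert ?x (set (take i xs)) = set (take (Suc i) xs)"
      using i by (simp add: take_Suc_conv_app_nth)
    have nxt: "g ?x = Suc ((xs @ [0]) ! Suc i)" using xs i by (auto simp: linked_def)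
    have "wp M body (\<lambda>(R, m). J (insert ?x (set (take i xs))) R m \<and> R c = ?x) (R, m)"
      using step[OF x(1-3) sub] I x by blast
    then have "wp M (Seq body (Assign c (Minus (Mem (Plus (Reg u) (Reg c))) (Num 1))))
       (\<lambda>(R, m). ?I (Suc i) R m) (R, m)"
      unfolding wp.simps
    proof (rule wp_mono)
      fix s assume "case s of (R, m) \<Rightarrow> J (insert ?x (set (take i xs))) R m \<and> R c = ?x"
      then obtain R m where s: "s = (R, m)" and J: "J (insert ?x (set (take i xs))) R m" "R c = ?x"
        by (cases s) auto
      have "aval (Minus (Mem (Plus (Reg u) (Reg c))) (Num 1)) (R, m) = (xs @ [0]) ! Suc i"
        using keep[OF J(1)] J(2) x(3) nxt by (simp add: aval_Mem_rd)
      with indep[OF J(1)] J show "case ((fst s)(c := aval (Minus (Mem (Plus (Reg u) (Reg c))) (Num 1)) s), snd s) of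
          (R, m) \<Rightarrow> ?I (Suc i) R m"
        by (simp add: ins s)
    qed
    then show "bval (Less (Num 0) (Reg c)) (R, m) \<and> wp M (Seq body (Assign c (Minus (Mem (Plus (Reg u) (Reg c))) (Num 1))))
       (\<lambda>(R, m). ?I (Suc i) R m) (R, m)" using x by simp
  next
    fix R m assume "?I (length xs) R m"
    then show "\<not> bval (Less (Num 0) (Reg c)) (R, m)" "Q (R, m)" using Q xs by (auto simp: nth_append)
  qed
  then show ?thesis using start by (simp add: for_table_def aval_Mem_rd rd_def)
qed

end

section \<open>The program for Tree Partitioning\<close>

abbreviation (input) seq_com (infixr ";;" 60) where "c ;; d \<equiv> Seq c d"
abbreviation (input) assign_com (infix "::=" 61) where "r ::= a \<equiv> Assign r a"
abbreviation (input) plus_aexp (infixl "\<oplus>" 65) where "a \<oplus> b \<equiv> Plus a b"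
abbreviation (input) minus_aexp (infixl "\<ominus>" 65) where "a \<ominus> b \<equiv> Minus a b"

text \<open>Registers below 20 are constant after the initialisation, except for register 0, which is reserved for the
  verdict. The input is followed in memory by the powers of \<open>n + 1\<close> up to the exponent \<open>n + 1\<close> and then by blocks of
  length \<open>(n + 1) ^ (n + 2)\<close>, an upper bound of all codes. Blocks 2 to 7 hold the boundaries, the visited
  vertices, the two components of the growth sequence, the map from codes of states to the sizes of the open
  components, and for each vertex the address of its current table; the tables of codes start at block 8.\<close>

abbreviation (input) "rN \<equiv> (2 :: nat)"
abbreviation (input) "rK \<equiv> (3 :: nat)"
abbreviation (input) "rE \<equiv> (4 :: nat)"
abbreviation (input) "rL \<equiv> (5 :: nat)"
abbreviation (input) "rZ \<equiv> (6 :: nat)"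
abbreviation (input) "rTop \<equiv> (7 :: nat)"
abbreviation (input) "rT \<equiv> (8 :: nat)"
abbreviation (input) "rBd \<equiv> (9 :: nat)"
abbreviation (input) "rVis \<equiv> (10 :: nat)"
abbreviation (input) "rPar \<equiv> (11 :: nat)"
abbreviation (input) "rChi \<equiv> (12 :: nat)"
abbreviation (input) "rSiz \<equiv> (13 :: nat)"
abbreviation (input) "rCur \<equiv> (14 :: nat)"
abbreviation (input) "rF \<equiv> (20 :: nat)"
abbreviation (input) "rI \<equiv> (21 :: nat)"
abbreviation (input) "rX \<equiv> (22 :: nat)"
abbreviation (input) "rY \<equiv> (23 :: nat)"
abbreviation (input) "rP \<equiv> (24 :: nat)"
abbreviation (input) "rQ \<equiv> (25 :: nat)"
abbreviation (input) "rU \<equiv> (26 :: nat)"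
abbreviation (input) "rV \<equiv> (27 :: nat)"
abbreviation (input) "rC \<equiv> (28 :: nat)"
abbreviation (input) "rD \<equiv> (29 :: nat)"
abbreviation (input) "rA \<equiv> (30 :: nat)"
abbreviation (input) "rG \<equiv> (31 :: nat)"
abbreviation (input) "rS \<equiv> (32 :: nat)"

text \<open>The machine has no multiplication, so a factor \<open>n + 1\<close> is spent as that
  many additions.\<close>

definition mult_loop :: com where
  "mult_loop = While (Less (Reg rY) (Reg rN \<oplus> Num 1)) (rQ ::= Reg rQ \<oplus> Reg rP ;; rY ::= Reg rY \<oplus> Num 1)"

text \<open>The power that follows the last stored one remains in \<open>rP\<close> and becomes the
  block length.\<close>

definition weights_loop :: com where
  "weights_loop = While (Less (Reg rX) (Reg rN \<oplus> Num 2))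
     (Store (Reg rL \<oplus> Reg rX) (Reg rP) ;; rQ ::= Num 0 ;; rY ::= Num 0 ;; mult_loop ;;
      rP ::= Reg rQ ;; rX ::= Reg rX \<oplus> Num 1)"

text \<open>\<open>init_prog\<close> starts the threshold at two units of the top digit: one for the
  component that exists without cuts, one because the comparison is strict. Capping \<open>k\<close>
  at \<open>n\<close> keeps the loop short and is harmless, as there are never more than
  \<open>n\<close> components.\<close>

definition threshold_loop :: com where
  "threshold_loop = While (Conj (Less (Reg rX) (Reg rK)) (Less (Reg rX) (Reg rN)))
     (rT ::= Reg rT \<oplus> Reg rTop ;; rX ::= Reg rX \<oplus> Num 1)"

definition read_prog :: com where
  "read_prog =
     (rN ::= Mem (Num 0) ;; rK ::= Mem (Num 1) ;;
      rE ::= Num 3 \<oplus> (Reg rN \<ominus> Num 1) \<oplus> (Reg rN \<ominus> Num 1) ;;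
      rL ::= Reg rE \<oplus> Mem (Num 2) ;; rP ::= Num 1)"

definition layout_prog :: com where
  "layout_prog =
     (rBd ::= Reg rL \<oplus> Reg rN \<oplus> Num 2 \<oplus> Reg rZ \<oplus> Reg rZ ;;
      rVis ::= Reg rBd \<oplus> Reg rZ ;; rPar ::= Reg rVis \<oplus> Reg rZ ;; rChi ::= Reg rPar \<oplus> Reg rZ ;;
      rSiz ::= Reg rChi \<oplus> Reg rZ ;; rCur ::= Reg rSiz \<oplus> Reg rZ ;; rX ::= Num 0 ;; rS ::= Num 0)"

definition init_prog :: com where
  "init_prog = (read_prog ;; weights_loop ;; rZ ::= Reg rP ;;
      rTop ::= Mem (Reg rL \<oplus> (Reg rN \<oplus> Num 1)) ;; rT ::= Reg rTop \<oplus> Reg rTop ;; rX ::= Num 0 ;;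
      threshold_loop ;; layout_prog)"

definition boundary_body :: com where
  "boundary_body = (Store (Reg rBd \<oplus> Reg rS) (Num 1) ;;
      rS ::= Reg rS \<oplus> Mem (Reg rE \<oplus> Reg rX) ;; rX ::= Reg rX \<oplus> Num 1)"

text \<open>Stopping once the sum exceeds \<open>n\<close> keeps the marked address inside its block
  and limits the number of positive sizes read to \<open>n + 1\<close>.\<close>

definition boundary_cond :: bexp where
  "boundary_cond = Conj (Less (Reg rX) (Mem (Num 2))) (Less (Reg rS) (Reg rN \<oplus> Num 1))"

definition grow_step :: "nat \<Rightarrow> nat \<Rightarrow> com" where
  "grow_step u v = Cond (Conj (Less (Num 0) (Mem (Reg rVis \<oplus> Reg u))) (Less (Mem (Reg rVis \<oplus> Reg v)) (Num 1)))
     (Store (Reg rPar \<oplus> Reg rI) (Reg u) ;; Store (Reg rChi \<oplus> Reg rI) (Reg v) ;;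
      Store (Reg rVis \<oplus> Reg v) (Num 1) ;; rI ::= Reg rI \<oplus> Num 1) Skip"

definition scan_loop :: com where
  "scan_loop = While (Less (Reg rY \<oplus> Num 1) (Reg rN))
     (rU ::= Mem (Reg rA) ;; rV ::= Mem (Reg rA \<oplus> Num 1) ;; grow_step rU rV ;; grow_step rV rU ;;
      rA ::= Reg rA \<oplus> Num 2 ;; rY ::= Reg rY \<oplus> Num 1)"

text \<open>The edge list is rescanned instead of building adjacency lists: as long as vertices are
  missing, each pass attaches at least one, so \<open>n\<close> passes suffice.\<close>

definition grow_loop :: com where
  "grow_loop = While (Less (Reg rX) (Reg rN))
     (rY ::= Num 0 ;; rA ::= Num 3 ;; scan_loop ;; rX ::= Reg rX \<oplus> Num 1)"

text \<open>The two stores at \<open>rF\<close> build the list with the single code 1, the state of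
  open size 1 with nothing cut off.\<close>

definition singletons_loop :: com where
  "singletons_loop = While (Less (Reg rX) (Reg rN))
     (Store (Reg rCur \<oplus> Reg rX) (Reg rF) ;; Store (Reg rF) (Num 1) ;; Store (Reg rF \<oplus> Num 1) (Num 1) ;;
      rF ::= Reg rF \<oplus> Reg rZ ;; rX ::= Reg rX \<oplus> Num 1)"

text \<open>\<open>rC\<close> is a code of the child and \<open>rD\<close> one of the parent. Their
  sum keeps the edge, since open sizes and multisets both add up; exchanging the child's open size
  in digit 0 for its weight cuts the edge. Open sizes are looked up because the machine cannot take
  remainders.\<close>

definition merge_body :: com where
  "merge_body = (rX ::= Reg rC \<oplus> Reg rD ;; insert_prog rF rX ;;
         Store (Reg rSiz \<oplus> Reg rX) (Mem (Reg rSiz \<oplus> Reg rC) \<oplus> Mem (Reg rSiz \<oplus> Reg rD)) ;;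
         rX ::= Reg rX \<ominus> Mem (Reg rSiz \<oplus> Reg rC) \<oplus> (Mem (Reg rL \<oplus> Mem (Reg rSiz \<oplus> Reg rC)) \<oplus> Reg rTop) ;;
         insert_prog rF rX ;; Store (Reg rSiz \<oplus> Reg rX) (Mem (Reg rSiz \<oplus> Reg rD)))"

text \<open>Each merge fills a fresh block, to which the parent is redirected afterwards, so the two
  tables being traversed do not change.\<close>

definition merge_loop :: com where
  "merge_loop = While (Less (Num 0) (Reg rI))
     (rI ::= Reg rI \<ominus> Num 1 ;;
      rU ::= Mem (Reg rCur \<oplus> Mem (Reg rChi \<oplus> Reg rI)) ;;
      rV ::= Mem (Reg rCur \<oplus> Mem (Reg rPar \<oplus> Reg rI)) ;;
      for_table rU rC (for_table rV rD merge_body) ;;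
      Store (Reg rCur \<oplus> Mem (Reg rPar \<oplus> Reg rI)) (Reg rF) ;; rF ::= Reg rF \<oplus> Reg rZ)"

text \<open>\<open>rG\<close> counts the boundaries strictly between \<open>rX\<close> and
  \<open>rY\<close>. It is increased only after the insertion for \<open>rY\<close>, because a piece
  may end on a boundary.\<close>

definition pieces_loop :: com where
  "pieces_loop = While (Less (Reg rY) (Reg rN \<oplus> Num 1))
     (Cond (Less (Reg rG) (Num 1))
        (rD ::= Reg rC \<oplus> (Mem (Reg rL \<oplus> (Reg rY \<ominus> Reg rX)) \<oplus> Reg rTop) ;; insert_prog rV rD) Skip ;;
      rG ::= Reg rG \<oplus> Mem (Reg rBd \<oplus> Reg rY) ;; rV ::= Reg rV \<oplus> Reg rZ ;; rY ::= Reg rY \<oplus> Num 1)"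

text \<open>Pieces have positive length, so the table for length \<open>rX\<close> is complete when
  it is traversed, and only tables for larger lengths grow.\<close>

definition pack_loop :: com where
  "pack_loop = While (Less (Reg rX) (Reg rN))
     (for_table rQ rC (rV ::= Reg rQ \<oplus> Reg rZ ;; rG ::= Num 0 ;; rY ::= Reg rX \<oplus> Num 1 ;; pieces_loop) ;;
      rQ ::= Reg rQ \<oplus> Reg rZ ;; rX ::= Reg rX \<oplus> Num 1)"

text \<open>The open component of vertex 0 is closed before the lookup. Packable codes are stored
  increased by 1, since the empty multiset has code 0 and tables hold positive numbers only.\<close>

definition check_prog :: com where
  "check_prog = (rU ::= Mem (Reg rCur) ;;
     for_table rU rC
       (rX ::= Reg rC \<ominus> Mem (Reg rSiz \<oplus> Reg rC) \<oplus> (Mem (Reg rL \<oplus> Mem (Reg rSiz \<oplus> Reg rC)) \<oplus> Reg rTop) ;;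
        Cond (Conj (Less (Reg rX) (Reg rT)) (Less (Num 0) (Mem (Reg rQ \<oplus> (Reg rX \<oplus> Num 1)))))
          (0 ::= Num 1) Skip))"

definition main_prog :: com where
  "main_prog = (Store (Reg rVis) (Num 1) ;; rI ::= Num 0 ;; rX ::= Num 0 ;; grow_loop ;;
     Store (Reg rSiz \<oplus> Num 1) (Num 1) ;; rX ::= Num 0 ;; rF ::= Reg rCur \<oplus> Reg rZ ;; singletons_loop ;;
     merge_loop ;;
     rQ ::= Reg rF ;; Store (Reg rQ) (Num 1) ;; Store (Reg rQ \<oplus> Num 1) (Num 1) ;; rX ::= Num 0 ;; pack_loop ;;
     check_prog)"

definition tp_prog :: com where
  "tp_prog = (init_prog ;; While boundary_cond boundary_body ;;
     Cond (Conj (Neg (Less (Reg rS) (Reg rN))) (Neg (Less (Reg rN) (Reg rS)))) main_prog Skip)"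

section \<open>Memory layout of an instance\<close>

lemma flatten_edges_length: "length (flatten_edges es) = 2 * length es"
  by (induction es) (auto simp: flatten_edges_def)

lemma flatten_edges_nth:
  "j < length es \<Longrightarrow> flatten_edges es ! (2 * j) = fst (es ! j) \<and> flatten_edges es ! Suc (2 * j) = snd (es ! j)"
proof (induction es arbitrary: j)
  case (Cons e es)
  then show ?case by (cases j) (auto simp: flatten_edges_def split: prod.splits)
qed simp

text \<open>\<open>base\<close> is the address of the group sizes and \<open>weights\<close> that of
  the powers of \<open>n + 1\<close>. \<open>M\<close> bounds the iterations of every loop except
  the one over the group sizes, which is accounted for separately.\<close>

locale tp_run = blocks +
  fixes n :: nat and es :: "(nat \<times> nat) list" and k :: nat and ss :: "nat list" and M :: nat
    and base weights :: nat
  assumes tree: "represents_tree n es"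
    and base: "base = 3 + 2 * (n - 1)" and weights: "weights = base + length ss"
    and B: "B = weights + n + 2" and Z: "Z = Suc n ^ (n + 2)"
    and M: "n + 2 \<le> M" "card (partitions_upto n n) \<le> M"
begin

definition m0 :: "nat \<Rightarrow> nat" where
  "m0 = snd (initial_state (tp_encode (n, es, k, ss)))"

lemma n_pos: "0 < n"
  using tree by (auto simp: represents_tree_def is_tree_def)

lemma length_es: "length es = n - 1"
  using tree by (rule represents_tree_length)

lemma length_encode: "length (tp_encode (n, es, k, ss)) = weights"
  by (simp add: tp_encode_def weights base length_es flatten_edges_length)

lemma m0_simps:
  "m0 0 = n" "m0 (Suc 0) = k" "m0 2 = length ss"
  "j < n - 1 \<Longrightarrow> m0 (3 + 2 * j) = fst (es ! j)"
  "j < n - 1 \<Longrightarrow> m0 (Suc (3 + 2 * j)) = snd (es ! j)"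
  "i < length ss \<Longrightarrow> m0 (base + i) = ss ! i"
  "weights \<le> a \<Longrightarrow> m0 a = 0"
proof -
  have m0: "m0 a = (if a < weights then ([n, k, length ss] @ flatten_edges es @ ss) ! a else 0)" for a
    using length_encode by (simp add: m0_def initial_state_def tp_encode_def)
  show "m0 0 = n" "m0 (Suc 0) = k" "m0 2 = length ss"
    unfolding m0 by (simp_all add: weights base)
  show "m0 (3 + 2 * j) = fst (es ! j)" "m0 (Suc (3 + 2 * j)) = snd (es ! j)" if "j < n - 1"
    using that flatten_edges_nth[of j es] unfolding m0
    by (simp_all add: weights base length_es flatten_edges_length nth_append numeral_3_eq_3)
  show "m0 (base + i) = ss ! i" if "i < length ss"
    using that unfolding m0
    by (simp add: weights base length_es flatten_edges_length nth_append numeral_3_eq_3)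
  show "m0 a = 0" if "weights \<le> a" using that by (simp add: m0)
qed

definition env :: "(nat \<Rightarrow> nat) \<Rightarrow> bool" where
  "env R \<longleftrightarrow> R rN = n \<and> R rK = k \<and> R rE = base \<and> R rL = weights \<and> R rZ = Z \<and> R rTop = Suc n ^ Suc n \<and>
    R rT = (2 + min k n) * Suc n ^ Suc n \<and> R rBd = bs 2 \<and> R rVis = bs 3 \<and> R rPar = bs 4 \<and> R rChi = bs 5 \<and>
    R rSiz = bs 6 \<and> R rCur = bs 7"

lemma env_upd [simp]: "20 \<le> r \<or> r = 0 \<Longrightarrow> env (R(r := v)) = env R"
  by (auto simp: env_def)

definition low :: "(nat \<Rightarrow> nat) \<Rightarrow> bool" where
  "low m \<longleftrightarrow> (\<forall>a<weights. m a = m0 a) \<and> (\<forall>x\<le>Suc n. m (weights + x) = Suc n ^ x)"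

lemma low_cong: "(\<And>a. a < B \<Longrightarrow> m a = m' a) \<Longrightarrow> low m = low m'"
  unfolding low_def B by simp

lemma low_upd [simp]:
  "low (m(bs t + i := v)) = low m" "low (m(bs t := v)) = low m"
  "low (m(Suc (bs t + i) := v)) = low m" "low (m(Suc (bs t) := v)) = low m"
  "low (insert_mem m (bs t) c) = low m"
  by (rule low_cong; simp add: bs_def insert_mem_def)+

lemma rd_weight [simp]: "low m \<Longrightarrow> x \<le> Suc n \<Longrightarrow> rd m (weights + x) = Suc n ^ x"
  by (simp add: low_def rd_def)

lemma rd_input: "low m \<Longrightarrow> a < weights \<Longrightarrow> rd m a = m0 a"
  by (simp add: low_def rd_def)

lemma n_less_Z: "n + 1 < Z"
proof -
  have "Suc n ^ 2 \<le> Suc n ^ (n + 2)" by (rule power_increasing) auto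
  moreover have "n + 1 < Suc n ^ 2" using n_pos by (simp add: power2_eq_square)
  ultimately show ?thesis unfolding Z by linarith
qed

lemma le_n_less_Z [simp]: "i \<le> n \<Longrightarrow> i < Z" "i \<le> n \<Longrightarrow> Suc i < Z"
  using n_less_Z by auto

lemma wp_mult_loop:
  assumes "R rN = n" "R rQ = 0" "R rY = 0" "Q (R(rQ := Suc n * R rP, rY := Suc n), m)"
  shows "wp M mult_loop Q (R, m)"
  unfolding mult_loop_def
proof (rule wp_while[where I = "\<lambda>i R' m'. R' = R(rQ := i * R rP, rY := i) \<and> m' = m" and N = "Suc n"], goal_cases)
  case (3 i R' m')
  with assms show ?case by (auto simp: aval_rd fun_eq_iff)
qed (use assms M in \<open>auto simp: aval_rd fun_upd_idem\<close>)

lemma wp_weights_loop: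
  assumes "R rN = n" "R rL = weights" "R rP = 1" "R rX = 0"
    and Q: "\<And>R' m'. (\<And>r. r < 20 \<Longrightarrow> R' r = R r) \<Longrightarrow> R' rP = Suc n ^ (n + 2) \<Longrightarrow>
       (\<And>a. m' a = (if weights \<le> a \<and> a < weights + (n + 2) then Suc n ^ (a - weights) else m a)) \<Longrightarrow> Q (R', m')"
  shows "wp M weights_loop Q (R, m)"
  unfolding weights_loop_def
proof (rule wp_while[where N = "n + 2" and I = "\<lambda>x R' m'. (\<forall>r<20. R' r = R r) \<and> R' rP = Suc n ^ x \<and> R' rX = x \<and>
       (\<forall>a. m' a = (if weights \<le> a \<and> a < weights + x then Suc n ^ (a - weights) else m a))"], goal_cases)
  case (3 x R' m')
  have "R' rN = n" "R' rL = weights" using 3 assms by auto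
  with 3 show ?case by (auto simp: aval_rd intro!: wp_mult_loop)
qed (use assms M in \<open>auto simp: aval_rd\<close>)

lemma wp_threshold_loop:
  assumes "R rN = n" "R rK = k" "R rX = 0" "Q (R(rT := R rT + min k n * R rTop, rX := min k n), m)"
  shows "wp M threshold_loop Q (R, m)"
  unfolding threshold_loop_def
proof (rule wp_while[where I = "\<lambda>i R' m'. R' = R(rT := R rT + i * R rTop, rX := i) \<and> m' = m" and N = "min k n"], goal_cases)
  case (3 i R' m')
  with assms show ?case by (auto simp: aval_rd fun_eq_iff)
qed (use assms M in \<open>auto simp: aval_rd fun_upd_idem\<close>)

lemma wp_read_prog:
  assumes "\<And>R. R rN = n \<Longrightarrow> R rK = k \<Longrightarrow> R rE = base \<Longrightarrow> R rL = weights \<Longrightarrow> R rP = 1 \<Longrightarrow>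
     R 0 = 0 \<Longrightarrow> R rX = 0 \<Longrightarrow> Q (R, m0)"
  shows "wp M read_prog Q (\<lambda>_. 0, m0)"
  unfolding read_prog_def
  by (simp add: aval_rd rd_def m0_simps) (rule assms; simp add: base weights)

lemma wp_layout_prog:
  assumes "R rN = n" "R rL = weights" "R rZ = Z"
    and "Q (R(rBd := bs 2, rVis := bs 3, rPar := bs 4, rChi := bs 5, rSiz := bs 6, rCur := bs 7, rX := 0, rS := 0), m)"
  shows "wp M layout_prog Q (R, m)"
proof -
  have "Suc (Suc (weights + n + Z + Z)) = bs 2" unfolding bs_def by (simp add: B)
  moreover have "bs 2 + Z = bs 3" "bs 3 + Z = bs 4" "bs 4 + Z = bs 5" "bs 5 + Z = bs 6" "bs 6 + Z = bs 7"
    by simp_all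
  ultimately show ?thesis unfolding layout_prog_def using assms by (simp add: aval_rd del: bs_Suc)
qed

lemma wp_init_prog:
  assumes Q: "\<And>R m. env R \<Longrightarrow> low m \<Longrightarrow> blk m = (\<lambda>_ _. 0) \<Longrightarrow> R 0 = 0 \<Longrightarrow> R rX = 0 \<Longrightarrow> R rS = 0 \<Longrightarrow> Q (R, m)"
  shows "wp M init_prog Q (initial_state (tp_encode (n, es, k, ss)))"
proof -
  have init: "initial_state (tp_encode (n, es, k, ss)) = ((\<lambda>_. 0), m0)"
    by (simp add: m0_def initial_state_def)
  show ?thesis unfolding init_prog_def init wp.simps(4)
  proof (rule wp_read_prog, rule wp_weights_loop, goal_cases)
    case (5 R R' m')
    have R': "R' rN = n" "R' rK = k" "R' rE = base" "R' rL = weights" "R' 0 = 0" using 5 by auto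
    have m': "m' a = (if weights \<le> a \<and> a < weights + (n + 2) then Suc n ^ (a - weights) else m0 a)" for a
      by (rule 5)
    have "low m'" unfolding low_def m' by auto
    moreover have "blk m' = (\<lambda>_ _. 0)"
    proof (intro ext)
      fix t i
      have "weights + (n + 2) \<le> bs t + i" unfolding bs_def by (simp add: B)
      then show "blk m' t i = 0" unfolding blk_def m' using m0_simps(7)[of "bs t + i"] by simp
    qed
    moreover have "m' (weights + Suc n) = Suc n ^ Suc n" unfolding m' by simp
    moreover have "R' rP = Z" unfolding Z by (rule 5)
    ultimately show ?case using R'
      apply (simp add: aval_rd rd_def del: power_Suc power.simps)
      apply (rule wp_threshold_loop)
         apply (simp_all del: power_Suc power.simps)
      apply (rule wp_layout_prog)
         apply (simp_all del: power_Suc power.simps)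
      apply (rule Q)
           apply (simp_all add: env_def del: power_Suc power.simps)
      done
  qed auto
qed

end

lemma count_list_drop: "i < length xs \<Longrightarrow> count_list (drop i xs) x = (if xs ! i = x then 1 else 0) + count_list (drop (Suc i) xs) x"
  by (simp add: Cons_nth_drop_Suc[symmetric] del: drop_Suc)

context tp_run
begin

lemma envD:
  assumes "env R"
  shows "R 2 = n" "R 3 = k" "R 4 = base" "R 5 = weights" "R 6 = Z" "R 7 = Suc n ^ Suc n"
    "R 8 = (2 + min k n) * Suc n ^ Suc n" "R 9 = bs 2" "R 10 = bs 3" "R 11 = bs 4" "R 12 = bs 5"
    "R 13 = bs 6" "R 14 = bs 7"
  using assms by (simp_all add: env_def)

section \<open>Reading the group sizes\<close>

definition boundary_fun :: "nat \<Rightarrow> nat \<Rightarrow> nat" where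
  "boundary_fun i j = (if j \<le> n \<and> (\<exists>i'<i. j = sum_list (take i' ss)) then 1 else 0)"

definition boundary_inv :: "nat \<Rightarrow> (nat \<Rightarrow> nat) \<Rightarrow> (nat \<Rightarrow> nat) \<Rightarrow> bool" where
  "boundary_inv i R m \<longleftrightarrow> i \<le> length ss \<and> env R \<and> low m \<and> R 0 = 0 \<and> R rX = i \<and>
     R rS = sum_list (take i ss) \<and> blk m = (\<lambda>_ _. 0)(2 := boundary_fun i)"

lemma boundary_cond_iff:
  assumes "boundary_inv i R m"
  shows "bval boundary_cond (R, m) \<longleftrightarrow> i < length ss \<and> sum_list (take i ss) \<le> n"
proof -
  have "env R" "low m" "R rX = i" "R rS = sum_list (take i ss)" using assms by (auto simp: boundary_inv_def)
  moreover from this have "rd m 2 = length ss" by (simp add: rd_input weights base m0_simps)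
  ultimately show ?thesis
    by (auto simp: boundary_cond_def aval_rd envD)
qed

lemma wp_boundary_body:
  assumes inv: "boundary_inv i R m" and i: "i < length ss" "sum_list (take i ss) \<le> n"
  shows "wp M' boundary_body (\<lambda>(R, m). boundary_inv (Suc i) R m) (R, m)"
proof -
  have env: "env R" "low m" "R 0 = 0" "R rX = i" "R rS = sum_list (take i ss)"
      and b: "blk m = (\<lambda>_ _. 0)(2 := boundary_fun i)"
    using inv by (auto simp: boundary_inv_def)
  have ssi: "rd m' (base + i) = ss ! i" if "low m'" for m'
    using that i by (simp add: rd_input weights m0_simps)
  have bf: "(boundary_fun i)(sum_list (take i ss) := Suc 0) = boundary_fun (Suc i)"
    using i by (auto simp: boundary_fun_def fun_eq_iff less_Suc_eq)
  show ?thesis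
    using env i by (simp add: boundary_body_def aval_rd envD boundary_inv_def ssi b bf sum_list_take_Suc del: take_Suc_conv_app_nth)
qed

text \<open>The iterations are not bounded by \<open>M\<close>, so the time is counted by a
  potential. Every iteration either consumes a group size 0 or raises the sum, and the loop ends
  when the sum exceeds \<open>n\<close>; the additional 1 pays for the last test.
  \<open>cost 0\<close> suffices for the body, which contains no loop.\<close>

lemma boundary_loop:
  assumes "boundary_inv i R m"
  shows "\<exists>t R' m' j. exec (While boundary_cond boundary_body) (R, m) t (R', m') \<and> boundary_inv j R' m' \<and>
    \<not> (j < length ss \<and> sum_list (take j ss) \<le> n) \<and>
    t \<le> (btime boundary_cond + 1 + cost 0 boundary_body) * (count_list (drop i ss) 0 + (Suc n - sum_list (take i ss)) + 1)"
  using assms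
proof (induction "length ss - i" arbitrary: i R m)
  case less: 0
  then have "\<not> bval boundary_cond (R, m)" using boundary_cond_iff[of i R m] by simp
  from exec.WhileF[OF this] less show ?case
    by (intro exI[of _ "btime boundary_cond + 1"] exI[of _ R] exI[of _ m] exI[of _ i]) auto
next
  case (Suc d)
  let ?K = "btime boundary_cond + 1 + cost 0 boundary_body"
  show ?case
  proof (cases "i < length ss \<and> sum_list (take i ss) \<le> n")
    case False
    then have "\<not> bval boundary_cond (R, m)" using Suc.prems boundary_cond_iff[of i R m] by simp
    from exec.WhileF[OF this] Suc.prems False show ?thesis
      by (intro exI[of _ "btime boundary_cond + 1"] exI[of _ R] exI[of _ m] exI[of _ i]) auto
  next
    case True
    have b: "bval boundary_cond (R, m)" using True boundary_cond_iff[OF Suc.prems] by simp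
    from wp_imp_runs[OF wp_boundary_body[OF Suc.prems, of 0]] True obtain t R1 m1 where
      1: "exec boundary_body (R, m) t (R1, m1)" "t \<le> cost 0 boundary_body" "boundary_inv (Suc i) R1 m1"
      by (auto simp: runs_def)
    have d: "d = length ss - Suc i" using Suc.hyps(2) by linarith
    from Suc.hyps(1)[OF d 1(3)] obtain t' R2 m2 j where
      2: "exec (While boundary_cond boundary_body) (R1, m1) t' (R2, m2)" "boundary_inv j R2 m2"
         "\<not> (j < length ss \<and> sum_list (take j ss) \<le> n)"
         "t' \<le> ?K * (count_list (drop (Suc i) ss) 0 + (Suc n - sum_list (take (Suc i) ss)) + 1)" by blast
    \<comment> \<open>One iteration lowers the potential by at least 1, whichever kind of group size
      it reads.\<close>
    have "Suc (count_list (drop (Suc i) ss) 0 + (Suc n - sum_list (take (Suc i) ss)) + 1)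
        \<le> count_list (drop i ss) 0 + (Suc n - sum_list (take i ss)) + 1"
      using True sum_list_take_Suc[of i ss] count_list_drop[of i ss 0]
      by (cases "ss ! i = 0") (simp_all only: if_True if_False simp_thms, arith+)
    then have "?K * Suc (count_list (drop (Suc i) ss) 0 + (Suc n - sum_list (take (Suc i) ss)) + 1)
        \<le> ?K * (count_list (drop i ss) 0 + (Suc n - sum_list (take i ss)) + 1)" by (rule mult_le_mono2)
    then have "btime boundary_cond + 1 + t + t'
        \<le> ?K * (count_list (drop i ss) 0 + (Suc n - sum_list (take i ss)) + 1)"
      using 1(2) 2(4) by (simp only: mult_Suc_right)
    with exec.WhileT[OF b 1(1) 2(1)] 2(2,3) show ?thesis by blast
  qed
qed

section \<open>Building the growth sequence\<close>

definition visited :: "nat set \<Rightarrow> nat \<Rightarrow> nat" where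
  "visited V v = (if v \<in> V then 1 else 0)"

definition grow_inv :: "(nat \<times> nat) list \<Rightarrow> (nat \<Rightarrow> nat \<Rightarrow> nat) \<Rightarrow> (nat \<Rightarrow> nat) \<Rightarrow> (nat \<Rightarrow> nat) \<Rightarrow> bool" where
  "grow_inv gs G R m \<longleftrightarrow> env R \<and> low m \<and> R 0 = 0 \<and> growth gs \<and> edges_of gs \<subseteq> edges_of es \<and> R rI = length gs \<and>
     (\<forall>t. t \<noteq> 3 \<longrightarrow> t \<noteq> 4 \<longrightarrow> t \<noteq> 5 \<longrightarrow> blk m t = G t) \<and>
     blk m 3 = visited (verts gs) \<and> (\<forall>i<length gs. blk m 4 i = fst (gs ! i) \<and> blk m 5 i = snd (gs ! i))"

lemma tree': "is_tree {..<n} (edges_of es)"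
  using tree by (simp add: represents_tree_def)

lemma growth_verts_less: "growth gs \<Longrightarrow> edges_of gs \<subseteq> edges_of es \<Longrightarrow> verts gs \<subseteq> {..<n}"
  using growth_verts_subset[of gs "{..<n}" "edges_of es"] tree' n_pos by (simp add: is_tree_def)

lemma growth_length_less: "growth gs \<Longrightarrow> edges_of gs \<subseteq> edges_of es \<Longrightarrow> length gs < n"
  using growth_verts_less[of gs] growth_card_verts[of gs] card_mono[of "{..<n}" "verts gs"] by auto

lemma edge_less_n: "{u, v} \<in> edges_of es \<Longrightarrow> u < n \<and> v < n"
  using simple_graph_edgeD[of "{..<n}" "edges_of es" u v] tree' by (auto simp: is_tree_def)

lemma wp_grow_step:
  assumes inv: "grow_inv gs G R m" and e: "{R u, R v} \<in> edges_of es" and uv: "20 \<le> u" "20 \<le> v" "u \<noteq> rI" "v \<noteq> rI"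
    and Q: "\<And>hs R' m'. grow_inv (gs @ hs) G R' m' \<Longrightarrow> (\<And>r. r \<noteq> rI \<Longrightarrow> R' r = R r) \<Longrightarrow>
      (R u \<in> verts gs \<and> R v \<notin> verts gs \<Longrightarrow> hs \<noteq> []) \<Longrightarrow> Q (R', m')"
  shows "wp M (grow_step u v) Q (R, m)"
proof -
  have g: "env R" "low m" "R 0 = 0" "growth gs" "edges_of gs \<subseteq> edges_of es" "R rI = length gs"
     "\<And>t. t \<noteq> 3 \<Longrightarrow> t \<noteq> 4 \<Longrightarrow> t \<noteq> 5 \<Longrightarrow> blk m t = G t"
     "blk m 3 = visited (verts gs)" "\<And>i. i < length gs \<Longrightarrow> blk m 4 i = fst (gs ! i) \<and> blk m 5 i = snd (gs ! i)"
    using inv by (auto simp: grow_inv_def)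
  have lt: "R u \<le> n" "R v \<le> n" "length gs \<le> n" using edge_less_n[OF e] growth_length_less[OF g(4,5)] by auto
  show ?thesis
  proof (cases "R u \<in> verts gs \<and> R v \<notin> verts gs")
    case False
    then have "wp M (grow_step u v) Q (R, m) = Q (R, m)"
      using g lt by (auto simp: grow_step_def aval_rd envD visited_def)
    with Q[of "[]" R m] inv False show ?thesis by auto
  next
    case True
    let ?R = "R(rI := Suc (length gs))"
    let ?m = "m(bs 4 + length gs := R u, bs 5 + length gs := R v, bs 3 + R v := 1)"
    have w: "wp M (grow_step u v) Q (R, m) = Q (?R, ?m)"
      using True g lt uv by (simp add: grow_step_def aval_rd envD visited_def)
    have "growth (gs @ [(R u, R v)])" using g True by (intro growth.snoc) auto
    moreover have "edges_of (gs @ [(R u, R v)]) \<subseteq> edges_of es" using g e by (simp add: edges_of_snoc)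
    ultimately have "grow_inv (gs @ [(R u, R v)]) G ?R ?m"
      unfolding grow_inv_def using g lt
      by (auto simp: verts_snoc visited_def fun_eq_iff nth_append less_Suc_eq)
    with Q[of "[(R u, R v)]" ?R ?m] show ?thesis unfolding w by simp
  qed
qed

lemma grow_inv_upd [simp]: "20 \<le> r \<Longrightarrow> r \<noteq> rI \<Longrightarrow> grow_inv gs G (R(r := x)) m = grow_inv gs G R m"
  by (simp add: grow_inv_def)

lemma edges_of_nth: "j < length es \<Longrightarrow> {fst (es ! j), snd (es ! j)} \<in> edges_of es"
  by (auto simp: edges_of_def image_iff case_prod_beta intro!: bexI[of _ "es ! j"])

text \<open>If a pass adds nothing, no edge leaves the visited set. For an incomplete sequence this
  contradicts \<open>tree_growth_extend\<close>, so such a pass always makes progress.\<close>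

lemma wp_scan_loop:
  assumes inv: "grow_inv gs G R m" "R rY = 0" "R rA = 3"
    and Q: "\<And>hs R' m'. grow_inv (gs @ hs) G R' m' \<Longrightarrow> R' rX = R rX \<Longrightarrow>
      (hs = [] \<Longrightarrow> \<forall>j<n - 1. fst (es ! j) \<in> verts gs \<longleftrightarrow> snd (es ! j) \<in> verts gs) \<Longrightarrow> Q (R', m')"
  shows "wp M scan_loop Q (R, m)"
proof -
  let ?I = "\<lambda>j R' m'. \<exists>hs. grow_inv (gs @ hs) G R' m' \<and> R' rY = j \<and> R' rA = 3 + 2 * j \<and> R' rX = R rX \<and>
     (hs = [] \<longrightarrow> (\<forall>j'<j. fst (es ! j') \<in> verts gs \<longleftrightarrow> snd (es ! j') \<in> verts gs))"
  show ?thesis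
    unfolding scan_loop_def
  proof (rule wp_while[where I = ?I and N = "n - 1"])
    show "?I 0 R m" using inv by (intro exI[of _ "[]"]) simp
    show "n - 1 \<le> M" using M by simp
  next
    fix j R1 m1 assume j: "j < n - 1" and "?I j R1 m1"
    then obtain hs where I: "grow_inv (gs @ hs) G R1 m1" "R1 rY = j" "R1 rA = 3 + 2 * j" "R1 rX = R rX"
       "hs = [] \<Longrightarrow> \<forall>j'<j. fst (es ! j') \<in> verts gs \<longleftrightarrow> snd (es ! j') \<in> verts gs" by blast
    have env: "env R1" "low m1" using I by (auto simp: grow_inv_def)
    let ?u = "fst (es ! j)" and ?v = "snd (es ! j)"
    have e: "{?u, ?v} \<in> edges_of es" using j by (intro edges_of_nth) (simp add: length_es)
    have lt: "3 + 2 * j < weights" "Suc (3 + 2 * j) < weights" using j by (simp_all add: weights base)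
    have rd: "rd m1 (R1 rA) = ?u" "rd m1 (Suc (R1 rA)) = ?v"
      unfolding I(3) by (rule trans[OF rd_input[OF env(2) lt(1)] m0_simps(4)[OF j]],
        rule trans[OF rd_input[OF env(2) lt(2)] m0_simps(5)[OF j]])
    have cond: "bval (Less (Reg rY \<oplus> Num 1) (Reg rN)) (R1, m1)"
      using j I(2) env by (auto simp: envD)
    let ?R1 = "R1(rU := ?u, rV := ?v)"
    have "wp M (grow_step rU rV ;; grow_step rV rU ;; rA ::= Reg rA \<oplus> Num 2 ;; rY ::= Reg rY \<oplus> Num 1)
       (\<lambda>(R, m). ?I (Suc j) R m) (?R1, m1)"
      unfolding wp.simps(4)
    proof (rule wp_grow_step[where gs = "gs @ hs" and G = G], goal_cases)
      case 1 show ?case using I(1) by simp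
      case 2 show ?case using e by simp
      case (7 hs1 R2 m2)
      show ?case
      proof (rule wp_grow_step[OF 7(1)], goal_cases)
        case 1 show ?case using e 7(2)[of rU] 7(2)[of rV] by (simp add: insert_commute)
      next
        case (6 hs2 R3 m3)
        have r: "R3 rA = 3 + 2 * j" "R3 rY = j" "R3 rX = R rX" "R2 rU = ?u" "R2 rV = ?v"
          using 6(2) 7(2) I by simp_all
        have "\<forall>j'<Suc j. fst (es ! j') \<in> verts gs \<longleftrightarrow> snd (es ! j') \<in> verts gs" if "hs @ hs1 @ hs2 = []"
          using that I(5) 7(3) 6(3) r by (auto simp: less_Suc_eq)
        then show ?case using 6(1) r by (simp add: aval_rd, intro exI[of _ "hs @ hs1 @ hs2"], simp)
      qed simp_all
    qed simp_all
    with cond rd show "bval (Less (Reg rY \<oplus> Num 1) (Reg rN)) (R1, m1) \<and> wp M (rU ::= Mem (Reg rA) ;;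
      rV ::= Mem (Reg rA \<oplus> Num 1) ;; grow_step rU rV ;; grow_step rV rU ;;
      rA ::= Reg rA \<oplus> Num 2 ;; rY ::= Reg rY \<oplus> Num 1) (\<lambda>(R, m). ?I (Suc j) R m) (R1, m1)"
      by (simp add: aval_rd)
  next
    fix R1 m1 assume "?I (n - 1) R1 m1"
    then show "\<not> bval (Less (Reg rY \<oplus> Num 1) (Reg rN)) (R1, m1)" "Q (R1, m1)"
      using n_pos Q by (auto simp: grow_inv_def envD)
  qed
qed

lemma wp_grow_loop:
  assumes inv: "grow_inv [] G R m" "R rX = 0"
    and Q: "\<And>gs R' m'. grow_inv gs G R' m' \<Longrightarrow> length gs = n - 1 \<Longrightarrow> Q (R', m')"
  shows "wp M grow_loop Q (R, m)"
proof -
  let ?I = "\<lambda>x R' m'. \<exists>gs. grow_inv gs G R' m' \<and> R' rX = x \<and> min x (n - 1) \<le> length gs"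
  show ?thesis
    unfolding grow_loop_def
  proof (rule wp_while[where I = ?I and N = n])
    show "?I 0 R m" using inv by (intro exI[of _ "[]"]) simp
    show "n \<le> M" using M by simp
  next
    fix x R1 m1 assume x: "x < n" and "?I x R1 m1"
    then obtain gs where I: "grow_inv gs G R1 m1" "R1 rX = x" "min x (n - 1) \<le> length gs" by blast
    have env: "env R1" "growth gs" "edges_of gs \<subseteq> edges_of es" using I by (auto simp: grow_inv_def)
    have "wp M scan_loop (wp M (rX ::= Reg rX \<oplus> Num 1) (\<lambda>(R, m). ?I (Suc x) R m)) (R1(rY := 0, rA := 3), m1)"
    proof (rule wp_scan_loop[where gs = gs and G = G], goal_cases)
      case 1 show ?case using I(1) by simp
    next
      case (4 hs R2 m2)
      have "min (Suc x) (n - 1) \<le> length (gs @ hs)"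
      proof (cases "hs = []")
        case False
        then have "1 \<le> length hs" by (simp add: Suc_le_eq)
        with I(3) show ?thesis by simp
      next
        case True
        have "\<not> length gs < n - 1"
        proof
          assume "length gs < n - 1"
          from tree_growth_extend[OF tree' env(2,3) this] obtain p c where
            pc: "{p, c} \<in> edges_of es" "p \<in> verts gs" "c \<notin> verts gs" by blast
          then obtain j where j: "j < length es" "{p, c} = {fst (es ! j), snd (es ! j)}"
            by (auto simp: edges_of_def in_set_conv_nth case_prod_beta)
          have "fst (es ! j) \<in> verts gs \<longleftrightarrow> snd (es ! j) \<in> verts gs" using 4(3)[OF True] j by (simp add: length_es)
          with pc j(2) show False by (auto simp: doubleton_eq_iff)
        qed
        then show ?thesis using True by simp
      qed
      with 4 I show ?case by (auto simp: aval_rd intro!: exI[of _ "gs @ hs"])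
    qed simp_all
    then show "bval (Less (Reg rX) (Reg rN)) (R1, m1) \<and> wp M (rY ::= Num 0 ;; rA ::= Num 3 ;; scan_loop ;; rX ::= Reg rX \<oplus> Num 1)
       (\<lambda>(R, m). ?I (Suc x) R m) (R1, m1)"
      using x I env by (simp add: aval_rd envD)
  next
    fix R1 m1 assume "?I n R1 m1"
    then obtain gs where I: "grow_inv gs G R1 m1" "R1 rX = n" "n - 1 \<le> length gs" by auto
    then have "length gs = n - 1" using growth_length_less[of gs] by (auto simp: grow_inv_def)
    with I Q show "\<not> bval (Less (Reg rX) (Reg rN)) (R1, m1)" "Q (R1, m1)"
      by (auto simp: grow_inv_def envD)
  qed
qed

lemma wp_singletons_loop:
  assumes inv: "env R" "low m" "R rX = 0" "R rF = bs 8" "\<And>t. 8 \<le> t \<Longrightarrow> blk m t = (\<lambda>_. 0)"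
    and Q: "\<And>R' m'. (\<And>r. r \<noteq> rX \<Longrightarrow> r \<noteq> rF \<Longrightarrow> R' r = R r) \<Longrightarrow> R' rF = bs (8 + n) \<Longrightarrow> low m' \<Longrightarrow>
       (\<And>t. t < 7 \<Longrightarrow> blk m' t = blk m t) \<Longrightarrow> (\<And>v. v < n \<Longrightarrow> blk m' 7 v = bs (8 + v)) \<Longrightarrow>
       (\<And>v. v < n \<Longrightarrow> table (blk m' (8 + v)) {1}) \<Longrightarrow> (\<And>t. 8 + n \<le> t \<Longrightarrow> blk m' t = (\<lambda>_. 0)) \<Longrightarrow> Q (R', m')"
  shows "wp M singletons_loop Q (R, m)"
  unfolding singletons_loop_def
proof (rule wp_while[where N = n and I = "\<lambda>x R' m'. (\<forall>r. r \<noteq> rX \<longrightarrow> r \<noteq> rF \<longrightarrow> R' r = R r) \<and> R' rX = x \<and>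
    R' rF = bs (8 + x) \<and> low m' \<and> (\<forall>t<7. blk m' t = blk m t) \<and> (\<forall>v<x. blk m' 7 v = bs (8 + v)) \<and>
    (\<forall>v<x. table (blk m' (8 + v)) {1}) \<and> (\<forall>t\<ge>8 + x. blk m' t = (\<lambda>_. 0))"], goal_cases)
  case (3 x R' m')
  then have "R' 2 = n" "R' 14 = bs 7" "R' 6 = Z" using inv(1) by (auto simp: envD)
  moreover have "(\<lambda>_. 0)(0 := Suc 0, Suc 0 := Suc 0) = (\<lambda>_. 0 :: nat)(Suc 0 := Suc 0, 0 := Suc 0)"
    by (simp add: fun_upd_twist)
  ultimately show ?case using 3 table_singleton
    by (auto simp: aval_rd less_Suc_eq)
next
  case (5 R' m')
  then show ?case by (intro Q) auto
qed (use inv M in \<open>auto simp: aval_rd envD\<close>)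

section \<open>Merging the tables of codes\<close>

abbreviation "W \<equiv> Suc n"

definition valid_code :: "nat \<Rightarrow> bool" where
  "valid_code c \<longleftrightarrow> (\<exists>a \<mu>. c = a + code (wt n) \<mu> \<and> 0 < a \<and> 0 \<notin># \<mu> \<and> a + sum_mset \<mu> \<le> n)"

lemma valid_codeD:
  assumes "valid_code c" shows "0 < c" "c < Z" "c mod W \<le> n"
proof -
  from assms obtain a \<mu> where c: "c = a + code (wt n) \<mu>" "0 < a" "0 \<notin># \<mu>" "a + sum_mset \<mu> \<le> n"
    by (auto simp: valid_code_def)
  then show "0 < c" "c < Z" "c mod W \<le> n"
    using state_code_less[of \<mu> n a] state_code_mod[of \<mu> a n] by (auto simp: Z simp del: mod_Suc power_Suc)
qed

definition codes :: "(nat \<times> nat) list \<Rightarrow> nat \<Rightarrow> nat set" where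
  "codes hs v = (\<lambda>(a, r). a + r) ` dp (wt n) hs (\<lambda>_. {(1, 0)}) v"

text \<open>\<open>y\<close> is the code of the child and \<open>y mod W\<close> its open size;
  subtracting the size and adding its weight turns the open component into a cut-off one.\<close>

definition code_pair :: "nat \<Rightarrow> nat \<Rightarrow> nat set" where
  "code_pair y x = {y + x, y + x - y mod W + (W ^ (y mod W) + W ^ W)}"

lemma dp_valid:
  assumes "growth (gs @ hs)" "length (gs @ hs) = n - 1" "(a, r) \<in> dp (wt n) hs (\<lambda>_. {(1, 0)}) v"
  shows "\<exists>\<mu>. r = code (wt n) \<mu> \<and> 0 < a \<and> 0 \<notin># \<mu> \<and> a + sum_mset \<mu> \<le> n" "(a + r) mod W = a"
proof -
  from dp_states[OF assms(1), of "wt n"] obtain s where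
    "dp (wt n) hs (\<lambda>_. {(1, 0)}) v \<subseteq> states (wt n) s" "s \<le> Suc (length (gs @ hs))" by blast
  with assms n_pos show *: "\<exists>\<mu>. r = code (wt n) \<mu> \<and> 0 < a \<and> 0 \<notin># \<mu> \<and> a + sum_mset \<mu> \<le> n"
    by (fastforce simp: states_def)
  then show "(a + r) mod W = a" using state_code_mod[of _ a n] by auto
qed

lemma codes_valid:
  assumes "growth (gs @ hs)" "length (gs @ hs) = n - 1" "c \<in> codes hs v"
  shows "valid_code c"
  using assms dp_valid(1)[OF assms(1,2)] unfolding codes_def valid_code_def by fastforce

lemma card_codes:
  assumes "growth (gs @ hs)" "length (gs @ hs) = n - 1"
  shows "card (codes hs v) \<le> M"
proof -
  from dp_states[OF assms(1), of "wt n"] obtain s where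
    s: "dp (wt n) hs (\<lambda>_. {(1, 0)}) v \<subseteq> states (wt n) s" "s \<le> Suc (length (gs @ hs))" by blast
  then have "s \<le> n" using assms(2) n_pos by simp
  note st = card_state_codes[OF this n_pos, of "wt n"]
  have "card (codes hs v) \<le> card ((\<lambda>(a, r). a + r) ` states (wt n) s)"
    unfolding codes_def using s(1) st(1) by (intro card_mono image_mono)
  also have "\<dots> \<le> M" using st(2) M(2) by linarith
  finally show ?thesis .
qed

lemma codes_Cons:
  assumes "growth (gs @ (p, c) # hs)" "length (gs @ (p, c) # hs) = n - 1"
  shows "codes ((p, c) # hs) v = (if v = p then \<Union>y\<in>codes hs c. \<Union>x\<in>codes hs p. code_pair y x else codes hs v)"
proof (cases "v = p")
  case True
  have g: "growth ((gs @ [(p, c)]) @ hs)" "length ((gs @ [(p, c)]) @ hs) = n - 1" using assms by simp_all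
  let ?T = "dp (wt n) hs (\<lambda>_. {(1, 0)})"
  have pair: "code_pair (b + s) (a + r) = (\<lambda>(a, r). a + r) ` {(a + b, r + s), (a, r + s + wt n b)}"
    if "(b, s) \<in> ?T c" for a b r s
    using dp_valid(2)[OF g that] by (auto simp: code_pair_def wt_def simp del: mod_Suc power_Suc)
  have "codes ((p, c) # hs) p = (\<lambda>(a, r). a + r) ` merge (wt n) (?T p) (?T c)"
    by (simp add: codes_def dp_Cons)
  also have "\<dots> = (\<Union>(a, r)\<in>?T p. \<Union>(b, s)\<in>?T c. (\<lambda>(a, r). a + r) ` {(a + b, r + s), (a, r + s + wt n b)})"
    by (simp add: merge_def image_UN case_prod_beta)
  also have "\<dots> = (\<Union>(a, r)\<in>?T p. \<Union>(b, s)\<in>?T c. code_pair (b + s) (a + r))"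
    using pair by (intro SUP_cong refl) (auto split: prod.splits)
  also have "\<dots> = (\<Union>y\<in>codes hs c. \<Union>x\<in>codes hs p. code_pair y x)"
    unfolding codes_def by (auto simp: case_prod_beta)
  finally show ?thesis using True by simp
qed (simp add: codes_def dp_Cons)

lemma codes_Nil: "codes [] v = {1}"
  by (simp add: codes_def)

text \<open>Block \<open>f\<close> is under construction and has content \<open>S\<close>.
  \<open>G\<close> is a snapshot of finished blocks, among them block \<open>\<tau> v\<close> with
  the current codes \<open>X v\<close> of the vertex \<open>v\<close>. Everything above
  \<open>f\<close> is still zero and available for new tables.\<close>

definition merge_inv :: "(nat \<Rightarrow> nat set) \<Rightarrow> (nat \<Rightarrow> nat) \<Rightarrow> (nat \<Rightarrow> nat \<Rightarrow> nat) \<Rightarrow> nat \<Rightarrow> nat \<Rightarrow> nat set \<Rightarrow>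
     (nat \<Rightarrow> nat) \<Rightarrow> (nat \<Rightarrow> nat) \<Rightarrow> bool" where
  "merge_inv X \<tau> G i f S R m \<longleftrightarrow> env R \<and> low m \<and> R 0 = 0 \<and> R rI = i \<and> R rF = bs f \<and> 8 \<le> f \<and>
     (\<forall>t<6. blk m t = G t) \<and>
     (\<forall>v<n. blk m 7 v = bs (\<tau> v) \<and> 8 \<le> \<tau> v \<and> \<tau> v < f \<and> blk m (\<tau> v) = G (\<tau> v) \<and> table (G (\<tau> v)) (X v) \<and>
        (\<forall>c\<in>X v. blk m 6 c = c mod W)) \<and>
     table (blk m f) S \<and> (\<forall>c\<in>S. blk m 6 c = c mod W) \<and> (\<forall>t>f. blk m t = (\<lambda>_. 0))"

lemma merge_inv_upd [simp]:
  "20 < r \<Longrightarrow> r \<noteq> rI \<Longrightarrow> merge_inv X \<tau> G i f S (R(r := x)) m = merge_inv X \<tau> G i f S R m"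
  by (simp add: merge_inv_def)

text \<open>A single size map serves all tables, because the open size is digit 0 of the code and
  does not depend on the vertex.\<close>

lemma merge_inv_insert:
  assumes inv: "merge_inv X \<tau> G i f S R m" and c: "0 < c" "c < Z" "a = c mod W"
  shows "merge_inv X \<tau> G i f (insert c S) R ((insert_mem m (bs f) c)(bs 6 + c := a))"
proof -
  have f: "8 \<le> f" using inv by (simp add: merge_inv_def)
  have t: "table (insert_fun (blk m f) c) (insert c S)"
    using inv c by (intro table_insert) (auto simp: merge_inv_def)
  show ?thesis
    using inv c f t unfolding merge_inv_def by (auto simp del: mod_Suc)
qed

lemma wp_merge_body:
  assumes inv: "merge_inv X \<tau> G i f S R m" and vw: "v < n" "w < n" and y: "y \<in> X v" and x: "x \<in> X w"
    and R: "R rC = y" "R rD = x" and valid: "valid_code y" "valid_code x"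
    and pair: "\<And>c. c \<in> code_pair y x \<Longrightarrow> 0 < c \<and> c < Z"
    and mods: "(y + x) mod W = y mod W + x mod W" "(y + x - y mod W + (W ^ (y mod W) + W ^ W)) mod W = x mod W"
    and Q: "\<And>R' m'. merge_inv X \<tau> G i f (S \<union> code_pair y x) R' m' \<Longrightarrow> (\<And>r. r \<noteq> rX \<Longrightarrow> R' r = R r) \<Longrightarrow> Q (R', m')"
  shows "wp M merge_body Q (R, m)"
proof -
  let ?c = "y + x" and ?d = "y + x - y mod W + (W ^ (y mod W) + W ^ W)"
  let ?m1 = "(insert_mem m (bs f) ?c)(bs 6 + ?c := y mod W + x mod W)"
  let ?m2 = "(insert_mem ?m1 (bs f) ?d)(bs 6 + ?d := x mod W)"
  have env: "env R" "low m" "R rF = bs f" using inv by (auto simp: merge_inv_def)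
  have c: "0 < ?c" "?c < Z" and d: "0 < ?d" "?d < Z"
    using pair[of ?c] pair[of ?d] by (auto simp: code_pair_def)
  have inv1: "merge_inv X \<tau> G i f (insert ?c S) R ?m1"
    using merge_inv_insert[OF inv c mods(1)[symmetric]] .
  have inv2: "merge_inv X \<tau> G i f (insert ?d (insert ?c S)) R ?m2"
    using merge_inv_insert[OF inv1 d mods(2)[symmetric]] .
  have r0: "rd m (bs 6 + y) = y mod W" "rd m (bs 6 + x) = x mod W"
    using inv vw x y valid_codeD(2)[OF valid(1)] valid_codeD(2)[OF valid(2)] by (auto simp: merge_inv_def simp del: mod_Suc)
  have r1: "rd ?m1 (bs 6 + y) = y mod W"
    using inv1 vw y valid_codeD(2)[OF valid(1)] by (auto simp: merge_inv_def simp del: mod_Suc blk_upd)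
  have "blk (insert_mem ?m1 (bs f) ?d) 6 = blk ?m1 6"
    using inv d(2) by (simp add: merge_inv_def del: blk_upd mod_Suc power_Suc)
  then have r2: "rd (insert_mem ?m1 (bs f) ?d) (bs 6 + x) = x mod W"
    using inv1 vw x valid_codeD(2)[OF valid(2)] by (simp add: merge_inv_def del: mod_Suc blk_upd blk_insert power_Suc)
  have "blk (insert_mem m (bs f) ?c) 6 = blk m 6"
    using inv c(2) by (simp add: merge_inv_def)
  then have r3: "rd (insert_mem m (bs f) ?c) (bs 6 + y) = y mod W" "rd (insert_mem m (bs f) ?c) (bs 6 + x) = x mod W"
    using inv vw x y valid_codeD(2)[OF valid(1)] valid_codeD(2)[OF valid(2)]
    by (simp_all add: merge_inv_def del: mod_Suc blk_insert)
  have rw: "rd ?m1 (weights + y mod W) = W ^ (y mod W)"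
    using inv1 valid_codeD(3)[OF valid(1)] by (intro rd_weight) (auto simp: merge_inv_def)
  have "wp M merge_body Q (R, m) = Q (R(rX := ?d), ?m2)"
    unfolding merge_body_def using env R r0 r1 r2 r3 rw
    by (simp add: aval_rd envD del: rd_blk mod_Suc power_Suc)
  moreover have "merge_inv X \<tau> G i f (S \<union> code_pair y x) (R(rX := ?d)) ?m2"
    using inv2 by (simp add: code_pair_def insert_commute del: mod_Suc power_Suc)
  ultimately show ?thesis using Q by simp
qed

text \<open>Both results are again codes of states of the dynamic program, so their open sizes are
  at most \<open>n\<close> and digit 0 does not overflow; this makes the remainders
  additive.\<close>

lemma code_pair_props:
  assumes "growth (gs @ (p, c) # hs)" "length (gs @ (p, c) # hs) = n - 1" "y \<in> codes hs c" "x \<in> codes hs p"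
  shows "\<And>z. z \<in> code_pair y x \<Longrightarrow> valid_code z"
    "(y + x) mod W = y mod W + x mod W" "(y + x - y mod W + (W ^ (y mod W) + W ^ W)) mod W = x mod W"
proof -
  show "valid_code z" if "z \<in> code_pair y x" for z
    using codes_valid[OF assms(1,2), of z p] that assms(3,4) unfolding codes_Cons[OF assms(1,2)] by auto
  have g: "growth ((gs @ [(p, c)]) @ hs)" "length ((gs @ [(p, c)]) @ hs) = n - 1" using assms by simp_all
  let ?T = "dp (wt n) hs (\<lambda>_. {(1, 0)})"
  obtain a r b s where x: "x = a + r" "(a, r) \<in> ?T p" and y: "y = b + s" "(b, s) \<in> ?T c"
    using assms(3,4) by (auto simp: codes_def)
  have yx: "y mod W = b" "x mod W = a"
    using dp_valid(2)[OF g x(2)] dp_valid(2)[OF g y(2)] by (simp_all only: x(1) y(1))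
  have "(a + b, r + s) \<in> dp (wt n) ((p, c) # hs) (\<lambda>_. {(1, 0)}) p"
    "(a, r + s + wt n b) \<in> dp (wt n) ((p, c) # hs) (\<lambda>_. {(1, 0)}) p"
    using mergeI[OF x(2) y(2), of "wt n"] by (simp_all add: dp_Cons)
  note * = this[THEN dp_valid(2)[OF assms(1,2)]]
  have "y + x = a + b + (r + s)" "y + x - b + (W ^ b + W ^ W) = a + (r + s + wt n b)"
    by (simp_all add: x y wt_def del: power_Suc)
  then show "(y + x) mod W = y mod W + x mod W" "(y + x - y mod W + (W ^ (y mod W) + W ^ W)) mod W = x mod W"
    unfolding yx using * by (simp_all only: add.commute)
qed

lemma wp_merge_loop:
  assumes gs: "growth gs" "length gs = n - 1" "edges_of gs \<subseteq> edges_of es"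
    and G: "\<And>i. i < n - 1 \<Longrightarrow> G 4 i = fst (gs ! i) \<and> G 5 i = snd (gs ! i)"
    and inv: "merge_inv (codes []) \<tau> G (n - 1) f {} R m"
    and Q: "\<And>\<tau> G' f R' m'. merge_inv (codes gs) \<tau> G' 0 f {} R' m' \<Longrightarrow> (\<And>t. t < 6 \<Longrightarrow> G' t = G t) \<Longrightarrow> Q (R', m')"
  shows "wp M merge_loop Q (R, m)"
proof -
  let ?I = "\<lambda>j R m. \<exists>\<tau> G' f. merge_inv (codes (drop (n - 1 - j) gs)) \<tau> G' (n - 1 - j) f {} R m \<and> (\<forall>t<6. G' t = G t)"
  show ?thesis unfolding merge_loop_def
  proof (rule wp_while[where I = ?I and N = "n - 1"])
    show "?I 0 R m" using inv gs by auto
    show "n - 1 \<le> M" using M by simp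
  next
    fix R m assume "?I (n - 1) R m"
    then obtain \<tau> G' f where I: "merge_inv (codes gs) \<tau> G' 0 f {} R m" "\<forall>t<6. G' t = G t" by auto
    then show "\<not> bval (Less (Num 0) (Reg rI)) (R, m)" "Q (R, m)"
      using Q[OF I(1)] by (auto simp: merge_inv_def)
  next
    fix j R m assume j: "j < n - 1" and "?I j R m"
    define i where "i = n - 1 - Suc j"
    have i: "n - 1 - j = Suc i" "i < n - 1" using j by (auto simp: i_def)
    from \<open>?I j R m\<close> obtain \<tau> G' f where I: "merge_inv (codes (drop (Suc i) gs)) \<tau> G' (Suc i) f {} R m"
      and G': "\<forall>t<6. G' t = G t" unfolding i by blast
    obtain p c where pc: "gs ! i = (p, c)" by (cases "gs ! i")
    define hs where "hs = drop (Suc i) gs"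
    have drop: "drop i gs = (p, c) # hs" using i gs(2) pc by (simp add: hs_def Cons_nth_drop_Suc[symmetric])
    have split: "take i gs @ (p, c) # hs = gs" using drop by (metis append_take_drop_id)
    have growth: "growth (take i gs @ (p, c) # hs)" "length (take i gs @ (p, c) # hs) = n - 1"
      using gs unfolding split by auto
    have growth': "growth ((take i gs @ [(p, c)]) @ hs)" "length ((take i gs @ [(p, c)]) @ hs) = n - 1"
      using growth by simp_all
    have "{p, c} \<in> edges_of gs" using pc i gs(2) by (force simp: edges_of_def image_iff in_set_conv_nth)
    then have n: "p < n" "c < n" using gs(3) edge_less_n by blast+
    let ?X = "codes hs" and ?R = "R(rI := i, rU := bs (\<tau> c), rV := bs (\<tau> p))"
    let ?inv = "merge_inv ?X \<tau> G' i f" and ?reg = "\<lambda>R. R rU = bs (\<tau> c) \<and> R rV = bs (\<tau> p)"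
    have I': "merge_inv ?X \<tau> G' (Suc i) f {} R m" using I by (simp add: hs_def)
    have start: "?inv {} ?R m" using I' by (simp add: merge_inv_def)
    let ?S = "\<lambda>D. \<Union>y\<in>D. \<Union>x\<in>?X p. code_pair y x"
    have valid: "\<And>v z. z \<in> ?X v \<Longrightarrow> valid_code z" by (rule codes_valid[OF growth'])
    have loops: "wp M (for_table rU rC (for_table rV rD merge_body))
        (\<lambda>(R, m). ?inv (?S (?X c)) R m) (?R, m)"
    proof (rule wp_for_table[where S = "?X c" and g = "G' (\<tau> c)" and t = "\<tau> c" and
        J = "\<lambda>D R m. ?inv (?S D) R m \<and> ?reg R"])
      show "table (G' (\<tau> c)) (?X c)" using I' n by (simp add: merge_inv_def)
      show "card (?X c) \<le> M" by (rule card_codes[OF growth'])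
      show "x < Z" if "x \<in> ?X c" for x using valid[OF that] valid_codeD by blast
      show "?inv (?S {}) ?R m \<and> ?reg ?R" using start by simp
    next
      fix D R m assume "?inv (?S D) R m \<and> ?reg R"
      then show "R rU = bs (\<tau> c) \<and> blk m (\<tau> c) = G' (\<tau> c)"
        "?inv (?S D) (R(rC := z)) m \<and> ?reg (R(rC := z))" for z
        using n by (auto simp: merge_inv_def)
    next
      fix R m assume "?inv (?S (?X c)) R m \<and> ?reg R"
      then show "case (R, m) of (R, m) \<Rightarrow> ?inv (?S (?X c)) R m" by simp
    next
      fix y D R m
      assume y: "y \<in> ?X c" "D \<subseteq> ?X c" "R rC = y" and J: "?inv (?S D) R m \<and> ?reg R"
      \<comment> \<open>Within the outer round for \<open>y\<close>, the content grows by the pairs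
        of \<open>y\<close> with the parent codes seen so far.\<close>
      let ?S' = "\<lambda>E. ?S D \<union> (\<Union>x\<in>E. code_pair y x)"
      show "wp M (for_table rV rD merge_body)
        (\<lambda>(R, m). (?inv (?S (insert y D)) R m \<and> ?reg R) \<and> R rC = y) (R, m)"
      proof (rule wp_for_table[where S = "?X p" and g = "G' (\<tau> p)" and t = "\<tau> p" and
          J = "\<lambda>E R m. ?inv (?S' E) R m \<and> ?reg R \<and> R rC = y"])
        show "table (G' (\<tau> p)) (?X p)" using I' n by (simp add: merge_inv_def)
        show "card (?X p) \<le> M" by (rule card_codes[OF growth'])
        show "x < Z" if "x \<in> ?X p" for x using valid[OF that] valid_codeD by blast
        show "?inv (?S' {}) R m \<and> ?reg R \<and> R rC = y" using J y by simp
      next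
        fix E R m assume "?inv (?S' E) R m \<and> ?reg R \<and> R rC = y"
        then show "R rV = bs (\<tau> p) \<and> blk m (\<tau> p) = G' (\<tau> p)"
          "?inv (?S' E) (R(rD := z)) m \<and> ?reg (R(rD := z)) \<and> (R(rD := z)) rC = y" for z
          using n by (auto simp: merge_inv_def)
      next
        fix R m assume "?inv (?S' (?X p)) R m \<and> ?reg R \<and> R rC = y"
        moreover have "?S' (?X p) = ?S (insert y D)" by auto
        ultimately show "case (R, m) of (R, m) \<Rightarrow>
            (?inv (?S (insert y D)) R m \<and> ?reg R) \<and> R rC = y" by simp
      next
        fix x E R m
        assume x: "x \<in> ?X p" "E \<subseteq> ?X p" "R rD = x"
          and J: "?inv (?S' E) R m \<and> ?reg R \<and> R rC = y"
        note props = code_pair_props[OF growth y(1) x(1)]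
        show "wp M merge_body (\<lambda>(R, m). (?inv (?S' (insert x E)) R m \<and> ?reg R \<and> R rC = y)
            \<and> R rD = x) (R, m)"
        proof (rule wp_merge_body[where X = ?X and v = c and w = p and y = y and x = x and \<tau> = \<tau> and G = G' and i = i
            and f = f and S = "?S' E"])
          show "?inv (?S' E) R m" "R rC = y" "R rD = x" "c < n" "p < n" "y \<in> ?X c" "x \<in> ?X p"
            "valid_code y" "valid_code x"
            using J n x(1,3) y(1) valid by blast+
          show "(y + x) mod W = y mod W + x mod W" "(y + x - y mod W + (W ^ (y mod W) + W ^ W)) mod W = x mod W"
            by (fact props)+
          show "0 < z \<and> z < Z" if "z \<in> code_pair y x" for z using props(1)[OF that] valid_codeD by blast
        next
          fix R' m' assume R': "?inv (?S' E \<union> code_pair y x) R' m'" "\<And>r. r \<noteq> rX \<Longrightarrow> R' r = R r"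
          have "?S' E \<union> code_pair y x = ?S' (insert x E)" by auto
          with R' J x show "case (R', m') of (R, m) \<Rightarrow>
             (?inv (?S' (insert x E)) R m \<and> ?reg R \<and> R rC = y) \<and> R rD = x" by simp
        qed
      qed
    qed
    have env: "env R" "R rI = Suc i" using I' by (auto simp: merge_inv_def)
    have rd45: "rd m (bs 4 + i) = p" "rd m (bs 5 + i) = c" if "?inv S R' m" for S R' m
    proof -
      have "i < Z" using i n_pos by (intro le_n_less_Z(1)) simp
      moreover have "blk m 4 i = p" "blk m 5 i = c"
        using that G[OF i(2)] G' pc by (simp_all add: merge_inv_def)
      ultimately show "rd m (bs 4 + i) = p" "rd m (bs 5 + i) = c" by simp_all
    qed
    have rd7: "rd m (bs 7 + p) = bs (\<tau> p)" "rd m (bs 7 + c) = bs (\<tau> c)"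
      using I' n by (simp_all add: merge_inv_def)
    have fin: "?I (Suc j) (R'(rF := bs (Suc f))) (m'(bs 7 + p := bs f))" if inv': "?inv (?S (?X c)) R' m'" for R' m'
    proof -
      have X: "codes (drop i gs) v = (if v = p then ?S (?X c) else ?X v)" for v
        unfolding drop codes_Cons[OF growth] by auto
      \<comment> \<open>Block \<open>f\<close> is finished: it becomes the table of
        \<open>p\<close>, and its content enters the snapshot.\<close>
      have "merge_inv (codes (drop i gs)) (\<tau>(p := f)) (G'(f := blk m' f)) i (Suc f) {} (R'(rF := bs (Suc f))) (m'(bs 7 + p := bs f))"
        using inv' n unfolding merge_inv_def X
        by (auto simp: table_empty less_Suc_eq simp del: mod_Suc)
      moreover have "\<forall>t<6. (G'(f := blk m' f)) t = G t" using G' inv' by (auto simp: merge_inv_def)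
      ultimately show ?thesis unfolding i_def by blast
    qed
    have "wp M (for_table rU rC (for_table rV rD merge_body))
       (wp M (Store (Reg rCur \<oplus> Mem (Reg rPar \<oplus> Reg rI)) (Reg rF) ;; rF ::= Reg rF \<oplus> Reg rZ) (\<lambda>(R, m). ?I (Suc j) R m)) (?R, m)"
    proof (rule wp_mono[OF loops], clarify)
      fix R' m' assume inv': "?inv (?S (?X c)) R' m'"
      then have "env R'" "R' rI = i" "R' rF = bs f" by (auto simp: merge_inv_def)
      with fin[OF inv'] rd45[OF inv']
      show "wp M (Store (Reg rCur \<oplus> Mem (Reg rPar \<oplus> Reg rI)) (Reg rF) ;; rF ::= Reg rF \<oplus> Reg rZ) (\<lambda>(R, m). ?I (Suc j) R m) (R', m')"
        by (simp add: aval_rd envD del: rd_blk)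
    qed
    with rd45[OF start] rd7 env show "bval (Less (Num 0) (Reg rI)) (R, m) \<and> wp M (rI ::= Reg rI \<ominus> Num 1 ;;
      rU ::= Mem (Reg rCur \<oplus> Mem (Reg rChi \<oplus> Reg rI)) ;;
      rV ::= Mem (Reg rCur \<oplus> Mem (Reg rPar \<oplus> Reg rI)) ;;
      for_table rU rC (for_table rV rD merge_body) ;;
      Store (Reg rCur \<oplus> Mem (Reg rPar \<oplus> Reg rI)) (Reg rF) ;; rF ::= Reg rF \<oplus> Reg rZ) (\<lambda>(R, m). ?I (Suc j) R m) (R, m)"
      by (simp add: aval_rd envD del: rd_blk)
  qed
qed

section \<open>Generating the packable multisets\<close>

abbreviation "Bd \<equiv> boundaries ss"

definition piece :: "nat \<Rightarrow> nat \<Rightarrow> nat \<Rightarrow> nat set" where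
  "piece q c j = (if q < j \<and> j \<le> n \<and> {q<..<j} \<inter> Bd = {} then {c + (W ^ (j - q) + W ^ W)} else {})"

text \<open>This is the content of the table for total length \<open>j\<close> after the tables for
  lengths below \<open>q\<close> have been extended. It is final from \<open>q = j\<close> on, as
  \<open>piece\<close> contributes to larger lengths only.\<close>

fun pack_codes :: "nat \<Rightarrow> nat \<Rightarrow> nat set" where
  "pack_codes 0 j = (if j = 0 then {1} else {})"
| "pack_codes (Suc q) j = pack_codes q j \<union> (\<Union>c\<in>pack_codes q q. piece q c j)"

lemma pack_codes_sound: "c \<in> pack_codes q j \<Longrightarrow> j \<le> n \<and> (\<exists>\<mu>. c = Suc (code (wt n) \<mu>) \<and> packable Bd j \<mu>)"
proof (induction q j arbitrary: c rule: pack_codes.induct)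
  case (1 j)
  then show ?case by (auto split: if_splits intro!: exI[of _ "{#}"] packable.empty)
next
  case (2 q j)
  show ?case
  proof (cases "c \<in> pack_codes q j")
    case True
    then show ?thesis by (rule 2)
  next
    case False
    with 2(3) obtain d where d: "d \<in> pack_codes q q" and j: "q < j" "j \<le> n" "{q<..<j} \<inter> Bd = {}"
      and c: "c = d + (W ^ (j - q) + W ^ W)" by (auto simp: piece_def split: if_splits)
    from 2(2)[OF d] obtain \<mu> where \<mu>: "d = Suc (code (wt n) \<mu>)" "packable Bd q \<mu>" by blast
    have "packable Bd (q + (j - q)) (add_mset (j - q) \<mu>)" using \<mu>(2) j by (intro packable.add) auto
    moreover have "W ^ (j - q) + W ^ W = wt n (j - q)" by (simp only: wt_def)
    ultimately show ?thesis using c j \<mu>(1)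
      by (intro conjI exI[of _ "add_mset (j - q) \<mu>"]) simp_all
  qed
qed

lemma pack_codes_mono: "q \<le> q' \<Longrightarrow> pack_codes q j \<subseteq> pack_codes q' j"
  by (rule lift_Suc_mono_le[of "\<lambda>q. pack_codes q j"]) auto

text \<open>The piece appended last starts at \<open>m\<close>; by induction the rest is in the
  table for \<open>m\<close> when that table is extended.\<close>

lemma pack_codes_complete: "packable Bd j \<mu> \<Longrightarrow> j \<le> n \<Longrightarrow> j \<le> q \<Longrightarrow> Suc (code (wt n) \<mu>) \<in> pack_codes q j"
proof (induction arbitrary: q rule: packable.induct)
  case empty
  have "1 \<in> pack_codes 0 0" by simp
  then show ?case using pack_codes_mono[of 0 q 0] by auto
next
  case (add m \<mu> x)
  have "Suc (code (wt n) \<mu>) \<in> pack_codes m m" using add by simp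
  moreover have "Suc (code (wt n) (add_mset x \<mu>)) \<in> piece m (Suc (code (wt n) \<mu>)) (m + x)"
    using add by (simp add: piece_def wt_def del: power_Suc)
  ultimately have "Suc (code (wt n) (add_mset x \<mu>)) \<in> pack_codes (Suc m) (m + x)" by auto
  then show ?case using pack_codes_mono[of "Suc m" q "m + x"] add by auto
qed

lemma pack_codes_less: "c \<in> pack_codes q j \<Longrightarrow> 0 < c \<and> c < Z"
proof -
  assume "c \<in> pack_codes q j"
  from pack_codes_sound[OF this] obtain \<mu> where \<mu>: "j \<le> n" "c = Suc (code (wt n) \<mu>)" "packable Bd j \<mu>" by blast
  with state_code_less[of \<mu> n 1] packable_sum_mset[OF \<mu>(3)] packable_pos[OF \<mu>(3)] n_pos
  show ?thesis by (simp add: Z del: power_Suc)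
qed

lemma card_pack_codes: "card (pack_codes q j) \<le> M"
proof -
  have sub: "pack_codes q j \<subseteq> (\<lambda>\<mu>. Suc (code (wt n) \<mu>)) ` partitions_upto n n"
  proof
    fix c assume "c \<in> pack_codes q j"
    from pack_codes_sound[OF this] obtain \<mu> where \<mu>: "j \<le> n" "c = Suc (code (wt n) \<mu>)" "packable Bd j \<mu>" by blast
    have "x \<in> {1..n}" if "x \<in># \<mu>" for x
      using member_le_sum_mset[OF that] packable_sum_mset[OF \<mu>(3)] packable_pos[OF \<mu>(3)] \<mu>(1) that
      by (cases x) auto
    then have "\<mu> \<in> partitions_upto n n"
      using packable_sum_mset[OF \<mu>(3)] \<mu>(1) by (auto simp: partitions_upto_def)
    with \<mu>(2) show "c \<in> (\<lambda>\<mu>. Suc (code (wt n) \<mu>)) ` partitions_upto n n" by blast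
  qed
  have fin: "finite (partitions_upto n n)" using n_pos by (rule card_partitions_upto(1))
  have "card (pack_codes q j) \<le> card ((\<lambda>\<mu>. Suc (code (wt n) \<mu>)) ` partitions_upto n n)"
    using sub fin by (intro card_mono) auto
  also have "\<dots> \<le> card (partitions_upto n n)" using fin by (rule card_image_le)
  finally show ?thesis using M(2) by linarith
qed

definition pack_inv :: "nat \<Rightarrow> (nat \<Rightarrow> nat \<Rightarrow> nat) \<Rightarrow> (nat \<Rightarrow> nat set) \<Rightarrow> (nat \<Rightarrow> nat) \<Rightarrow> (nat \<Rightarrow> nat) \<Rightarrow> bool" where
  "pack_inv f G T R m \<longleftrightarrow> env R \<and> low m \<and> R 0 = 0 \<and> (\<forall>t<f. blk m t = G t) \<and> (\<forall>j\<le>n. table (blk m (f + j)) (T j))"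

lemma pack_inv_upd [simp]: "20 \<le> r \<Longrightarrow> pack_inv f G T (R(r := x)) m = pack_inv f G T R m"
  by (simp add: pack_inv_def)

lemma pack_inv_insert:
  assumes "pack_inv f G T R m" "0 < c" "c < Z" "\<And>j. j \<le> n \<Longrightarrow> T' j = (if j = y then insert c (T j) else T j)"
  shows "pack_inv f G T' R (insert_mem m (bs (f + y)) c)"
  using assms table_insert[of "blk m (f + y)" "T y" c] by (auto simp: pack_inv_def)

lemma pack_inv_cong: "(\<And>j. j \<le> n \<Longrightarrow> T j = T' j) \<Longrightarrow> pack_inv f G T R m = pack_inv f G T' R m"
  by (simp add: pack_inv_def)

lemma wp_pieces_loop:
  assumes inv: "pack_inv f G T R m" and f: "2 < f" and G: "G 2 = boundary_fun (length ss)" and q: "q < n"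
    and c: "c \<in> pack_codes q q" and R: "R rC = c" "R rX = q" "R rY = Suc q" "R rV = bs (f + Suc q)" "R rG = 0"
    and Q: "\<And>R' m'. pack_inv f G (\<lambda>j. T j \<union> piece q c j) R' m' \<Longrightarrow> blk m' (f + q) = blk m (f + q) \<Longrightarrow>
       R' rC = c \<Longrightarrow> R' rX = q \<Longrightarrow> R' rQ = R rQ \<Longrightarrow> Q (R', m')"
  shows "wp M pieces_loop Q (R, m)"
proof -
  let ?T = "\<lambda>i j. T j \<union> (if j < Suc q + i then piece q c j else {})"
  let ?I = "\<lambda>i R' m'. pack_inv f G (?T i) R' m' \<and> blk m' (f + q) = blk m (f + q) \<and> R' rC = c \<and> R' rX = q \<and> R' rQ = R rQ \<and>
     R' rY = Suc q + i \<and> R' rV = bs (f + (Suc q + i)) \<and> (R' rG = 0 \<longleftrightarrow> {q<..<Suc q + i} \<inter> Bd = {})"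
  show ?thesis unfolding pieces_loop_def
  proof (rule wp_while[where I = ?I and N = "n - q"])
    have "piece q c j = {}" if "j < Suc q" for j using that by (simp add: piece_def)
    then have "pack_inv f G (?T 0) R m = pack_inv f G T R m" by (intro pack_inv_cong) auto
    then show "?I 0 R m" using inv R by auto
    show "n - q \<le> M" using M by simp
  next
    fix i R1 m1 assume i: "i < n - q" and I: "?I i R1 m1"
    define y where "y = Suc q + i"
    have y: "y \<le> n" "q < y" "Suc q + Suc i = Suc y" using i by (auto simp: y_def)
    have lt: "j < Suc q + Suc i \<longleftrightarrow> j < Suc q + i \<or> j = y" for j by (auto simp: y_def)
    have env: "env R1" "low m1" and inv1: "pack_inv f G (?T i) R1 m1" using I by (auto simp: pack_inv_def)
    have R1: "R1 rC = c" "R1 rX = q" "R1 rQ = R rQ" "R1 rY = y" "R1 rV = bs (f + y)"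
       "R1 rG = 0 \<longleftrightarrow> {q<..<y} \<inter> Bd = {}" "blk m1 (f + q) = blk m (f + q)"
      using I by (simp_all add: y_def)
    have bd: "rd m' (bs 2 + y) = (if y \<in> Bd then 1 else 0)" if "pack_inv f G T' R' m'" for T' R' m'
    proof -
      have "rd m' (bs 2 + y) = G 2 y" using that f y by (simp add: pack_inv_def)
      then show ?thesis unfolding G boundary_fun_def boundaries_def using y by auto
    qed
    have gap: "{q<..<Suc y} \<inter> Bd = {} \<longleftrightarrow> {q<..<y} \<inter> Bd = {} \<and> y \<notin> Bd"
      using y(2) by (auto simp: less_Suc_eq)
    have cond: "bval (Less (Reg rY) (Reg rN \<oplus> Num 1)) (R1, m1)"
      using R1 y env by (simp add: envD)
    show "bval (Less (Reg rY) (Reg rN \<oplus> Num 1)) (R1, m1) \<and> wp M (Cond (Less (Reg rG) (Num 1))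
        (rD ::= Reg rC \<oplus> (Mem (Reg rL \<oplus> (Reg rY \<ominus> Reg rX)) \<oplus> Reg rTop) ;; insert_prog rV rD) Skip ;;
      rG ::= Reg rG \<oplus> Mem (Reg rBd \<oplus> Reg rY) ;; rV ::= Reg rV \<oplus> Reg rZ ;; rY ::= Reg rY \<oplus> Num 1)
        (\<lambda>(R, m). ?I (Suc i) R m) (R1, m1)"
    proof (cases "R1 rG = 0")
      case True
      let ?c = "c + (W ^ (y - q) + W ^ W)"
      have p: "piece q c y = {?c}" using True R1(6) y by (simp add: piece_def)
      then have "?c \<in> pack_codes (Suc q) y" using c by auto
      note cZ = conjunct1[OF pack_codes_less[OF this]] conjunct2[OF pack_codes_less[OF this]]
      have w: "rd m1 (weights + (y - q)) = W ^ (y - q)" using env y by (intro rd_weight) auto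
      have inv2: "pack_inv f G (?T (Suc i)) R1 (insert_mem m1 (bs (f + y)) ?c)"
      proof (rule pack_inv_insert[OF inv1 cZ])
        fix j show "?T (Suc i) j = (if j = y then insert ?c (?T i j) else ?T i j)"
          unfolding lt using p by (auto simp: y_def)
      qed
      have "blk (insert_mem m1 (bs (f + y)) ?c) (f + q) = blk m (f + q)" using cZ(2) y(2) R1 by simp
      with cond inv2 env R1 w True bd[OF inv2] gap y(3) show ?thesis
        by (simp add: aval_rd envD del: rd_blk rd_weight power_Suc power.simps)
    next
      case False
      then have p: "piece q c y = {}" using R1(6) y by (auto simp: piece_def)
      have "pack_inv f G (?T i) R1 m1 = pack_inv f G (?T (Suc i)) R1 m1"
        unfolding lt using p by (intro pack_inv_cong) (auto simp: y_def)
      with inv1 have inv2: "pack_inv f G (?T (Suc i)) R1 m1" by simp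
      from cond inv2 env R1 False bd[OF inv2] gap y(3) show ?thesis
        by (simp add: aval_rd envD del: rd_blk rd_weight power_Suc power.simps)
    qed
  next
    fix R1 m1 assume I: "?I (n - q) R1 m1"
    have "pack_inv f G (?T (n - q)) R1 m1 = pack_inv f G (\<lambda>j. T j \<union> piece q c j) R1 m1"
      using q by (intro pack_inv_cong) auto
    with I q show "\<not> bval (Less (Reg rY) (Reg rN \<oplus> Num 1)) (R1, m1)" "Q (R1, m1)"
      by (auto simp: pack_inv_def envD intro!: Q)
  qed
qed

lemma wp_pack_loop:
  assumes inv: "pack_inv f G (pack_codes 0) R m" and f: "2 < f" and G: "G 2 = boundary_fun (length ss)"
    and R: "R rX = 0" "R rQ = bs f"
    and Q: "\<And>R' m'. pack_inv f G (pack_codes n) R' m' \<Longrightarrow> R' rQ = bs (f + n) \<Longrightarrow> Q (R', m')"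
  shows "wp M pack_loop Q (R, m)"
proof -
  let ?body = "rV ::= Reg rQ \<oplus> Reg rZ ;; rG ::= Num 0 ;; rY ::= Reg rX \<oplus> Num 1 ;; pieces_loop"
  let ?loop = "for_table rQ rC ?body"
  let ?I = "\<lambda>q R m. pack_inv f G (pack_codes q) R m \<and> R rX = q \<and> R rQ = bs (f + q)"
  show ?thesis unfolding pack_loop_def
  proof (rule wp_while[where I = ?I and N = n])
    show "?I 0 R m" using inv R by simp
    show "n \<le> M" using M by simp
  next
    fix q R m assume q: "q < n" and I: "?I q R m"
    let ?g = "blk m (f + q)"
    let ?J = "\<lambda>D R m. pack_inv f G (\<lambda>j. pack_codes q j \<union> (\<Union>c\<in>D. piece q c j)) R m \<and> R rX = q \<and> R rQ = bs (f + q) \<and>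
       blk m (f + q) = ?g"
    have loop: "wp M ?loop
      (\<lambda>(R, m). ?J (pack_codes q q) R m) (R, m)"
    proof (rule wp_for_table[where S = "pack_codes q q" and g = ?g and t = "f + q" and J = ?J])
      show "table ?g (pack_codes q q)" using I q by (simp add: pack_inv_def)
      show "c < Z" if "c \<in> pack_codes q q" for c using pack_codes_less[OF that] by blast
      show "card (pack_codes q q) \<le> M" by (rule card_pack_codes)
      show "?J {} R m" using I by simp
    next
      fix D R m assume "?J D R m"
      then show "R rQ = bs (f + q) \<and> blk m (f + q) = ?g" "?J D (R(rC := y)) m" for y by simp_all
    next
      fix R m assume "?J (pack_codes q q) R m"
      then show "case (R, m) of (R, m) \<Rightarrow> ?J (pack_codes q q) R m" by simp
    next
      fix c D R1 m1
      assume c: "c \<in> pack_codes q q" "R1 rC = c" and J: "?J D R1 m1"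
      let ?R = "R1(rV := bs (f + Suc q), rG := 0, rY := Suc q)"
      have "wp M pieces_loop (\<lambda>(R, m). ?J (insert c D) R m \<and> R rC = c) (?R, m1)"
      proof (rule wp_pieces_loop[where f = f and G = G and q = q and c = c and
          T = "\<lambda>j. pack_codes q j \<union> (\<Union>c\<in>D. piece q c j)"])
        show "pack_inv f G (\<lambda>j. pack_codes q j \<union> (\<Union>c\<in>D. piece q c j)) ?R m1" using J by simp
      next
        fix R' m' assume a: "pack_inv f G (\<lambda>j. pack_codes q j \<union> (\<Union>c\<in>D. piece q c j) \<union> piece q c j) R' m'"
          "blk m' (f + q) = blk m1 (f + q)" "R' rC = c" "R' rX = q" "R' rQ = ?R rQ"
        have "pack_inv f G (\<lambda>j. pack_codes q j \<union> (\<Union>c\<in>insert c D. piece q c j)) R' m'"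
          using a(1) by (simp add: Un_assoc Un_left_commute Un_commute)
        with a J show "case (R', m') of (R, m) \<Rightarrow> ?J (insert c D) R m \<and> R rC = c" by simp
      qed (use c J f G q in simp_all)
      moreover have "env R1" using J by (simp add: pack_inv_def)
      ultimately show "wp M (?body)
        (\<lambda>(R, m). ?J (insert c D) R m \<and> R rC = c) (R1, m1)"
        using J by (simp add: aval_rd envD)
    qed
    have "wp M (?loop ;; rQ ::= Reg rQ \<oplus> Reg rZ ;; rX ::= Reg rX \<oplus> Num 1) (\<lambda>(R, m). ?I (Suc q) R m) (R, m)"
      unfolding wp.simps(4)
    proof (rule wp_mono[OF loop])
      fix s assume "case s of (R, m) \<Rightarrow> ?J (pack_codes q q) R m"
      then obtain R' m' where s: "s = (R', m')" and J: "?J (pack_codes q q) R' m'" by (cases s) auto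
      have "(\<lambda>j. pack_codes q j \<union> (\<Union>c\<in>pack_codes q q. piece q c j)) = pack_codes (Suc q)" by (rule ext) simp
      with J have "pack_inv f G (pack_codes (Suc q)) R' m'" "R' rX = q" "R' rQ = bs (f + q)" by auto
      moreover from this have "env R'" by (simp add: pack_inv_def)
      ultimately show "wp M (rQ ::= Reg rQ \<oplus> Reg rZ) (wp M (rX ::= Reg rX \<oplus> Num 1) (\<lambda>(R, m). ?I (Suc q) R m)) s"
        by (simp add: s aval_rd envD del: pack_codes.simps)
    qed
    moreover have "bval (Less (Reg rX) (Reg rN)) (R, m)" using I q by (simp add: pack_inv_def envD)
    ultimately show "bval (Less (Reg rX) (Reg rN)) (R, m) \<and> wp M (?loop ;; rQ ::= Reg rQ \<oplus> Reg rZ ;; rX ::= Reg rX \<oplus> Num 1) (\<lambda>(R, m). ?I (Suc q) R m) (R, m)" by blast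
  next
    fix R m assume "?I n R m"
    then show "\<not> bval (Less (Reg rX) (Reg rN)) (R, m)" "Q (R, m)" using Q by (auto simp: pack_inv_def envD)
  qed
qed

section \<open>The final test\<close>

definition accepted :: "nat \<Rightarrow> bool" where
  "accepted y \<longleftrightarrow> (let d = y - y mod W + (W ^ (y mod W) + W ^ W) in
     d < (2 + min k n) * W ^ W \<and> Suc d \<in> pack_codes n n)"

lemma wp_check_prog:
  assumes inv: "pack_inv f G (pack_codes n) R m" and Q': "R rQ = bs (f + n)"
    and f: "7 < f" and G7: "G 7 0 = bs t" "t < f" "table (G t) S" and card: "card S \<le> M"
    and S: "\<And>y. y \<in> S \<Longrightarrow> valid_code y" "\<And>y. y \<in> S \<Longrightarrow> G 6 y = y mod W"
      "\<And>y. y \<in> S \<Longrightarrow> Suc (y - y mod W + (W ^ (y mod W) + W ^ W)) < Z"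
    and Q: "\<And>R' m'. R' 0 = (if \<exists>y\<in>S. accepted y then 1 else 0) \<Longrightarrow> Q (R', m')"
  shows "wp M check_prog Q (R, m)"
proof -
  have env: "env R" "low m" "R 0 = 0" using inv by (auto simp: pack_inv_def)
  have tab: "table (blk m (f + n)) (pack_codes n n)" using inv by (simp add: pack_inv_def)
  have blkt: "blk m t = G t" "blk m 7 0 = bs t" "\<And>y. blk m 6 y = G 6 y" using inv G7 f by (auto simp: pack_inv_def)
  let ?body = "rX ::= Reg rC \<ominus> Mem (Reg rSiz \<oplus> Reg rC) \<oplus> (Mem (Reg rL \<oplus> Mem (Reg rSiz \<oplus> Reg rC)) \<oplus> Reg rTop) ;;
        Cond (Conj (Less (Reg rX) (Reg rT)) (Less (Num 0) (Mem (Reg rQ \<oplus> (Reg rX \<oplus> Num 1)))))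
          (0 ::= Num 1) Skip"
  have loop: "wp M (for_table rU rC ?body) Q (R(rU := bs t), m)"
  proof (rule wp_for_table[where S = S and g = "G t" and t = t and
      J = "\<lambda>D R m'. m' = m \<and> env R \<and> R rU = bs t \<and> R rQ = bs (f + n) \<and> R 0 = (if \<exists>y\<in>D. accepted y then 1 else 0)"])
    show "y < Z" if "y \<in> S" for y using valid_codeD(2)[OF S(1)[OF that]] .
  next
    fix y D R1 m1
    assume y: "y \<in> S" "y < Z" "R1 rC = y" and J: "m1 = m \<and> env R1 \<and> R1 rU = bs t \<and> R1 rQ = bs (f + n) \<and>
       R1 0 = (if \<exists>y\<in>D. accepted y then 1 else 0)"
    let ?d = "y - y mod W + (W ^ (y mod W) + W ^ W)"
    have r1: "rd m (bs 6 + y) = y mod W" using y blkt S(2) by simp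
    have r2: "rd m (weights + y mod W) = W ^ (y mod W)"
      using env(2) valid_codeD(3)[OF S(1)[OF y(1)]] by (intro rd_weight) simp_all
    have "rd m (Suc (bs (f + n) + ?d)) = blk m (f + n) (Suc ?d)" using S(3)[OF y(1)] by (intro rd_blk(3))
    then have r3: "rd m (Suc (bs (f + n) + ?d)) = 0 \<longleftrightarrow> Suc ?d \<notin> pack_codes n n" using table_member[OF tab] by simp
    have acc: "accepted y \<longleftrightarrow> ?d < (2 + min k n) * W ^ W \<and> Suc ?d \<in> pack_codes n n" by (simp only: accepted_def Let_def)
    define d where "d = ?d"
    show "wp M ?body (\<lambda>(R, m'). (m' = m \<and> env R \<and> R rU = bs t \<and> R rQ = bs (f + n) \<and>
       R 0 = (if \<exists>y\<in>insert y D. accepted y then 1 else 0)) \<and> R rC = y) (R1, m1)"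
      using J y(3) r1 r2 r3 acc unfolding d_def[symmetric]
      by (simp add: aval_rd envD d_def[symmetric] del: rd_blk rd_weight power_Suc power.simps mod_Suc)
  qed (use env inv G7 card blkt Q Q' in auto)
  have "rd m (bs 7) = bs t" using blkt(2) by simp
  with env loop show ?thesis by (simp add: check_prog_def aval_rd envD del: rd_blk)
qed

end

section \<open>Accepted codes and solutions\<close>

lemma growth_component_sum_id:
  assumes "growth gs" "F \<subseteq> edges_of gs"
  shows "component_sum (\<lambda>x. x) a (verts gs) F = sum a (verts gs)"
  using assms
proof (induction arbitrary: F a rule: growth.induct)
  case Nil
  then show ?case by (simp add: component_sum_def components_singleton)
next
  case (snoc gs p c)
  from growth.snoc[OF snoc.hyps] snoc.prems show ?case
  proof (cases rule: growth_snoc_edge_subset_cases)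
    case 1
    then have "component_sum (\<lambda>x. x) a (insert c (verts gs)) F = a c + component_sum (\<lambda>x. x) a (verts gs) F"
      using snoc.hyps by (intro component_sum_isolated) auto
    with snoc.IH[OF 1(1)] snoc.hyps show ?thesis by (simp add: verts_snoc)
  next
    case (2 F')
    then have "component_sum (\<lambda>x. x) a (insert c (verts gs)) F
        = component_sum (\<lambda>x. x) (a(p := a p + a c)) (verts gs) F'"
      unfolding 2(1) using snoc.hyps by (intro component_sum_join) auto
    also have "\<dots> = sum (a(p := a p + a c)) (verts gs)" by (rule snoc.IH[OF 2(2)])
    also have "\<dots> = a p + a c + sum (a(p := a p + a c)) (verts gs - {p})"
      using snoc.hyps by (simp add: sum.remove[of _ p])
    also have "sum (a(p := a p + a c)) (verts gs - {p}) = sum a (verts gs - {p})"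
      by (rule sum.cong) auto
    also have "a p + a c + sum a (verts gs - {p}) = a c + sum a (verts gs)"
      using snoc.hyps by (simp add: sum.remove[of "verts gs" p])
    also have "\<dots> = sum a (insert c (verts gs))" using snoc.hyps by simp
    finally show ?thesis by (simp add: verts_snoc)
  qed
qed

lemma growth_sum_card_components:
  "growth gs \<Longrightarrow> F \<subseteq> edges_of gs \<Longrightarrow> (\<Sum>C\<in>components (verts gs) F. card C) = Suc (length gs)"
  using growth_component_sum_id[of gs F "\<lambda>_. 1"] by (simp add: component_sum_def growth_card_verts)

lemma code_component_sizes: "finite A \<Longrightarrow> code w (image_mset f (mset_set A)) = (\<Sum>x\<in>A. w (f x))"
  by (simp add: code_def image_mset.compositionality o_def sum_unfold_sum_mset)

context tp_run
begin

lemma component_sizes: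
  assumes "growth gs" "length gs = n - 1" "F \<subseteq> edges_of gs" "verts gs = {..<n}"
  defines "\<mu> \<equiv> image_mset card (mset_set (components {..<n} F))"
  shows "0 \<notin># \<mu>" "sum_mset \<mu> = n" "size \<mu> = card (components {..<n} F)" "card (components {..<n} F) + card F = n"
proof -
  have fin: "finite (components {..<n} F)" by (simp add: finite_components)
  have "card C \<noteq> 0" if "C \<in> components {..<n} F" for C
    using component_nonempty[OF that] components_subset[OF that] finite_subset[of C "{..<n}"] by auto
  then show "0 \<notin># \<mu>" using fin unfolding \<mu>_def by force
  have len: "Suc (length gs) = n" using assms(2) n_pos by simp
  show "sum_mset \<mu> = n"
    using growth_sum_card_components[OF assms(1,3)] len by (simp add: \<mu>_def assms(4) sum_unfold_sum_mset)
  show "size \<mu> = card (components {..<n} F)" by (simp add: \<mu>_def)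
  show "card (components {..<n} F) + card F = n"
    using growth_card_components[OF assms(1,3)] len by (simp add: assms(4))
qed

text \<open>The groups together contain every vertex exactly once. This justifies rejecting all
  other group sizes without building any tables.\<close>

lemma tp_yes_sum_list:
  assumes "growth gs" "length gs = n - 1" "edges_of gs = edges_of es" "verts gs = {..<n}" "tp_yes (n, es, k, ss)"
  shows "sum_list ss = n"
proof -
  from assms(5) obtain E' g where E': "E' \<subseteq> edges_of es" and
    g: "\<forall>C\<in>components {..<n} (edges_of es - E'). g C < length ss"
       "\<And>i. i < length ss \<Longrightarrow> (\<Sum>C | C \<in> components {..<n} (edges_of es - E') \<and> g C = i. card C) = ss ! i"
    by (auto simp: tp_yes_def tree_partitioning_def)
  let ?D = "components {..<n} (edges_of es - E')"
  have "sum_list ss = (\<Sum>i<length ss. ss ! i)" by (simp add: sum_list_sum_nth atLeast0LessThan)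
  also have "\<dots> = (\<Sum>i<length ss. \<Sum>C | C \<in> ?D \<and> g C = i. card C)" using g(2) by simp
  also have "\<dots> = (\<Sum>C\<in>?D. card C)" using g(1) by (intro sum.group) (auto simp: finite_components)
  also have "\<dots> = n"
    using component_sizes(2)[OF assms(1,2) _ assms(4), of "edges_of es - E'"] assms(3)
    by (auto simp: sum_unfold_sum_mset)
  finally show ?thesis .
qed

text \<open>The sets \<open>F\<close> of the dynamic program are the kept edges, the complements of
  the cut sets. In a forest the number of components plus the number of edges is \<open>n\<close>,
  so at most \<open>k\<close> cuts means at most \<open>k + 1\<close> components.\<close>

lemma accepted_iff_tp_yes:
  assumes gs: "growth gs" "length gs = n - 1" "edges_of gs = edges_of es" "verts gs = {..<n}" and sum: "sum_list ss = n"
  shows "(\<exists>y\<in>codes gs 0. accepted y) \<longleftrightarrow> tp_yes (n, es, k, ss)"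
proof -
  let ?T = "dp (wt n) gs (\<lambda>_. {(1, 0)})" and ?E = "edges_of es"
  let ?grouped = "\<lambda>F. \<exists>g. (\<forall>C\<in>components {..<n} F. g C < length ss) \<and>
     (\<forall>i<length ss. (\<Sum>C | C \<in> components {..<n} F \<and> g C = i. card C) = ss ! i)"
  define ok where "ok = (\<lambda>d. d < (2 + min k n) * W ^ W \<and> Suc d \<in> pack_codes n n)"
  have acc: "accepted (a + r) \<longleftrightarrow> ok (r + wt n a)" if "(a, r) \<in> ?T 0" for a r
  proof -
    have "(a + r) mod W = a" using dp_valid(2)[where gs = "[]", OF _ _ that] gs by simp
    then have "a + r - (a + r) mod W + (W ^ ((a + r) mod W) + W ^ W) = r + wt n a"
      by (simp add: wt_def del: power_Suc mod_Suc)
    then show ?thesis unfolding accepted_def ok_def by (simp only: Let_def)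
  qed
  have ok: "ok (\<Sum>C\<in>components {..<n} F. wt n (card C)) \<longleftrightarrow> card (components {..<n} F) \<le> Suc k \<and>
     ?grouped F"
    if F: "F \<subseteq> ?E" for F
  proof -
    let ?D = "components {..<n} F"
    define \<mu> where "\<mu> = image_mset card (mset_set ?D)"
    have F': "F \<subseteq> edges_of gs" using F gs(3) by simp
    note sizes = component_sizes[OF gs(1,2) F' gs(4), folded \<mu>_def]
    have fin: "finite ?D" by (simp add: finite_components)
    have code: "(\<Sum>C\<in>?D. wt n (card C)) = code (wt n) \<mu>"
      unfolding \<mu>_def using fin by (rule code_component_sizes[symmetric])
    have "size \<mu> \<le> n" using size_le_sum_mset[OF sizes(1)] sizes(2) by simp
    then have 1: "code (wt n) \<mu> < (2 + min k n) * W ^ W \<longleftrightarrow> card ?D \<le> Suc k"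
      using code_less_iff_size[OF sizes(1), of n "2 + min k n"] sizes(2,3) by auto
    have 2: "Suc (code (wt n) \<mu>) \<in> pack_codes n n \<longleftrightarrow> packable Bd n \<mu>"
    proof
      assume "Suc (code (wt n) \<mu>) \<in> pack_codes n n"
      from pack_codes_sound[OF this] obtain \<nu> where \<nu>: "code (wt n) \<mu> = code (wt n) \<nu>" "packable Bd n \<nu>" by auto
      have "\<mu> = \<nu>"
        using sizes(1,2) packable_pos[OF \<nu>(2)] packable_sum_mset[OF \<nu>(2)] \<nu>(1) by (intro code_inj[of _ n]) auto
      with \<nu> show "packable Bd n \<mu>" by simp
    qed (rule pack_codes_complete, simp_all)
    have pos: "0 < card C" if "C \<in> ?D" for C
      using sizes(1) that fin by (force simp: \<mu>_def)
    have "packable Bd n \<mu> \<longleftrightarrow> ?grouped F"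
      using grouped_iff_packable[where f = card and ss = ss, OF fin pos] sum by (simp add: \<mu>_def)
    then show ?thesis unfolding code ok_def 1 2 by blast
  qed
  have "(\<exists>y\<in>codes gs 0. accepted y) \<longleftrightarrow> (\<exists>d\<in>(\<lambda>(a, r). r + wt n a) ` ?T 0. ok d)"
    unfolding codes_def using acc by (auto simp: case_prod_beta)
  also have "\<dots> \<longleftrightarrow> (\<exists>F\<subseteq>?E. ok (\<Sum>C\<in>components {..<n} F. wt n (card C)))"
    unfolding dp_correct[OF gs(1)] gs(3,4) by auto
  also have "\<dots> \<longleftrightarrow> tp_yes (n, es, k, ss)"
  proof
    assume "\<exists>F\<subseteq>?E. ok (\<Sum>C\<in>components {..<n} F. wt n (card C))"
    then obtain F where F: "F \<subseteq> ?E" "ok (\<Sum>C\<in>components {..<n} F. wt n (card C))" by blast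
    have "finite ?E" by (simp add: edges_of_def)
    then have "card (?E - F) = card ?E - card F" using F(1) by (simp add: card_Diff_subset finite_subset)
    moreover have "card ?E = n - 1" using growth_card_edges[OF gs(1)] gs by simp
    moreover have "card (components {..<n} F) + card F = n" using component_sizes(4)[OF gs(1,2) _ gs(4)] F gs(3) by simp
    ultimately have "card (?E - F) \<le> k" using ok[OF F(1)] F(2) n_pos by linarith
    moreover have eq: "?E - (?E - F) = F" using F(1) by auto
    moreover have "?grouped F"
      using ok[OF F(1)] F(2) by blast
    ultimately show "tp_yes (n, es, k, ss)"
      unfolding tp_yes_def tree_partitioning_def prod.case
      by (intro exI[of _ "?E - F"] conjI Diff_subset) (simp_all only: eq)
  next
    assume "tp_yes (n, es, k, ss)"
    then obtain E' where E': "E' \<subseteq> ?E" "card E' \<le> k" "?grouped (?E - E')"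
      unfolding tp_yes_def tree_partitioning_def by auto
    have "finite ?E" by (simp add: edges_of_def)
    then have "card (?E - E') = card ?E - card E'" using E'(1) by (simp add: card_Diff_subset finite_subset)
    moreover have "card ?E = n - 1" using growth_card_edges[OF gs(1)] gs by simp
    moreover have "card (components {..<n} (?E - E')) + card (?E - E') = n"
      using component_sizes(4)[OF gs(1,2) _ gs(4), of "?E - E'"] gs(3) by auto
    ultimately have "card (components {..<n} (?E - E')) \<le> Suc k" using E'(2) n_pos by linarith
    with E'(3) have "ok (\<Sum>C\<in>components {..<n} (?E - E'). wt n (card C))" using ok[of "?E - E'"] by blast
    then show "\<exists>F\<subseteq>?E. ok (\<Sum>C\<in>components {..<n} F. wt n (card C))" by (intro exI[of _ "?E - E'"]) auto
  qed
  finally show ?thesis .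
qed

lemma wp_main_prog:
  assumes inv: "boundary_inv (length ss) R m" and sum: "sum_list ss = n"
    and Q: "\<And>R' m'. R' 0 = (if tp_yes (n, es, k, ss) then 1 else 0) \<Longrightarrow> Q (R', m')"
  shows "wp M main_prog Q (R, m)"
proof -
  have env: "env R" "low m" "R 0 = 0" and b: "blk m = (\<lambda>_ _. 0)(2 := boundary_fun (length ss))"
    using inv by (auto simp: boundary_inv_def)
  let ?G = "(\<lambda>_ _. 0)(2 := boundary_fun (length ss))"
  \<comment> \<open>Named in this way, the postcondition of each stage stays opaque while the stage
    before it is verified.\<close>
  define check_Q where "check_Q = wp M check_prog Q"
  define pack_Q where "pack_Q = wp M (rQ ::= Reg rF ;; Store (Reg rQ) (Num 1) ;; Store (Reg rQ \<oplus> Num 1) (Num 1) ;; rX ::= Num 0 ;; pack_loop ;;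
     check_prog) Q"
  define merge_Q where "merge_Q = wp M merge_loop pack_Q"
  define sing_Q where "sing_Q = wp M (Store (Reg rSiz \<oplus> Num 1) (Num 1) ;; rX ::= Num 0 ;; rF ::= Reg rCur \<oplus> Reg rZ ;; singletons_loop) merge_Q"
  have pack: "pack_Q (R', m')" if gs: "growth gs" "length gs = n - 1" "edges_of gs = edges_of es" "verts gs = {..<n}"
      and mi: "merge_inv (codes gs) \<tau> G' 0 f {} R' m'" and G2: "G' 2 = boundary_fun (length ss)" for gs \<tau> G' f R' m'
  proof -
    let ?m = "m'(bs f := Suc 0, Suc (bs f) := Suc 0)"
    have e: "env R'" "low m'" "R' 0 = 0" "R' rF = bs f" "8 \<le> f" using mi by (auto simp: merge_inv_def)
    have tf: "table (blk m' f) {}" "\<And>t. f < t \<Longrightarrow> blk m' t = (\<lambda>_. 0)" using mi by (auto simp: merge_inv_def)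
    \<comment> \<open>An empty table is zero everywhere, so the block reserved for the next merge
      can serve as the first table of the packing stage.\<close>
    have bf: "blk m' f = (\<lambda>_. 0)"
    proof
      fix i show "blk m' f i = 0"
        using tf(1) by (cases "i = 0") (auto simp: table_def linked_def)
    qed
    have pi: "pack_inv f (blk m') (pack_codes 0) (R'(rQ := bs f, rX := 0)) ?m"
      using e tf(2) bf table_singleton table_empty n_pos
      by (auto simp: pack_inv_def fun_upd_twist)
    have "wp M pack_loop check_Q (R'(rQ := bs f, rX := 0), ?m)"
    proof (rule wp_pack_loop[OF pi])
      show "2 < f" using e by simp
      show "blk m' 2 = boundary_fun (length ss)" using mi G2 by (simp add: merge_inv_def)
    next
      fix R1 m1 assume p1: "pack_inv f (blk m') (pack_codes n) R1 m1" "R1 rQ = bs (f + n)"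
      have g: "growth ([] @ gs)" "length ([] @ gs) = n - 1" using gs by simp_all
      have valid: "\<And>y. y \<in> codes gs 0 \<Longrightarrow> valid_code y" by (rule codes_valid[OF g])
      show "check_Q (R1, m1)" unfolding check_Q_def
      proof (rule wp_check_prog[OF p1, where S = "codes gs 0" and t = "\<tau> 0"])
        show "7 < f" "\<tau> 0 < f" "blk m' 7 0 = bs (\<tau> 0)" "table (blk m' (\<tau> 0)) (codes gs 0)"
          using mi n_pos by (auto simp: merge_inv_def)
        show "card (codes gs 0) \<le> M" by (rule card_codes[OF g])
        show "valid_code y" "blk m' 6 y = y mod W" if "y \<in> codes gs 0" for y
          using valid[OF that] mi n_pos that by (auto simp: merge_inv_def simp del: mod_Suc)
        show "Suc (y - y mod W + (W ^ (y mod W) + W ^ W)) < Z" if "y \<in> codes gs 0" for y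
        proof -
          from valid[OF that] obtain a \<nu> where y: "y = a + code (wt n) \<nu>" "0 < a" "0 \<notin># \<nu>" "a + sum_mset \<nu> \<le> n"
            by (auto simp: valid_code_def)
          then have "y mod W = a" using state_code_mod[of \<nu> a n] by (simp del: mod_Suc)
          then have "y - y mod W + (W ^ (y mod W) + W ^ W) = code (wt n) (add_mset a \<nu>)"
            using y(1) by (simp add: wt_def del: mod_Suc power_Suc)
          moreover have "1 + code (wt n) (add_mset a \<nu>) < Suc n ^ (n + 2)"
            using y n_pos by (intro state_code_less) auto
          ultimately show ?thesis unfolding Z by simp
        qed
        show "Q (R2, m2)" if "R2 0 = (if \<exists>y\<in>codes gs 0. accepted y then 1 else 0)" for R2 m2
          using that unfolding accepted_iff_tp_yes[OF gs sum] by (rule Q)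
      qed
    qed simp_all
    then show ?thesis unfolding pack_Q_def check_Q_def using e(4) by (simp add: aval_rd)
  qed
  have sing: "sing_Q (R', m')" if gs: "growth gs" "length gs = n - 1" "edges_of gs = edges_of es" "verts gs = {..<n}"
      and gi: "grow_inv gs ?G R' m'" for gs R' m'
  proof -
    have e: "env R'" "low m'" "R' 0 = 0" "R' rI = n - 1"
      and t: "\<And>t. t \<noteq> 3 \<Longrightarrow> t \<noteq> 4 \<Longrightarrow> t \<noteq> 5 \<Longrightarrow> blk m' t = ?G t"
      and par: "\<And>i. i < n - 1 \<Longrightarrow> blk m' 4 i = fst (gs ! i) \<and> blk m' 5 i = snd (gs ! i)"
      using gi gs by (auto simp: grow_inv_def)
    let ?m = "m'(Suc (bs 6) := Suc 0)" and ?R = "R'(rX := 0, rF := bs 8)"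
    have "wp M singletons_loop merge_Q (?R, ?m)"
    proof (rule wp_singletons_loop)
      fix R1 m1 assume a: "\<And>r. r \<noteq> rX \<Longrightarrow> r \<noteq> rF \<Longrightarrow> R1 r = ?R r" "R1 rF = bs (8 + n)" "low m1"
        "\<And>t. t < 7 \<Longrightarrow> blk m1 t = blk ?m t" "\<And>v. v < n \<Longrightarrow> blk m1 7 v = bs (8 + v)"
        "\<And>v. v < n \<Longrightarrow> table (blk m1 (8 + v)) {1}" "\<And>t. 8 + n \<le> t \<Longrightarrow> blk m1 t = (\<lambda>_. 0)"
      have r: "R1 r = R' r" if "r \<noteq> rX" "r \<noteq> rF" for r using a(1)[OF that] that by simp
      have "env R1" using e(1) r unfolding env_def by simp
      moreover have "blk m1 6 (Suc 0) = Suc 0" using a(4)[of 6] t[of 6] by simp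
      ultimately have mi: "merge_inv (codes []) (\<lambda>v. 8 + v) (blk m1) (n - 1) (8 + n) {} R1 m1"
        unfolding merge_inv_def codes_Nil using e r a n_pos table_empty by auto
      show "merge_Q (R1, m1)" unfolding merge_Q_def
      proof (rule wp_merge_loop[OF gs(1,2) _ _ mi])
        show "edges_of gs \<subseteq> edges_of es" using gs(3) by simp
        show "blk m1 4 i = fst (gs ! i) \<and> blk m1 5 i = snd (gs ! i)" if "i < n - 1" for i
          using par[OF that] a(4)[of 4] a(4)[of 5] by simp
      next
        fix \<tau> G' f R2 m2 assume "merge_inv (codes gs) \<tau> G' 0 f {} R2 m2" "\<And>t. t < 6 \<Longrightarrow> G' t = blk m1 t"
        moreover have "blk m1 2 = boundary_fun (length ss)" using a(4)[of 2] t[of 2] by simp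
        ultimately show "pack_Q (R2, m2)" using pack[OF gs] by simp
      qed
    qed (use e t in simp_all)
    moreover have "bs 7 + Z = bs 8" by simp
    ultimately show ?thesis unfolding sing_Q_def using e by (simp add: aval_rd envD del: bs_Suc)
  qed
  have "wp M grow_loop sing_Q (R(rI := 0, rX := 0), m(bs 3 := Suc 0))"
  proof (rule wp_grow_loop)
    show "grow_inv [] ?G (R(rI := 0, rX := 0)) (m(bs 3 := Suc 0))"
      using env b by (auto simp: grow_inv_def growth.Nil visited_def fun_eq_iff)
  next
    fix gs R' m' assume g: "grow_inv gs ?G R' m'" "length gs = n - 1"
    then have "growth gs" "edges_of gs \<subseteq> edges_of es" by (auto simp: grow_inv_def)
    with g tree_growth_complete[OF tree'] show "sing_Q (R', m')" by (intro sing[of gs]) auto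
  qed simp
  then show ?thesis
    unfolding main_prog_def sing_Q_def merge_Q_def pack_Q_def using env by (simp add: aval_rd envD wp_Seq)
qed

end

section \<open>Running times\<close>

lemma (in tp_run) tp_prog_exec:
  "\<exists>t s. exec tp_prog (initial_state (tp_encode (n, es, k, ss))) t s \<and>
    t \<le> cost M init_prog + (btime boundary_cond + 1 + cost 0 boundary_body) * (count_list ss 0 + n + 2) +
      (cost M main_prog + 20) \<and>
    fst s 0 = (if tp_yes (n, es, k, ss) then 1 else 0)"
proof -
  let ?K = "btime boundary_cond + 1 + cost 0 boundary_body"
  have "wp M init_prog (\<lambda>(R, m). boundary_inv 0 R m) (initial_state (tp_encode (n, es, k, ss)))"
    by (rule wp_init_prog) (simp add: boundary_inv_def boundary_fun_def fun_eq_iff)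
  from wp_imp_runs[OF this] obtain t1 R1 m1 where
    1: "exec init_prog (initial_state (tp_encode (n, es, k, ss))) t1 (R1, m1)" "t1 \<le> cost M init_prog" "boundary_inv 0 R1 m1"
    by (auto simp: runs_def)
  from boundary_loop[OF 1(3)] obtain t2 R2 m2 j where
    2: "exec (While boundary_cond boundary_body) (R1, m1) t2 (R2, m2)" "boundary_inv j R2 m2"
       "\<not> (j < length ss \<and> sum_list (take j ss) \<le> n)"
       "t2 \<le> ?K * (count_list (drop 0 ss) 0 + (Suc n - sum_list (take 0 ss)) + 1)" by blast
  have t2: "t2 \<le> ?K * (count_list ss 0 + n + 2)" using 2(4) by simp
  have R2: "R2 rS = sum_list (take j ss)" "R2 rN = n" "R2 0 = 0" "j \<le> length ss"
    using 2(2) by (auto simp: boundary_inv_def env_def)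
  obtain gs where gs: "growth gs" "length gs = n - 1" "edges_of gs = edges_of es" "verts gs = {..<n}"
  proof -
    have "\<exists>gs. growth gs \<and> edges_of gs \<subseteq> edges_of es \<and> length gs = n - 1"
      by (rule tree_exists_growth[OF tree']) simp
    with tree_growth_complete[OF tree'] that show thesis by metis
  qed
  let ?c = "Conj (Neg (Less (Reg rS) (Reg rN))) (Neg (Less (Reg rN) (Reg rS)))"
  have "\<exists>t3 s. exec (Cond ?c main_prog Skip) (R2, m2) t3 s \<and> t3 \<le> cost M main_prog + 20 \<and>
     fst s 0 = (if tp_yes (n, es, k, ss) then 1 else 0)"
  proof (cases "sum_list (take j ss) = n")
    case True
    with 2(3) R2(4) have j: "j = length ss" by auto
    with True have sum: "sum_list ss = n" by simp
    have "boundary_inv (length ss) R2 m2" using 2(2) j by simp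
    from wp_imp_runs[OF wp_main_prog[OF this sum, where Q = "\<lambda>s. fst s 0 = (if tp_yes (n, es, k, ss) then 1 else 0)"]]
    obtain t3 s where 3: "exec main_prog (R2, m2) t3 s" "t3 \<le> cost M main_prog"
      "fst s 0 = (if tp_yes (n, es, k, ss) then 1 else 0)" by (auto simp: runs_def)
    have "bval ?c (R2, m2)" using True R2 by simp
    from exec.CondT[OF this 3(1), of Skip] 3(2,3) show ?thesis
      by (intro exI[of _ "btime ?c + 1 + t3"] exI[of _ s]) simp
  next
    case False
    have "\<not> tp_yes (n, es, k, ss)"
    proof
      assume "tp_yes (n, es, k, ss)"
      with tp_yes_sum_list[OF gs] have sum: "sum_list ss = n" by blast
      with sum_list_take_mono[of j "length ss" ss] R2(4) have "sum_list (take j ss) \<le> n" by simp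
      with 2(3) R2(4) have "j = length ss" by simp
      with sum False show False by simp
    qed
    moreover have "\<not> bval ?c (R2, m2)" using False R2 by auto
    note exec.CondF[OF this exec.Skip, of main_prog]
    ultimately show ?thesis using R2(3)
      by (intro exI[of _ "btime ?c + 1 + 1"] exI[of _ "(R2, m2)"]) simp
  qed
  then obtain t3 s where 3: "exec (Cond ?c main_prog Skip) (R2, m2) t3 s" "t3 \<le> cost M main_prog + 20"
     "fst s 0 = (if tp_yes (n, es, k, ss) then 1 else 0)" by blast
  have "exec tp_prog (initial_state (tp_encode (n, es, k, ss))) (t1 + (t2 + t3)) s"
    unfolding tp_prog_def by (rule exec.Seq[OF 1(1) exec.Seq[OF 2(1) 3(1)]])
  with 1(2) t2 3(2,3) show ?thesis by (intro exI[of _ "t1 + (t2 + t3)"] exI[of _ s]) simp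
qed

section \<open>Constants that are uniform over all instances\<close>

definition loop_bound :: "nat \<Rightarrow> nat" where
  "loop_bound n = n + 2 + card (partitions_upto n n)"

lemma tree_pos: "represents_tree n es \<Longrightarrow> 0 < n"
  by (auto simp: represents_tree_def is_tree_def)

lemma tp_prog_time:
  "\<exists>A D K. \<forall>n es k ss. represents_tree n es \<longrightarrow> (\<exists>t s. exec tp_prog (initial_state (tp_encode (n, es, k, ss))) t s \<and>
     t \<le> A * Suc (loop_bound n) ^ D + K * count_list ss 0 \<and> fst s 0 = (if tp_yes (n, es, k, ss) then 1 else 0))"
proof -
  let ?K = "btime boundary_cond + 1 + cost 0 boundary_body"
  obtain K1 d1 where 1: "\<And>M. cost M init_prog \<le> K1 * Suc M ^ d1" using cost_polynomial by blast
  obtain K2 d2 where 2: "\<And>M. cost M main_prog \<le> K2 * Suc M ^ d2" using cost_polynomial by blast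
  \<comment> \<open>The constants and exponents are kept as the sums that
    \<open>polynomial_bound_add\<close> delivers.\<close>
  let ?A = "(K1 + ?K) + (K2 + 20)" and ?D = "(d1 + 1) + (d2 + 0)"
  have "\<exists>t s. exec tp_prog (initial_state (tp_encode (n, es, k, ss))) t s \<and>
     t \<le> ?A * Suc (loop_bound n) ^ ?D + ?K * count_list ss 0 \<and> fst s 0 = (if tp_yes (n, es, k, ss) then 1 else 0)"
    if tree: "represents_tree n es" for n es k ss
  proof -
    let ?M = "loop_bound n"
    define base where "base = 3 + 2 * (n - 1)"
    define weights where "weights = base + length ss"
    interpret tp_run "weights + n + 2" "Suc n ^ (n + 2)" n es k ss ?M base weights
    proof
      show "1 < Suc n ^ (n + 2)" by (rule one_less_power) (use tree_pos[OF tree] in auto)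
    qed (use tree in \<open>auto simp: base_def weights_def loop_bound_def\<close>)
    from tp_prog_exec obtain t s where
      t: "exec tp_prog (initial_state (tp_encode (n, es, k, ss))) t s"
      "t \<le> cost ?M init_prog + ?K * (count_list ss 0 + n + 2) + (cost ?M main_prog + 20)"
      "fst s 0 = (if tp_yes (n, es, k, ss) then 1 else 0)" by blast
    have "?K * (n + 2) \<le> ?K * Suc ?M ^ 1" by (intro mult_le_mono2) (simp add: loop_bound_def)
    from polynomial_bound_add[OF polynomial_bound_add[OF 1[of ?M] this]
        polynomial_bound_add[OF 2[of ?M], of 20 20 0]]
    have "(cost ?M init_prog + ?K * (n + 2)) + (cost ?M main_prog + 20) \<le> ?A * Suc ?M ^ ?D" by simp
    moreover have "?K * (count_list ss 0 + n + 2) = ?K * (n + 2) + ?K * count_list ss 0"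
      by (simp add: add_mult_distrib2 add.assoc)
    ultimately have "t \<le> ?A * Suc ?M ^ ?D + ?K * count_list ss 0" using t(2) by linarith
    with t show ?thesis by blast
  qed
  then show ?thesis by blast
qed

section \<open>Reduction of the balanced problem\<close>

definition reduce_loop :: com where
  "reduce_loop = While (Neg (Less (Reg 3) (Reg 4))) (Assign 3 (Minus (Reg 3) (Reg 4)) ;; Assign 5 (Plus (Reg 5) (Num 1)))"

definition copy_loop :: com where
  "copy_loop = While (Less (Reg 3) (Reg 4)) (Store (Plus (Reg 6) (Reg 3)) (Reg 5) ;; Assign 3 (Plus (Reg 3) (Num 1)))"

text \<open>The two encodings share their header, with \<open>b\<close> in the place of the number
  of groups, so it suffices to append \<open>b\<close> copies of \<open>n div b\<close>. Values of
  \<open>b\<close> that are 0 or exceed \<open>n\<close> are turned away first: for 0 the repeated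
  subtraction would not end, and otherwise the copying would take too long. Register 7 signals
  success.\<close>

definition expand_prog :: com where
  "expand_prog = (Assign 2 (Mem (Num 0)) ;; Assign 4 (Mem (Num 2)) ;;
     Assign 6 (Plus (Num 3) (Plus (Minus (Reg 2) (Num 1)) (Minus (Reg 2) (Num 1)))) ;;
     Cond (Conj (Less (Num 0) (Reg 4)) (Neg (Less (Reg 2) (Reg 4))))
       (Assign 3 (Reg 2) ;; reduce_loop ;;
        Cond (Less (Reg 3) (Num 1)) (Assign 3 (Num 0) ;; copy_loop ;; Assign 7 (Num 1)) Skip)
       Skip)"

text \<open>\<open>tp_prog\<close> is verified only for registers that are initially 0, so those
  used by the expansion are cleared.\<close>

definition reset_prog :: com where
  "reset_prog = (Assign 2 (Num 0) ;; Assign 3 (Num 0) ;; Assign 4 (Num 0) ;; Assign 5 (Num 0) ;; Assign 6 (Num 0) ;;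
     Assign 7 (Num 0))"

definition btp_prog :: com where
  "btp_prog = (expand_prog ;; Cond (Less (Num 0) (Reg 7)) (reset_prog ;; tp_prog) Skip)"

lemma wp_reduce_loop:
  assumes "R 3 = n" "R 4 = b" "R 5 = 0" "0 < b" "n \<le> M" "Q (R(3 := n mod b, 5 := n div b), m)"
  shows "wp M reduce_loop Q (R, m)"
  unfolding reduce_loop_def
proof (rule wp_while[where I = "\<lambda>i R' m'. R' = R(3 := n - i * b, 5 := i) \<and> m' = m" and N = "n div b"], goal_cases)
  case (2)
  show ?case using assms div_le_dividend[of n b] by linarith
next
  case (3 i R' m')
  then have "Suc i * b \<le> n div b * b" by (intro mult_le_mono1) simp
  also have "\<dots> \<le> n" by simp
  finally have "b + i * b \<le> n" by simp
  with 3 assms show ?case by (auto simp: fun_eq_iff)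
next
  case (4 R' m')
  have "n - n div b * b = n mod b" by (simp add: minus_div_mult_eq_mod)
  with 4 assms show ?case by simp
next
  case (5 R' m')
  have "n - n div b * b = n mod b" by (simp add: minus_div_mult_eq_mod)
  with 5 assms show ?case by simp
qed (use assms in \<open>auto simp: fun_upd_idem\<close>)

lemma wp_copy_loop:
  assumes "R 3 = 0" "R 4 = b" "R 5 = q" "R 6 = a" "b \<le> M"
    "Q (R(3 := b), \<lambda>j. if a \<le> j \<and> j < a + b then q else m j)"
  shows "wp M copy_loop Q (R, m)"
  unfolding copy_loop_def
proof (rule wp_while[where I = "\<lambda>i R' m'. R' = R(3 := i) \<and> m' = (\<lambda>j. if a \<le> j \<and> j < a + i then q else m j)" and N = b], goal_cases)
  case (3 i R' m')
  with assms show ?case by (auto simp: fun_eq_iff)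
qed (use assms in \<open>auto simp: fun_upd_idem\<close>)

lemma wp_expand_prog:
  assumes tree: "represents_tree n es" and M: "n \<le> M"
  shows "wp M expand_prog (\<lambda>(R, m). if 0 < b \<and> b dvd n then R 7 = 1 \<and> (\<forall>r. r < 2 \<or> 7 < r \<longrightarrow> R r = 0) \<and>
      m = snd (initial_state (tp_encode (n, es, k, replicate b (n div b)))) else R 7 = 0 \<and> R 0 = 0)
    (initial_state (btp_encode (n, es, k, b)))"
proof -
  define m where "m = snd (initial_state (btp_encode (n, es, k, b)))"
  let ?a = "3 + 2 * (n - 1)"
  have n: "0 < n" using tree by (rule tree_pos)
  have len: "length (btp_encode (n, es, k, b)) = ?a"
    using represents_tree_length[OF tree] by (simp add: btp_encode_def flatten_edges_length)
  have m: "m 0 = n" "m 2 = b"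
    by (simp_all add: m_def initial_state_def btp_encode_def)
  have enc: "tp_encode (n, es, k, replicate b q) = btp_encode (n, es, k, b) @ replicate b q" for q
    by (simp add: tp_encode_def btp_encode_def)
  have mem: "(\<lambda>j. if ?a \<le> j \<and> j < ?a + b then q else m j) = snd (initial_state (tp_encode (n, es, k, replicate b q)))" for q
    unfolding enc m_def initial_state_def by (auto simp: fun_eq_iff nth_append len)
  have init: "initial_state (btp_encode (n, es, k, b)) = (\<lambda>_. 0, m)"
    by (simp add: m_def initial_state_def)
  have a: "Suc (Suc (Suc (n - Suc 0 + (n - Suc 0)))) = ?a" by simp
  show ?thesis
  proof (cases "0 < b \<and> b \<le> n")
    case False
    then have "\<not> (0 < b \<and> b dvd n)" using n by (auto dest: dvd_imp_le)
    with False m show ?thesis unfolding expand_prog_def init by (auto simp: aval_Mem_rd rd_def)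
  next
    case True
    define R :: "nat \<Rightarrow> nat" where "R = (\<lambda>_. 0)(2 := n, 4 := b, 6 := ?a, 3 := n)"
    have R: "R 3 = n" "R 4 = b" "R 5 = 0" "R 6 = ?a" by (simp_all add: R_def)
    have div: "n mod b = 0 \<longleftrightarrow> 0 < b \<and> b dvd n" using True by (auto simp: dvd_eq_mod_eq_0)
    let ?Q = "\<lambda>(R, m). if 0 < b \<and> b dvd n then R 7 = 1 \<and> (\<forall>r. r < 2 \<or> 7 < r \<longrightarrow> R r = 0) \<and>
      m = snd (initial_state (tp_encode (n, es, k, replicate b (n div b)))) else R 7 = 0 \<and> R 0 = 0"
    let ?c = "Cond (Less (Reg 3) (Num 1)) (Assign 3 (Num 0) ;; copy_loop ;; Assign 7 (Num 1)) Skip"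
    have "wp M ?c ?Q (R(3 := n mod b, 5 := n div b), m)"
    proof (cases "n mod b = 0")
      case False
      with div show ?thesis by (simp add: R_def)
    next
      case mod: True
      let ?R = "R(5 := n div b, 3 := 0)"
      have "wp M copy_loop (wp M (Assign 7 (Num 1)) ?Q) (?R, m)"
        by (rule wp_copy_loop[of _ b "n div b" ?a]) (use R True M div mod mem[of "n div b"] in \<open>auto simp: R_def\<close>)
      with mod show ?thesis by (simp add: fun_upd_twist)
    qed
    then have "wp M reduce_loop (wp M ?c ?Q) (R, m)"
      using R True M by (intro wp_reduce_loop[of R n b]) auto
    then show ?thesis using True m a unfolding expand_prog_def init R_def
      by (simp add: aval_Mem_rd rd_def wp_Seq fun_upd_twist)
  qed
qed

lemma wp_reset_prog:
  assumes "\<And>r. r < 2 \<or> 7 < r \<Longrightarrow> R r = 0"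
  shows "wp M reset_prog (\<lambda>s. s = (\<lambda>_. 0, m)) (R, m)"
proof -
  have "(R(2 := 0, 3 := 0, 4 := 0, 5 := 0, 6 := 0, 7 := 0)) r = 0" for r
  proof -
    have "r < 2 \<or> 7 < r \<or> r = 2 \<or> r = 3 \<or> r = 4 \<or> r = 5 \<or> r = 6 \<or> r = 7" by arith
    then show ?thesis using assms[of r] by auto
  qed
  then show ?thesis unfolding reset_prog_def by (simp add: fun_eq_iff)
qed

lemma btp_yes_iff: "btp_yes (n, es, k, b) \<longleftrightarrow> b dvd n \<and> tp_yes (n, es, k, replicate b (n div b))"
  by (simp add: btp_yes_def tp_yes_def balanced_tree_partitioning_def)

text \<open>If \<open>b\<close> divides \<open>n\<close>, every group size \<open>n div b\<close> is
  positive, so the charge for groups of size 0 vanishes. The constant 30 covers the test and the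
  clearing of registers.\<close>

lemma btp_prog_exec:
  assumes tree: "represents_tree n es"
    and tp: "\<And>ss. \<exists>t s. exec tp_prog (initial_state (tp_encode (n, es, k, ss))) t s \<and>
     t \<le> T + K * count_list ss 0 \<and> fst s 0 = (if tp_yes (n, es, k, ss) then 1 else 0)"
  shows "\<exists>t s. exec btp_prog (initial_state (btp_encode (n, es, k, b))) t s \<and>
     t \<le> cost (loop_bound n) expand_prog + (T + 30) \<and> fst s 0 = (if btp_yes (n, es, k, b) then 1 else 0)"
proof -
  let ?M = "loop_bound n" and ?ss = "replicate b (n div b)"
  have n: "0 < n" using tree by (rule tree_pos)
  have "n \<le> ?M" by (simp add: loop_bound_def)
  from wp_imp_runs[OF wp_expand_prog[OF tree this, of b k]] obtain t1 R m where
    1: "exec expand_prog (initial_state (btp_encode (n, es, k, b))) t1 (R, m)" "t1 \<le> cost ?M expand_prog"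
    and Rm: "if 0 < b \<and> b dvd n then R 7 = 1 \<and> (\<forall>r. r < 2 \<or> 7 < r \<longrightarrow> R r = 0) \<and>
      m = snd (initial_state (tp_encode (n, es, k, ?ss))) else R 7 = 0 \<and> R 0 = 0"
    unfolding runs_def by auto
  show ?thesis
  proof (cases "0 < b \<and> b dvd n")
    case False
    then have "\<not> btp_yes (n, es, k, b)" using n by (auto simp: btp_yes_iff)
    moreover have "R 7 = 0" "R 0 = 0" using Rm False by auto
    moreover from this have "\<not> bval (Less (Num 0) (Reg 7)) (R, m)" by simp
    note exec.Seq[OF 1(1) exec.CondF[OF this exec.Skip, of "reset_prog ;; tp_prog"]]
    ultimately show ?thesis using 1(2) unfolding btp_prog_def
      by (intro exI[of _ "t1 + (btime (Less (Num 0) (Reg 7)) + 1 + 1)"] exI[of _ "(R, m)"]) simp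
  next
    case True
    then have R7: "R 7 = 1" and R: "\<And>r. r < 2 \<or> 7 < r \<Longrightarrow> R r = 0"
      and m: "m = snd (initial_state (tp_encode (n, es, k, ?ss)))" using Rm by auto
    have yes: "btp_yes (n, es, k, b) = tp_yes (n, es, k, ?ss)" using True by (simp add: btp_yes_iff)
    have "0 < n div b" using True n by (auto simp: div_greater_zero_iff dvd_imp_le)
    then have zeros: "count_list ?ss 0 = 0" by (simp add: count_list_0_iff)
    have "(\<lambda>_. 0, m) = initial_state (tp_encode (n, es, k, ?ss))" by (simp add: m initial_state_def)
    with wp_imp_runs[OF wp_reset_prog[where R = R and M = 0 and m = m, OF R]] obtain t2 where
      2: "exec reset_prog (R, m) t2 (initial_state (tp_encode (n, es, k, ?ss)))" "t2 \<le> cost 0 reset_prog"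
      by (auto simp: runs_def)
    from tp[of ?ss] obtain t3 s where 3: "exec tp_prog (initial_state (tp_encode (n, es, k, ?ss))) t3 s" "t3 \<le> T"
      "fst s 0 = (if tp_yes (n, es, k, ?ss) then 1 else 0)" unfolding zeros by auto
    have "bval (Less (Num 0) (Reg 7)) (R, m)" using R7 by simp
    from exec.Seq[OF 1(1) exec.CondT[OF this exec.Seq[OF 2(1) 3(1)], of Skip]] 1(2) 2(2) 3(2,3) show ?thesis
      unfolding btp_prog_def yes reset_prog_def
      by (intro exI[of _ "t1 + (btime (Less (Num 0) (Reg 7)) + 1 + (t2 + t3))"] exI[of _ s]) simp
  qed
qed

section \<open>From the number of partitions to the exponent\<close>

lemma loop_bound_exp:
  assumes "0 < n"
  shows "real (Suc (loop_bound n)) \<le> exp (11 * sqrt (real n))"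
proof -
  define s where "s = sqrt (real n)"
  have s: "1 \<le> s" "real n = s\<^sup>2" using assms by (auto simp: s_def)
  have "s \<le> exp s" using exp_ge_add_one_self[of s] by linarith
  then have "s\<^sup>2 \<le> exp s ^ 2" using s(1) by (intro power_mono) auto
  then have a: "real n \<le> exp (2 * s)" by (simp add: s(2) exp_double)
  have b: "3 \<le> exp (2 * s)" using exp_ge_add_one_self[of "2 * s"] s(1) by linarith
  have c: "exp (2 * s) \<le> exp (9 * s)" using s(1) by simp
  have d: "real (card (partitions_upto n n)) \<le> exp (9 * s)" unfolding s_def by (rule card_partitions_upto(2)[OF assms])
  have "real (Suc (loop_bound n)) = real n + 3 + real (card (partitions_upto n n))" by (simp add: loop_bound_def)
  \<comment> \<open>Each of the three summands is at most \<open>exp (9 * s)\<close>; the factor 3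
    is absorbed by \<open>exp (2 * s)\<close>, whence 11 = 9 + 2.\<close>
  also have "\<dots> \<le> 3 * exp (9 * s)" using a b c d by linarith
  also have "\<dots> \<le> exp (2 * s) * exp (9 * s)" using b by (intro mult_right_mono) auto
  also have "\<dots> = exp (11 * s)" by (simp flip: exp_add)
  finally show ?thesis unfolding s_def .
qed

text \<open>For positive \<open>n\<close> the square root is at least 1, so that the factor
  \<open>A\<close> can be absorbed as \<open>exp (A * sqrt n)\<close>. Dividing by
  \<open>ln 2\<close> changes the base from e to 2.\<close>

lemma polynomial_loop_bound:
  assumes "0 < n"
  shows "real (A * Suc (loop_bound n) ^ D) \<le> 2 powr ((real A + 11 * real D) / ln 2 * sqrt (real n))"
proof -
  define s where "s = sqrt (real n)"
  have s: "1 \<le> s" using assms by (simp add: s_def)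
  have "real A \<le> exp (real A)" using exp_ge_add_one_self[of "real A"] by linarith
  also have "\<dots> \<le> exp (real A * s)" using s mult_left_mono[of 1 s "real A"] by simp
  finally have A: "real A \<le> exp (real A * s)" .
  have "real (Suc (loop_bound n)) ^ D \<le> exp (11 * s) ^ D"
    using loop_bound_exp[OF assms] unfolding s_def by (intro power_mono) auto
  also have "\<dots> = exp (11 * real D * s)" by (simp add: exp_of_nat_mult[symmetric] ac_simps)
  finally have "real A * real (Suc (loop_bound n)) ^ D \<le> exp (real A * s) * exp (11 * real D * s)"
    using A by (intro mult_mono) auto
  also have "\<dots> = exp ((real A + 11 * real D) * s)" by (simp add: exp_add[symmetric] distrib_right)
  also have "\<dots> = 2 powr ((real A + 11 * real D) / ln 2 * s)" by (simp add: powr_def)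
  finally show ?thesis unfolding s_def by simp
qed

theorem theorem3:
  "(\<exists>P f c. f \<in> O(\<lambda>n. sqrt (real n)) \<and>
      decides_in_time P tp_encode tp_instances tp_yes (tp_time f c)) \<and>
   (\<exists>P f. f \<in> O(\<lambda>n. sqrt (real n)) \<and>
      decides_in_time P btp_encode btp_instances btp_yes (btp_time f))"
proof -
  from tp_prog_time obtain A D K where tp: "\<And>n es k ss. represents_tree n es \<Longrightarrow>
     \<exists>t s. exec tp_prog (initial_state (tp_encode (n, es, k, ss))) t s \<and>
     t \<le> A * Suc (loop_bound n) ^ D + K * count_list ss 0 \<and> fst s 0 = (if tp_yes (n, es, k, ss) then 1 else 0)" by blast
  have O: "(\<lambda>n. C * sqrt (real n)) \<in> O(\<lambda>n. sqrt (real n))" for C by simp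
  let ?f = "\<lambda>n. (real A + 11 * real D) / ln 2 * sqrt (real n)"
  have "decides_in_time tp_prog tp_encode tp_instances tp_yes (tp_time ?f K)"
    unfolding decides_in_time_def
  proof
    fix x assume "x \<in> tp_instances"
    then obtain n es k ss where x: "x = (n, es, k, ss)" "represents_tree n es" by (auto simp: tp_instances_def)
    from tp[OF x(2), of k ss] obtain t s where
      t: "exec tp_prog (initial_state (tp_encode (n, es, k, ss))) t s"
      "t \<le> A * Suc (loop_bound n) ^ D + K * count_list ss 0" "fst s 0 = (if tp_yes (n, es, k, ss) then 1 else 0)" by blast
    have "real t \<le> real (A * Suc (loop_bound n) ^ D) + real (K * count_list ss 0)"
      using t(2) by (metis of_nat_add of_nat_le_iff)
    also have "\<dots> \<le> tp_time ?f K x"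
      unfolding tp_time_def x(1) prod.case
      using polynomial_loop_bound[OF tree_pos[OF x(2)], of A D] by (rule add_right_mono)
    finally show "\<exists>t s. exec tp_prog (initial_state (tp_encode x)) t s \<and>
       real t \<le> tp_time ?f K x \<and> fst s 0 = (if tp_yes x then 1 else 0)"
      using t x(1) by blast
  qed
  moreover obtain K' d where e: "\<And>M. cost M expand_prog \<le> K' * Suc M ^ d" using cost_polynomial by blast
  let ?A = "K' + (A + 30)" and ?D = "d + (D + 0)"
  let ?g = "\<lambda>n. (real ?A + 11 * real ?D) / ln 2 * sqrt (real n)"
  have "decides_in_time btp_prog btp_encode btp_instances btp_yes (btp_time ?g)"
    unfolding decides_in_time_def
  proof
    fix x assume "x \<in> btp_instances"
    then obtain n es k b where x: "x = (n, es, k, b)" "represents_tree n es" by (auto simp: btp_instances_def)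
    from btp_prog_exec[OF x(2), where k = k and b = b, OF tp[OF x(2)]] obtain t s where
      t: "exec btp_prog (initial_state (btp_encode (n, es, k, b))) t s"
      "t \<le> cost (loop_bound n) expand_prog + (A * Suc (loop_bound n) ^ D + 30)"
      "fst s 0 = (if btp_yes (n, es, k, b) then 1 else 0)" by blast
    have "cost (loop_bound n) expand_prog + (A * Suc (loop_bound n) ^ D + 30) \<le> ?A * Suc (loop_bound n) ^ ?D"
      by (intro polynomial_bound_add e) simp_all
    with t(2) have "real t \<le> real (?A * Suc (loop_bound n) ^ ?D)" by (simp only: of_nat_le_iff)
    also have "\<dots> \<le> btp_time ?g x"
      unfolding btp_time_def x(1) prod.case by (rule polynomial_loop_bound[OF tree_pos[OF x(2)]])
    finally show "\<exists>t s. exec btp_prog (initial_state (btp_encode x)) t s \<and>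
       real t \<le> btp_time ?g x \<and> fst s 0 = (if btp_yes x then 1 else 0)"
      using t x(1) by blast
  qed
  ultimately show ?thesis using O by blast
qed

end
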